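(* Let $P$ be the true distribution of the full data and let $\Lambda_1,\Lambda_2,\Gamma_1,\Gamma_2$ be pre-specified real-valued measurable functions of $X$ with $\Lambda_2(X)\ge 1\ge \Lambda_1(X)\ge 0$ and $\Gamma_2(X)\ge 1\ge\Gamma_1(X)\ge 0$. Under deMSM with parameters $(\Lambda_1,\Lambda_2,\Gamma_1,\Gamma_2)$, the sharp lower and upper bounds for $\nu^1(X)=E(Y^1\mid T=0,X)$, namely $\nu^{1-}_{\mathrm{deMSM}}(X)=\inf_Q E_Q(Y^1\mid T=0,X)$ and $\nu^{1+}_{\mathrm{deMSM}}(X)=\sup_Q E_Q(Y^1\mid T=0,X)$ over all $Q$ in deMSM, are $$\nu^{1-}_{\mathrm{deMSM}}(X)=E(Y\mid T=1,X)-\{\bar\Lambda_2(X)-\bar\Lambda_1(X)\}\,E\big(\rho^*_{1,1-\bar\tau}\mid T=1,X\big),$$ $$\nu^{1+}_{\mathrm{deMSM}}(X)=E(Y\mid T=1,X)+\{\bar\Lambda_2(X)-\bar\Lambda_1(X)\}\,E\big(\rho^*_{1,\bar\tau}\mid T=1,X\big),$$ and the sharp lower and upper bounds for $\mu^1=E(Y^1)$, namely $\inf_Q E_Q(Y^1)$ and $\sup_Q E_Q(Y^1)$ over all $Q$ in deMSM, are respectively $$\mu^{1-}_{\mathrm{deMSM}}=E\{TY+(1-T)\nu^{1-}_{\mathrm{deMSM}}(X)\},\qquad \mu^{1+}_{\mathrm{deMSM}}=E\{TY+(1-T)\nu^{1+}_{\mathrm{deMSM}}(X)\}.$$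
   Context: Setting. $X$ is a vector of measured covariates, $T\in\{0,1\}$ a treatment, $Y^0,Y^1$ real-valued potential outcomes, $U$ an unmeasured covariate with values in some standard Borel space (which may depend on the joint distribution considered), and the observed outcome is $Y=TY^1+(1-T)Y^0$ (consistency). $P$ is the true joint distribution of $(Y^0,Y^1,T,X,U)$; $E$ is expectation under $P$, $E_Q$ under a joint distribution $Q$. Conventions: $0<P(T=1\mid X)<1$ almost surely, $Y$ is integrable, density ratios (Radon–Nikodym derivatives) are required to exist, constraints on them hold almost surely, and suprema/infima over $Q$ of functions of $X$ are understood conditionally on $X$ (as essential suprema/infima). deMSM with parameters $(\Lambda_1,\Lambda_2,\Gamma_1,\Gamma_2)$ is the collection of joint distributions $Q$ of $(Y^0,Y^1,T,X,U)$ such that: (i) $Q$ and $P$ induce the same distribution of $(Y,T,X)$; (ii) under $Q$, $(Y^0,Y^1)\perp T\mid X,U$; $$\lambda_Q(X,U)=\frac{dQ(U\mid T=0,X)}{dQ(U\mid T=1,X)}\in[\Lambda_1(X),\Lambda_2(X)];\qquad \omega_Q(Y^1,X,U)=\frac{dQ(Y^1\mid X,U)}{dQ(Y^1\mid T=1,X)}\in[\Gamma_1(X),\Gamma_2(X)].$$ Notation. $\tau(X)=\{\Lambda_2(X)-1\}/\{\Lambda_2(X)-\Lambda_1(X)\}$, set to $1/2$ if $\Lambda_1(X)=\Lambda_2(X)=1$; $\tau_\Gamma(X)$ is defined the same way with $(\Gamma_1,\Gamma_2)$ in place of $(\Lambda_1,\Lambda_2)$. Define $$\bar\Lambda_1=1-(\Lambda_2-\Lambda_1)(\Gamma_2-\Gamma_1)\min\{(1-\tau)(1-\tau_\Gamma),\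 \tau\tau_\Gamma\},$$ $$\bar\Lambda_2=1+(\Lambda_2-\Lambda_1)(\Gamma_2-\Gamma_1)\min\{(1-\tau)\tau_\Gamma,\ \tau(1-\tau_\Gamma)\}$$ (all functions of $X$), and $\bar\tau(X)=\{\bar\Lambda_2(X)-1\}/\{\bar\Lambda_2(X)-\bar\Lambda_1(X)\}$, set to $1/2$ if $\bar\Lambda_1(X)=\bar\Lambda_2(X)=1$. For $\gamma=\gamma(X)\in(0,1)$, $\rho_\gamma(y,q)=\gamma(y-q)_+ +(1-\gamma)(q-y)_+$ with $c_+=\max\{c,0\}$, $q^*_{1,\gamma}(X)$ is a $\gamma(X)$-quantile of $Y$ given $T=1,X$, i.e. a minimizer over $q\in\mathbb{R}$ of $E\{\rho_\gamma(Y,q)\mid T=1,X\}$, and $\rho^*_{1,\gamma}=\rho_\gamma(Y,q^*_{1,\gamma}(X))$.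
   Formalization: The bounds for μ¹ are proved assuming some Q in deMSM makes Y¹ integrable, with inf/sup over those Q for which E_Q(Y¹) exists (possibly infinite), since integrability of Y alone does not ensure this; U under Q takes values in a standard Borel space carried by a set of reals. *)

theory Defs
  imports "HOL-Probability.Probability"
begin

section \<open>Standard Borel spaces and conditional laws\<close>

definition standard_borel :: "'a measure \<Rightarrow> bool" where
  "standard_borel M \<longleftrightarrow>
     (\<exists>S. completely_metrizable_space S \<and> second_countable S \<and> topspace S = space M \<and>
          sets M = sigma_sets (topspace S) {V. openin S V})"

text \<open>\<open>cond_law Q V MV W MW K\<close>: the kernel \<open>K\<close> is a regular conditional distribution
  of \<open>W\<close> given \<open>V\<close> under \<open>Q\<close>. In the situations below such a kernel exists and is unique up to
  null sets of the law of \<open>V\<close>.\<close>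

definition cond_law ::
  "'a measure \<Rightarrow> ('a \<Rightarrow> 'b) \<Rightarrow> 'b measure \<Rightarrow> ('a \<Rightarrow> 'c) \<Rightarrow> 'c measure \<Rightarrow> ('b \<Rightarrow> 'c measure) \<Rightarrow> bool"
where
  "cond_law Q V MV W MW K \<longleftrightarrow>
     K \<in> MV \<rightarrow>\<^sub>M prob_algebra MW \<and>
     (\<forall>A\<in>sets MV. \<forall>B\<in>sets MW.
        emeasure Q {\<omega> \<in> space Q. V \<omega> \<in> A \<and> W \<omega> \<in> B} =
        (\<integral>\<^sup>+\<omega>. indicator A (V \<omega>) * emeasure (K (V \<omega>)) B \<partial>Q))"

definition cond_indep ::
  "'a measure \<Rightarrow> ('a \<Rightarrow> 'b) \<Rightarrow> 'b measure \<Rightarrow> ('a \<Rightarrow> 'c) \<Rightarrow> 'c measure \<Rightarrow> ('a \<Rightarrow> 'd) \<Rightarrow> 'd measure \<Rightarrow> bool"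
where
  "cond_indep Q V MV W MW Z MZ \<longleftrightarrow>
     (\<forall>A\<in>sets MV. \<forall>B\<in>sets MW. AE \<omega> in Q.
        real_cond_exp Q (vimage_algebra (space Q) Z MZ) (\<lambda>\<omega>. indicator A (V \<omega>) * indicator B (W \<omega>)) \<omega> =
        real_cond_exp Q (vimage_algebra (space Q) Z MZ) (\<lambda>\<omega>. indicator A (V \<omega>)) \<omega> *
        real_cond_exp Q (vimage_algebra (space Q) Z MZ) (\<lambda>\<omega>. indicator B (W \<omega>)) \<omega>)"

definition is_esssup :: "'a measure \<Rightarrow> ('a \<Rightarrow> real) set \<Rightarrow> ('a \<Rightarrow> real) \<Rightarrow> bool" where
  "is_esssup M F g \<longleftrightarrow>
     g \<in> borel_measurable M \<and>
     (\<forall>f\<in>F. AE x in M. f x \<le> g x) \<and>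
     (\<forall>h\<in>borel_measurable M. (\<forall>f\<in>F. AE x in M. f x \<le> h x) \<longrightarrow> (AE x in M. g x \<le> h x))"

definition is_essinf :: "'a measure \<Rightarrow> ('a \<Rightarrow> real) set \<Rightarrow> ('a \<Rightarrow> real) \<Rightarrow> bool" where
  "is_essinf M F g \<longleftrightarrow>
     g \<in> borel_measurable M \<and>
     (\<forall>f\<in>F. AE x in M. g x \<le> f x) \<and>
     (\<forall>h\<in>borel_measurable M. (\<forall>f\<in>F. AE x in M. h x \<le> f x) \<longrightarrow> (AE x in M. h x \<le> g x))"

text \<open>The integral with values in the extended reals; it is meaningful for \<open>quasi_integrable\<close>
  functions only, since \<open>\<infinity> - \<infinity> = \<infinity>\<close> in \<^typ>\<open>ereal\<close>.\<close>

definition quasi_integrable :: "'a measure \<Rightarrow> ('a \<Rightarrow> real) \<Rightarrow> bool" where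
  "quasi_integrable M f \<longleftrightarrow>
     f \<in> borel_measurable M \<and>
     ((\<integral>\<^sup>+x. ennreal (f x) \<partial>M) < \<infinity> \<or> (\<integral>\<^sup>+x. ennreal (- f x) \<partial>M) < \<infinity>)"

definition ext_integral :: "'a measure \<Rightarrow> ('a \<Rightarrow> real) \<Rightarrow> ereal" where
  "ext_integral M f =
     enn2ereal (\<integral>\<^sup>+x. ennreal (f x) \<partial>M) - enn2ereal (\<integral>\<^sup>+x. ennreal (- f x) \<partial>M)"


section \<open>Full data\<close>

text \<open>A full-data point is \<open>(Y\<^sup>0, Y\<^sup>1, T, X, U)\<close>, with \<open>T = 1\<close> encoded as \<^const>\<open>True\<close>.\<close>

type_synonym ('x, 'u) full = "real \<times> real \<times> bool \<times> 'x \<times> 'u"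

fun outcome0 :: "('x, 'u) full \<Rightarrow> real" where "outcome0 (y0, y1, t, x, u) = y0"
fun outcome1 :: "('x, 'u) full \<Rightarrow> real" where "outcome1 (y0, y1, t, x, u) = y1"
fun treat :: "('x, 'u) full \<Rightarrow> bool" where "treat (y0, y1, t, x, u) = t"
fun covar :: "('x, 'u) full \<Rightarrow> 'x" where "covar (y0, y1, t, x, u) = x"
fun unmeas :: "('x, 'u) full \<Rightarrow> 'u" where "unmeas (y0, y1, t, x, u) = u"

definition observed :: "('x, 'u) full \<Rightarrow> real" where
  "observed \<omega> = of_bool (treat \<omega>) * outcome1 \<omega> + (1 - of_bool (treat \<omega>)) * outcome0 \<omega>"

definition treat_covar :: "('x, 'u) full \<Rightarrow> bool \<times> 'x" where
  "treat_covar \<omega> = (treat \<omega>, covar \<omega>)"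

abbreviation TX_space :: "(bool \<times> 'x::polish_space) measure" where
  "TX_space \<equiv> count_space UNIV \<Otimes>\<^sub>M borel"

definition full_space :: "'u measure \<Rightarrow> ('x::polish_space, 'u) full measure" where
  "full_space MU = borel \<Otimes>\<^sub>M (borel \<Otimes>\<^sub>M (count_space UNIV \<Otimes>\<^sub>M (borel \<Otimes>\<^sub>M MU)))"

definition full_law :: "'u measure \<Rightarrow> ('x::polish_space, 'u) full measure \<Rightarrow> bool" where
  "full_law MU Q \<longleftrightarrow> standard_borel MU \<and> prob_space Q \<and> sets Q = sets (full_space MU)"

definition observed_law :: "('x::polish_space, 'u) full measure \<Rightarrow> (real \<times> bool \<times> 'x) measure" where
  "observed_law Q =
     distr Q (borel \<Otimes>\<^sub>M (count_space UNIV \<Otimes>\<^sub>M borel)) (\<lambda>\<omega>. (observed \<omega>, treat \<omega>, covar \<omega>))"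

abbreviation covar_law :: "('x::polish_space, 'u) full measure \<Rightarrow> 'x measure" where
  "covar_law Q \<equiv> distr Q borel covar"

definition overlap :: "('x::polish_space, 'u) full measure \<Rightarrow> bool" where
  "overlap P \<longleftrightarrow>
     (AE \<omega> in P. real_cond_exp P (vimage_algebra (space P) covar borel) (\<lambda>\<omega>. of_bool (treat \<omega>)) \<omega> \<in> {0<..<1})"


section \<open>The sensitivity model\<close>

text \<open>Almost-sure constraints on a density ratio refer to the measure in its denominator, with
  respect to which a Radon-Nikodym derivative is determined: a lower bound must also hold where
  the ratio vanishes.\<close>

definition lambda_constraint ::
  "('x::polish_space \<Rightarrow> real) \<Rightarrow> ('x \<Rightarrow> real) \<Rightarrow> 'u measure \<Rightarrow> ('x, 'u) full measure \<Rightarrow> bool" where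
  "lambda_constraint \<Lambda>1 \<Lambda>2 MU Q \<longleftrightarrow>
     (\<exists>K. cond_law Q treat_covar TX_space unmeas MU K \<and>
        (AE x in covar_law Q.
           absolutely_continuous (K (True, x)) (K (False, x)) \<and>
           (AE u in K (True, x).
              RN_deriv (K (True, x)) (K (False, x)) u \<in> {ennreal (\<Lambda>1 x)..ennreal (\<Lambda>2 x)})))"

definition omega_constraint ::
  "('x::polish_space \<Rightarrow> real) \<Rightarrow> ('x \<Rightarrow> real) \<Rightarrow> 'u measure \<Rightarrow> ('x, 'u) full measure \<Rightarrow> bool" where
  "omega_constraint \<Gamma>1 \<Gamma>2 MU Q \<longleftrightarrow>
     (\<exists>K J. cond_law Q (\<lambda>\<omega>. (covar \<omega>, unmeas \<omega>)) (borel \<Otimes>\<^sub>M MU) outcome1 borel K \<and>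
        cond_law Q treat_covar TX_space outcome1 borel J \<and>
        (AE (x, u) in distr Q (borel \<Otimes>\<^sub>M MU) (\<lambda>\<omega>. (covar \<omega>, unmeas \<omega>)).
           absolutely_continuous (J (True, x)) (K (x, u)) \<and>
           (AE y in J (True, x).
              RN_deriv (J (True, x)) (K (x, u)) y \<in> {ennreal (\<Gamma>1 x)..ennreal (\<Gamma>2 x)})))"

definition deMSM ::
  "('x::polish_space, 'v) full measure \<Rightarrow> ('x \<Rightarrow> real) \<Rightarrow> ('x \<Rightarrow> real) \<Rightarrow> ('x \<Rightarrow> real) \<Rightarrow> ('x \<Rightarrow> real) \<Rightarrow>
   'u measure \<Rightarrow> ('x, 'u) full measure \<Rightarrow> bool" where
  "deMSM P \<Lambda>1 \<Lambda>2 \<Gamma>1 \<Gamma>2 MU Q \<longleftrightarrow>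
     full_law MU Q \<and>
     observed_law Q = observed_law P \<and>
     cond_indep Q (\<lambda>\<omega>. (outcome0 \<omega>, outcome1 \<omega>)) (borel \<Otimes>\<^sub>M borel) treat (count_space UNIV)
       (\<lambda>\<omega>. (covar \<omega>, unmeas \<omega>)) (borel \<Otimes>\<^sub>M MU) \<and>
     lambda_constraint \<Lambda>1 \<Lambda>2 MU Q \<and>
     omega_constraint \<Gamma>1 \<Gamma>2 MU Q"

text \<open>The space of \<open>U\<close> varies with \<open>Q\<close>. A standard Borel space has at most the cardinality of the
  continuum, so every such space is isomorphic to one whose carrier is a set of reals;
  \<open>MU\<close> below is an arbitrary standard Borel structure on an arbitrary such set, not
  necessarily related to the usual topology.\<close>

definition deMSM_laws ::
  "('x::polish_space, 'v) full measure \<Rightarrow> ('x \<Rightarrow> real) \<Rightarrow> ('x \<Rightarrow> real) \<Rightarrow> ('x \<Rightarrow> real) \<Rightarrow> ('x \<Rightarrow> real) \<Rightarrow>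
   ('x, real) full measure set" where
  "deMSM_laws P \<Lambda>1 \<Lambda>2 \<Gamma>1 \<Gamma>2 = {Q. \<exists>MU :: real measure. deMSM P \<Lambda>1 \<Lambda>2 \<Gamma>1 \<Gamma>2 MU Q}"

text \<open>\<open>g\<close> is a version of \<open>x \<mapsto> E\<^sub>Q(Y\<^sup>1 | T = 0, X = x)\<close>. For \<open>Q\<close> in the model, \<open>Y\<^sup>1\<close> is automatically
  integrable under almost every conditional law: its absolute mean there is at most \<open>\<Gamma>2 x\<close> times
  that of \<open>Y\<close> given \<open>T = 1, X = x\<close>. It need not be integrable under \<open>Q\<close>, even though \<open>Y\<close> is. If,
  for instance, \<open>\<Lambda>1 = \<Lambda>2 = \<Gamma>1 = \<Gamma>2 = 1\<close> and \<open>Y = \<plusminus>M(X)\<close> symmetrically given \<open>T = 1, X\<close>, where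
  \<open>M(X) P(T = 1 | X)\<close> has finite expectation and \<open>M(X) P(T = 0 | X)\<close> does not, then no \<open>Q\<close> in the model
  has a mean of \<open>Y\<^sup>1\<close>, not even an infinite one. Bounds on this mean therefore range over the
  \<open>Q\<close> for which it exists.\<close>

definition is_cond_mean_untreated :: "('x::polish_space, 'u) full measure \<Rightarrow> ('x \<Rightarrow> real) \<Rightarrow> bool" where
  "is_cond_mean_untreated Q g \<longleftrightarrow>
     g \<in> borel_measurable borel \<and>
     (\<exists>J. cond_law Q treat_covar TX_space outcome1 borel J \<and>
        (AE x in covar_law Q. g x = (\<integral>y. y \<partial>J (False, x))))"


section \<open>Bounds\<close>

definition tau :: "('x \<Rightarrow> real) \<Rightarrow> ('x \<Rightarrow> real) \<Rightarrow> 'x \<Rightarrow> real" where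
  "tau L1 L2 x = (if L1 x = 1 \<and> L2 x = 1 then 1/2 else (L2 x - 1) / (L2 x - L1 x))"

definition bar1 ::
  "('x \<Rightarrow> real) \<Rightarrow> ('x \<Rightarrow> real) \<Rightarrow> ('x \<Rightarrow> real) \<Rightarrow> ('x \<Rightarrow> real) \<Rightarrow> 'x \<Rightarrow> real" where
  "bar1 \<Lambda>1 \<Lambda>2 \<Gamma>1 \<Gamma>2 x =
     1 - (\<Lambda>2 x - \<Lambda>1 x) * (\<Gamma>2 x - \<Gamma>1 x) *
       min ((1 - tau \<Lambda>1 \<Lambda>2 x) * (1 - tau \<Gamma>1 \<Gamma>2 x)) (tau \<Lambda>1 \<Lambda>2 x * tau \<Gamma>1 \<Gamma>2 x)"

definition bar2 ::
  "('x \<Rightarrow> real) \<Rightarrow> ('x \<Rightarrow> real) \<Rightarrow> ('x \<Rightarrow> real) \<Rightarrow> ('x \<Rightarrow> real) \<Rightarrow> 'x \<Rightarrow> real" where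
  "bar2 \<Lambda>1 \<Lambda>2 \<Gamma>1 \<Gamma>2 x =
     1 + (\<Lambda>2 x - \<Lambda>1 x) * (\<Gamma>2 x - \<Gamma>1 x) *
       min ((1 - tau \<Lambda>1 \<Lambda>2 x) * tau \<Gamma>1 \<Gamma>2 x) (tau \<Lambda>1 \<Lambda>2 x * (1 - tau \<Gamma>1 \<Gamma>2 x))"

definition tau_bar ::
  "('x \<Rightarrow> real) \<Rightarrow> ('x \<Rightarrow> real) \<Rightarrow> ('x \<Rightarrow> real) \<Rightarrow> ('x \<Rightarrow> real) \<Rightarrow> 'x \<Rightarrow> real" where
  "tau_bar \<Lambda>1 \<Lambda>2 \<Gamma>1 \<Gamma>2 = tau (bar1 \<Lambda>1 \<Lambda>2 \<Gamma>1 \<Gamma>2) (bar2 \<Lambda>1 \<Lambda>2 \<Gamma>1 \<Gamma>2)"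

definition rho :: "real \<Rightarrow> real \<Rightarrow> real \<Rightarrow> real" where
  "rho \<gamma> y q = \<gamma> * max (y - q) 0 + (1 - \<gamma>) * max (q - y) 0"

text \<open>In what follows \<open>K\<close> is a conditional law of \<open>Y\<close> given \<open>(T, X)\<close> under \<open>P\<close>, so that
  \<open>\<integral>y. f y \<partial>K (True, x)\<close> is \<open>E(f(Y) | T = 1, X = x)\<close>.\<close>

definition treated_quantile ::
  "('x::polish_space, 'v) full measure \<Rightarrow> (bool \<times> 'x \<Rightarrow> real measure) \<Rightarrow> ('x \<Rightarrow> real) \<Rightarrow> ('x \<Rightarrow> real) \<Rightarrow> bool"
where
  "treated_quantile P K \<gamma> q \<longleftrightarrow>
     q \<in> borel_measurable borel \<and>
     (AE x in covar_law P. \<forall>r. (\<integral>y. rho (\<gamma> x) y (q x) \<partial>K (True, x)) \<le> (\<integral>y. rho (\<gamma> x) y r \<partial>K (True, x)))"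

definition nu_lower ::
  "('x \<Rightarrow> real) \<Rightarrow> ('x \<Rightarrow> real) \<Rightarrow> ('x \<Rightarrow> real) \<Rightarrow> ('x \<Rightarrow> real) \<Rightarrow>
   (bool \<times> 'x \<Rightarrow> real measure) \<Rightarrow> ('x \<Rightarrow> real) \<Rightarrow> 'x \<Rightarrow> real" where
  "nu_lower \<Lambda>1 \<Lambda>2 \<Gamma>1 \<Gamma>2 K q x =
     (\<integral>y. y \<partial>K (True, x)) -
     (bar2 \<Lambda>1 \<Lambda>2 \<Gamma>1 \<Gamma>2 x - bar1 \<Lambda>1 \<Lambda>2 \<Gamma>1 \<Gamma>2 x) *
       (\<integral>y. rho (1 - tau_bar \<Lambda>1 \<Lambda>2 \<Gamma>1 \<Gamma>2 x) y (q x) \<partial>K (True, x))"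

definition nu_upper ::
  "('x \<Rightarrow> real) \<Rightarrow> ('x \<Rightarrow> real) \<Rightarrow> ('x \<Rightarrow> real) \<Rightarrow> ('x \<Rightarrow> real) \<Rightarrow>
   (bool \<times> 'x \<Rightarrow> real measure) \<Rightarrow> ('x \<Rightarrow> real) \<Rightarrow> 'x \<Rightarrow> real" where
  "nu_upper \<Lambda>1 \<Lambda>2 \<Gamma>1 \<Gamma>2 K q x =
     (\<integral>y. y \<partial>K (True, x)) +
     (bar2 \<Lambda>1 \<Lambda>2 \<Gamma>1 \<Gamma>2 x - bar1 \<Lambda>1 \<Lambda>2 \<Gamma>1 \<Gamma>2 x) *
       (\<integral>y. rho (tau_bar \<Lambda>1 \<Lambda>2 \<Gamma>1 \<Gamma>2 x) y (q x) \<partial>K (True, x))"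

text \<open>\<open>T Y + (1 - T) \<nu>(X)\<close>\<close>

definition impute :: "('x \<Rightarrow> real) \<Rightarrow> ('x, 'u) full \<Rightarrow> real" where
  "impute \<nu> \<omega> = of_bool (treat \<omega>) * observed \<omega> + (1 - of_bool (treat \<omega>)) * \<nu> (covar \<omega>)"

end

theory Submission
  imports Defs
begin

text \<open>Fix \<open>x\<close>, let \<open>F\<close> be the law of \<open>Y\<close> given \<open>T = 1, X = x\<close>, and let \<open>G\<close> be the law of \<open>Y\<^sup>1\<close> given
  \<open>T = 0, X = x\<close> under a law of the model. By conditional independence \<open>G\<close> has density
  \<open>w(y) = E(\<omega>(y, U) \<lambda>(U) | T = 1, x)\<close> with respect to \<open>F\<close>, where \<open>\<omega>\<close> and \<open>\<lambda>\<close> both have conditional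
  mean 1. Integrating \<open>(\<Gamma>\<^sub>2 - \<omega>)(\<lambda> - \<Lambda>\<^sub>1) \<ge> 0\<close> and its three companions confines \<open>w\<close> to the range
  between the two functions \<open>bar1\<close> and \<open>bar2\<close>. Conversely every such \<open>w\<close> of mean 1 arises: let \<open>\<lambda>\<close> be
  two-valued and \<open>\<omega>\<close> affine in \<open>w\<close> on either of the two events, with slopes \<open>1 / (1 - \<Lambda>\<^sub>1)\<close> and
  \<open>- 1 / (\<Lambda>\<^sub>2 - 1)\<close>. By a Neyman-Pearson argument,
  \<open>\<integral> y w dF\<close> is largest for the weight that is maximal above a quantile and minimal below it.\<close>

section \<open>Regular conditional laws\<close>

text \<open>The constants come from a two-point problem. Given \<open>T = 1\<close>, a variable of
  mean 1 with values \<Lambda>1 and \<Lambda>2 takes the upper one with probability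
  \<open>(1 - \<Lambda>1) / (\<Lambda>2 - \<Lambda>1)\<close>. If \<omega>, at fixed y, has one
  value on each of the two events, then the demands that \<omega> have mean 1 and \<omega> \<lambda>
  have mean w(y) are two linear equations with a single solution, and this solution has the slopes
  named above. It stays between \<Gamma>1 and \<Gamma>2 exactly when w - 1 obeys four inequalities,
  whose right-hand sides are the four products inside the bars. This is why necessity and
  construction meet. Conditional laws and density ratios are fixed only up to null sets, and this
  shapes both halves. Necessity is argued for one Borel set of outcomes at a time, which avoids
  choosing a version of \<omega> that is jointly measurable in y and u; overlap then turns null sets
  of the law of \<open>(T, X)\<close> into null sets of the law of X in both arms. The construction
  is made to work for every x, exceptional x receiving the weight 1, so that its identities hold
  without exception.\<close>

lemma emeasure_Collect_nn_integral:
  assumes "{x \<in> space M. p x} \<in> sets M"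
  shows "emeasure M {x \<in> space M. p x} = (\<integral>\<^sup>+x. of_bool (p x) \<partial>M)"
proof -
  have "emeasure M {x \<in> space M. p x} = (\<integral>\<^sup>+x. indicator {x \<in> space M. p x} x \<partial>M)"
    using assms by simp
  also have "\<dots> = (\<integral>\<^sup>+x. of_bool (p x) \<partial>M)"
    by (rule nn_integral_cong) (auto simp: indicator_def)
  finally show ?thesis .
qed

lemma cond_lawD:
  assumes "cond_law Q V MV W MW K" "A \<in> sets MV" "B \<in> sets MW"
  shows "emeasure Q {\<omega> \<in> space Q. V \<omega> \<in> A \<and> W \<omega> \<in> B} =
    (\<integral>\<^sup>+\<omega>. indicator A (V \<omega>) * emeasure (K (V \<omega>)) B \<partial>Q)"
  using assms by (simp add: cond_law_def)

lemma cond_law_sets: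
  assumes "cond_law Q V MV W MW K"
  shows "v \<in> space MV \<Longrightarrow> prob_space (K v)" "v \<in> space MV \<Longrightarrow> sets (K v) = sets MW"
    "v \<in> space MV \<Longrightarrow> space (K v) = space MW"
  using assms by (auto simp: cond_law_def dest!: measurable_space simp: space_prob_algebra intro!: sets_eq_imp_space_eq)

text \<open>\<open>cond_law\<close> speaks of rectangles only. These form an intersection-stable
  generator of the product sigma-algebra, so the joint law is the mixture of the kernel along
  \<open>V\<close>.\<close>

lemma cond_law_joint:
  assumes K: "cond_law Q V MV W MW K" and Q: "prob_space Q"
    and V[measurable]: "V \<in> Q \<rightarrow>\<^sub>M MV" and W[measurable]: "W \<in> Q \<rightarrow>\<^sub>M MW"
  shows "distr Q (MV \<Otimes>\<^sub>M MW) (\<lambda>\<omega>. (V \<omega>, W \<omega>)) =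
    Q \<bind> (\<lambda>\<omega>. distr (K (V \<omega>)) (MV \<Otimes>\<^sub>M MW) (Pair (V \<omega>)))" (is "?D1 = ?D2")
proof -
  interpret prob_space Q by fact
  have Kp[measurable]: "K \<in> MV \<rightarrow>\<^sub>M prob_algebra MW" using K by (simp add: cond_law_def)
  have k[measurable]: "(\<lambda>\<omega>. distr (K (V \<omega>)) (MV \<Otimes>\<^sub>M MW) (Pair (V \<omega>))) \<in> Q \<rightarrow>\<^sub>M prob_algebra (MV \<Otimes>\<^sub>M MW)"
    by (rule measurable_distr_prob_space2[where M=MW]) measurable
  note ks = measurable_prob_algebraD[OF k]
  let ?E = "{A \<times> B |A B. A \<in> sets MV \<and> B \<in> sets MW}"
  show ?thesis
  proof (rule measure_eqI_generator_eq[where E = ?E and A = "\<lambda>_. space MV \<times> space MW" and \<Omega>="space MV \<times> space MW"])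
    show "Int_stable ?E" by (rule Int_stable_pair_measure_generator)
    show "?E \<subseteq> Pow (space MV \<times> space MW)" by (auto dest: sets.sets_into_space)
    show "sets ?D1 = sigma_sets (space MV \<times> space MW) ?E" by (simp add: sets_pair_measure)
    show "sets ?D2 = sigma_sets (space MV \<times> space MW) ?E"
      using sets_bind[of Q "\<lambda>\<omega>. distr (K (V \<omega>)) (MV \<Otimes>\<^sub>M MW) (Pair (V \<omega>))" "MV \<Otimes>\<^sub>M MW"] not_empty
      by (simp add: sets_pair_measure)
    show "emeasure ?D1 (space MV \<times> space MW) \<noteq> \<infinity>"
      by (simp add: emeasure_distr emeasure_eq_measure)
  next
    fix X assume "X \<in> ?E"
    then obtain A B where X: "X = A \<times> B" and A[measurable]: "A \<in> sets MV" and B[measurable]: "B \<in> sets MW" by auto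
    have "emeasure ?D1 X = emeasure Q {\<omega> \<in> space Q. V \<omega> \<in> A \<and> W \<omega> \<in> B}"
      unfolding X by (subst emeasure_distr) (auto intro!: arg_cong[where f="emeasure Q"])
    also have "\<dots> = (\<integral>\<^sup>+\<omega>. indicator A (V \<omega>) * emeasure (K (V \<omega>)) B \<partial>Q)"
      using K by (simp add: cond_law_def)
    also have "\<dots> = (\<integral>\<^sup>+\<omega>. emeasure (distr (K (V \<omega>)) (MV \<Otimes>\<^sub>M MW) (Pair (V \<omega>))) X \<partial>Q)"
    proof (rule nn_integral_cong)
      fix \<omega> assume "\<omega> \<in> space Q"
      then have v: "V \<omega> \<in> space MV" using measurable_space[OF V] by auto
      note c = cond_law_sets[OF K v]
      have [measurable]: "Pair (V \<omega>) \<in> K (V \<omega>) \<rightarrow>\<^sub>M (MV \<Otimes>\<^sub>M MW)"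
        using v measurable_Pair1' c(2) measurable_cong_sets[OF c(2) refl] by fastforce
      have "emeasure (distr (K (V \<omega>)) (MV \<Otimes>\<^sub>M MW) (Pair (V \<omega>))) X = emeasure (K (V \<omega>)) (Pair (V \<omega>) -` X \<inter> space (K (V \<omega>)))"
        unfolding X by (subst emeasure_distr) auto
      also have "Pair (V \<omega>) -` X \<inter> space (K (V \<omega>)) = (if V \<omega> \<in> A then B else {})"
        using sets.sets_into_space[OF B] by (auto simp: X c)
      finally show "indicator A (V \<omega>) * emeasure (K (V \<omega>)) B = emeasure (distr (K (V \<omega>)) (MV \<Otimes>\<^sub>M MW) (Pair (V \<omega>))) X"
        by (auto simp: indicator_def)
    qed
    also have "\<dots> = emeasure ?D2 X"
      unfolding X by (subst emeasure_bind[OF not_empty ks]) auto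
    finally show "emeasure ?D1 X = emeasure ?D2 X" .
  qed auto
qed

lemma cond_law_nn_integral:
  assumes K: "cond_law Q V MV W MW K" and Q: "prob_space Q"
    and V[measurable]: "V \<in> Q \<rightarrow>\<^sub>M MV" and W[measurable]: "W \<in> Q \<rightarrow>\<^sub>M MW"
    and f[measurable]: "f \<in> borel_measurable (MV \<Otimes>\<^sub>M MW)"
  shows "(\<integral>\<^sup>+\<omega>. f (V \<omega>, W \<omega>) \<partial>Q) = (\<integral>\<^sup>+\<omega>. (\<integral>\<^sup>+w. f (V \<omega>, w) \<partial>K (V \<omega>)) \<partial>Q)"
proof -
  interpret prob_space Q by fact
  have Kp[measurable]: "K \<in> MV \<rightarrow>\<^sub>M prob_algebra MW" using K by (simp add: cond_law_def)
  have k[measurable]: "(\<lambda>\<omega>. distr (K (V \<omega>)) (MV \<Otimes>\<^sub>M MW) (Pair (V \<omega>))) \<in> Q \<rightarrow>\<^sub>M prob_algebra (MV \<Otimes>\<^sub>M MW)"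
    by (rule measurable_distr_prob_space2[where M=MW]) measurable
  have "(\<integral>\<^sup>+\<omega>. f (V \<omega>, W \<omega>) \<partial>Q) = (\<integral>\<^sup>+z. f z \<partial>distr Q (MV \<Otimes>\<^sub>M MW) (\<lambda>\<omega>. (V \<omega>, W \<omega>)))"
    by (subst nn_integral_distr) auto
  also have "\<dots> = (\<integral>\<^sup>+\<omega>. (\<integral>\<^sup>+z. f z \<partial>distr (K (V \<omega>)) (MV \<Otimes>\<^sub>M MW) (Pair (V \<omega>))) \<partial>Q)"
    unfolding cond_law_joint[OF K Q V W]
    by (rule nn_integral_bind[OF f measurable_prob_algebraD[OF k]])
  also have "\<dots> = (\<integral>\<^sup>+\<omega>. (\<integral>\<^sup>+w. f (V \<omega>, w) \<partial>K (V \<omega>)) \<partial>Q)"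
  proof (rule nn_integral_cong)
    fix \<omega> assume "\<omega> \<in> space Q"
    then have v: "V \<omega> \<in> space MV" using measurable_space[OF V] by auto
    note c = cond_law_sets[OF K v]
    have [measurable]: "Pair (V \<omega>) \<in> K (V \<omega>) \<rightarrow>\<^sub>M (MV \<Otimes>\<^sub>M MW)"
      using v measurable_Pair1' c(2) measurable_cong_sets[OF c(2) refl] by fastforce
    show "(\<integral>\<^sup>+z. f z \<partial>distr (K (V \<omega>)) (MV \<Otimes>\<^sub>M MW) (Pair (V \<omega>))) = (\<integral>\<^sup>+w. f (V \<omega>, w) \<partial>K (V \<omega>))"
      by (subst nn_integral_distr) auto
  qed
  finally show ?thesis .
qed

text \<open>Disintegrating the integral of the indicator of \<open>N\<close>, which is 0, makes the
  inner integral vanish for almost every \<open>v\<close>. This carries a null set of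
  \<open>(X, U)\<close> over to the laws of \<open>U\<close> given \<open>(T, X)\<close>.\<close>

lemma cond_law_AE:
  assumes K: "cond_law Q V MV W MW K" and Q: "prob_space Q"
    and V[measurable]: "V \<in> Q \<rightarrow>\<^sub>M MV" and W[measurable]: "W \<in> Q \<rightarrow>\<^sub>M MW"
    and N[measurable]: "N \<in> sets (MV \<Otimes>\<^sub>M MW)"
    and AE: "AE \<omega> in Q. (V \<omega>, W \<omega>) \<notin> N"
  shows "AE v in distr Q MV V. AE w in K v. (v, w) \<notin> N"
proof -
  have Kp[measurable]: "K \<in> MV \<rightarrow>\<^sub>M prob_algebra MW" using K by (simp add: cond_law_def)
  note [measurable] = measurable_prob_algebraD[OF Kp]
  let ?f = "indicator N :: _ \<Rightarrow> ennreal"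
  have m[measurable]: "(\<lambda>v. \<integral>\<^sup>+w. ?f (v, w) \<partial>K v) \<in> borel_measurable MV"
    by (rule nn_integral_measurable_subprob_algebra2[where N=MW]) measurable
  have "(\<integral>\<^sup>+\<omega>. ?f (V \<omega>, W \<omega>) \<partial>Q) = 0"
    using AE by (subst nn_integral_0_iff_AE) (auto simp: indicator_def)
  then have "(\<integral>\<^sup>+v. (\<integral>\<^sup>+w. ?f (v, w) \<partial>K v) \<partial>distr Q MV V) = 0"
    by (subst nn_integral_distr) (simp_all add: cond_law_nn_integral[OF K Q V W])
  then have "AE v in distr Q MV V. (\<integral>\<^sup>+w. ?f (v, w) \<partial>K v) = 0"
    by (subst (asm) nn_integral_0_iff_AE) simp_all
  then show ?thesis
  proof (rule AE_mp[OF _ AE_I2[OF impI]])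
    fix v assume v: "v \<in> space (distr Q MV V)" and z: "(\<integral>\<^sup>+w. ?f (v, w) \<partial>K v) = 0"
    have v: "v \<in> space MV" using v by simp
    have [measurable]: "(\<lambda>w. ?f (v, w)) \<in> borel_measurable (K v)"
      using v by (simp add: measurable_cong_sets[OF cond_law_sets(2)[OF K v] refl])
    from z have "AE w in K v. ?f (v, w) = 0"
      by (subst (asm) nn_integral_0_iff_AE) auto
    then show "AE w in K v. (v, w) \<notin> N"
      by (rule AE_mp) (auto simp: indicator_def intro!: AE_I2)
  qed
qed

text \<open>On a fixed half-line both kernels give densities of the same measure with respect to the
  law of \<open>V\<close>, so they agree almost everywhere. There are countably many half-lines with
  rational endpoint, hence one null set serves all of them, and together they determine a law on the
  reals.\<close>

lemma cond_law_unique: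
  fixes K K' :: "'b \<Rightarrow> real measure"
  assumes K: "cond_law Q V MV W borel K" and K': "cond_law Q V MV W borel K'"
    and Q: "prob_space Q" and V[measurable]: "V \<in> Q \<rightarrow>\<^sub>M MV"
  shows "AE v in distr Q MV V. K v = K' v"
proof -
  interpret D: prob_space "distr Q MV V" by (rule prob_space.prob_space_distr) fact+
  have Kp[measurable]: "K \<in> MV \<rightarrow>\<^sub>M prob_algebra borel" "K' \<in> MV \<rightarrow>\<^sub>M prob_algebra borel"
    using K K' by (auto simp add: cond_law_def)
  note [measurable] = measurable_prob_algebraD[OF Kp(1)] measurable_prob_algebraD[OF Kp(2)]
  have "AE v in distr Q MV V. emeasure (K v) {..of_rat q} = emeasure (K' v) {..of_rat q}" for q
  proof (rule D.density_unique2)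
    fix A assume "A \<in> sets (distr Q MV V)"
    then have [measurable]: "A \<in> sets MV" by simp
    have "(\<integral>\<^sup>+\<omega>. indicator A (V \<omega>) * emeasure (K (V \<omega>)) {..of_rat q} \<partial>Q) = (\<integral>\<^sup>+\<omega>. indicator A (V \<omega>) * emeasure (K' (V \<omega>)) {..of_rat q} \<partial>Q)"
      using K K' by (auto simp: cond_law_def dest!: bspec[where x=A] bspec[where x="{..of_rat q}"])
    then show "set_nn_integral (distr Q MV V) A (\<lambda>v. emeasure (K v) {..of_rat q}) = set_nn_integral (distr Q MV V) A (\<lambda>v. emeasure (K' v) {..of_rat q})"
      by (simp add: nn_integral_distr mult.commute)
  qed measurable
  then have "AE v in distr Q MV V. \<forall>q. emeasure (K v) {..of_rat q} = emeasure (K' v) {..of_rat q}"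
    by (subst AE_all_countable) auto
  then show ?thesis
  proof (rule AE_mp[OF _ AE_I2[OF impI]])
    fix v assume "v \<in> space (distr Q MV V)" and eq: "\<forall>q. emeasure (K v) {..of_rat q} = emeasure (K' v) {..of_rat q}"
    then have v: "v \<in> space MV" by simp
    note c = cond_law_sets[OF K v] and c' = cond_law_sets[OF K' v]
    interpret p: prob_space "K v" by (rule c)
    interpret p': prob_space "K' v" by (rule c')
    let ?E = "range (\<lambda>q::rat. {..of_rat q :: real})"
    have stable: "Int_stable ?E"
      by (force simp: Int_stable_def min_def)
    show "K v = K' v"
    proof (rule measure_eqI_generator_eq[OF stable, where A="\<lambda>n. {..of_rat (of_nat n)}" and \<Omega>=UNIV])
      have "borel = sigma UNIV ?E"
      proof (rule borel_eq_sigmaI1[OF borel_eq_atMost])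
        fix X :: "real set" assume "X \<in> range atMost"
        then obtain x where X: "X = {..x}" by auto
        have "{..x} = (\<Inter>q\<in>{q. x < of_rat q}. {..of_rat q})"
        proof (intro equalityI subsetI INT_I)
          fix y assume y: "y \<in> (\<Inter>q\<in>{q. x < of_rat q}. {..of_rat q :: real})"
          show "y \<in> {..x}"
          proof (rule ccontr)
            assume "y \<notin> {..x}"
            then obtain q where "x < of_rat q" "of_rat q < y" using of_rat_dense[of x y] by auto
            then show False using y by auto
          qed
        qed auto
        also have "\<dots> \<in> sets (sigma UNIV ?E)"
        proof (rule sets.countable_INT'')
          show "UNIV \<in> sets (sigma UNIV ?E)" using sets.top[of "sigma UNIV ?E"] by simp
        qed auto
        finally show "X \<in> sets (sigma UNIV ?E)" using X by simp
      qed simp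
      then have "sets borel = sigma_sets UNIV ?E"
        by (metis sets_measure_of subset_UNIV Pow_UNIV)
      then show "sets (K v) = sigma_sets UNIV ?E" "sets (K' v) = sigma_sets UNIV ?E"
        using c(2) c'(2) by simp_all
      show "(\<Union>n. {..of_rat (of_nat n) :: real}) = UNIV"
        by (auto intro: real_arch_simple)
      show "range (\<lambda>n. {..of_rat (of_nat n) :: real}) \<subseteq> ?E" by blast
    qed (use eq in \<open>auto simp: p.emeasure_eq_measure\<close>)
  qed
qed

section \<open>Conditional independence\<close>

lemma covariate_subalgebra:
  assumes Q: "prob_space Q" and Z: "Z \<in> Q \<rightarrow>\<^sub>M MZ"
  shows "subalgebra Q (vimage_algebra (space Q) Z MZ)"
    "sigma_finite_subalgebra Q (vimage_algebra (space Q) Z MZ)"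
proof -
  show s: "subalgebra Q (vimage_algebra (space Q) Z MZ)"
    using Z measurable_space[OF Z]
    by (auto simp: subalgebra_def sets_vimage_algebra2 measurable_sets)
  interpret prob_space Q by fact
  have "finite_measure_subalgebra Q (vimage_algebra (space Q) Z MZ)"
    by unfold_locales (rule s)
  then show "sigma_finite_subalgebra Q (vimage_algebra (space Q) Z MZ)"
    by (rule finite_measure_subalgebra_is_sigma_finite)
qed

lemma measurable_vimage_compose:
  assumes "Z \<in> Q \<rightarrow>\<^sub>M MZ" "h \<in> MZ \<rightarrow>\<^sub>M N"
  shows "(\<lambda>\<omega>. h (Z \<omega>)) \<in> vimage_algebra (space Q) Z MZ \<rightarrow>\<^sub>M N"
  using measurable_space[OF assms(1)] by (intro measurable_compose[OF measurable_vimage_algebra1 assms(2)]) auto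

lemma (in prob_space) integrable_unit_bounded:
  fixes h :: "'a \<Rightarrow> real"
  assumes "h \<in> borel_measurable M" "\<And>x. 0 \<le> h x" "\<And>x. h x \<le> 1"
  shows "integrable M h"
  using assms by (intro integrable_const_bound[where B=1]) auto

lemma real_cond_exp_vimageI:
  fixes f k :: "_ \<Rightarrow> real"
  assumes Q: "prob_space Q" and Z[measurable]: "Z \<in> Q \<rightarrow>\<^sub>M MZ"
    and f: "integrable Q f" and k[measurable]: "k \<in> borel_measurable MZ"
    and ki: "integrable Q (\<lambda>\<omega>. k (Z \<omega>))"
    and eq: "\<And>C. C \<in> sets MZ \<Longrightarrow> (\<integral>\<omega>. indicator C (Z \<omega>) * f \<omega> \<partial>Q) = (\<integral>\<omega>. indicator C (Z \<omega>) * k (Z \<omega>) \<partial>Q)"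
  shows "AE \<omega> in Q. real_cond_exp Q (vimage_algebra (space Q) Z MZ) f \<omega> = k (Z \<omega>)"
proof -
  interpret prob_space Q by fact
  interpret sigma_finite_subalgebra Q "vimage_algebra (space Q) Z MZ" by (rule covariate_subalgebra[OF Q Z])
  show ?thesis
  proof (rule real_cond_exp_charact)
    fix A assume "A \<in> sets (vimage_algebra (space Q) Z MZ)"
    then obtain C where C: "C \<in> sets MZ" and A: "A = Z -` C \<inter> space Q"
      using measurable_space[OF Z] by (auto simp: sets_vimage_algebra2)
    have "set_lebesgue_integral Q A h = (\<integral>\<omega>. indicator C (Z \<omega>) * h \<omega> \<partial>Q)" for h :: "_ \<Rightarrow> real"
      unfolding set_lebesgue_integral_def A by (intro Bochner_Integration.integral_cong) (auto simp: indicator_def)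
    then show "set_lebesgue_integral Q A f = set_lebesgue_integral Q A (\<lambda>\<omega>. k (Z \<omega>))" using eq[OF C] by simp
  next
    show "(\<lambda>\<omega>. k (Z \<omega>)) \<in> borel_measurable (vimage_algebra (space Q) Z MZ)"
      by (rule measurable_vimage_compose[OF Z k])
  qed (rule f ki)+
qed

text \<open>The working form of conditional independence: a version \<open>k\<close> of the
  conditional probability that \<open>V\<close> lies in \<open>A\<close>, given \<open>Z\<close>,
  may replace the indicator of that event even next to an event in \<open>W\<close>. The product
  rule is applied under the integral; since \<open>k (Z \<omega>)\<close> is measurable in
  \<open>Z\<close>, the remaining conditional expectation can then be undone.\<close>

lemma cond_indep_integral:
  assumes Q: "prob_space Q" and V[measurable]: "V \<in> Q \<rightarrow>\<^sub>M MV" and W[measurable]: "W \<in> Q \<rightarrow>\<^sub>M MW"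
    and Z[measurable]: "Z \<in> Q \<rightarrow>\<^sub>M MZ"
    and ind: "cond_indep Q V MV W MW Z MZ"
    and A[measurable]: "A \<in> sets MV" and B[measurable]: "B \<in> sets MW" and C[measurable]: "C \<in> sets MZ"
    and k[measurable]: "k \<in> borel_measurable MZ" and k01: "\<And>z. 0 \<le> k z" "\<And>z. k z \<le> (1::real)"
    and eq: "\<And>C. C \<in> sets MZ \<Longrightarrow>
      (\<integral>\<omega>. indicator C (Z \<omega>) * indicator A (V \<omega>) \<partial>Q) = (\<integral>\<omega>. indicator C (Z \<omega>) * k (Z \<omega>) \<partial>Q)"
  shows "(\<integral>\<omega>. indicator C (Z \<omega>) * (indicator A (V \<omega>) * indicator B (W \<omega>)) \<partial>Q) =
    (\<integral>\<omega>. indicator C (Z \<omega>) * (k (Z \<omega>) * indicator B (W \<omega>)) \<partial>Q)"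
proof -
  interpret prob_space Q by fact
  let ?F = "vimage_algebra (space Q) Z MZ"
  interpret sigma_finite_subalgebra Q ?F by (rule covariate_subalgebra[OF Q Z])
  note F = measurable_vimage_compose[OF Z]
  have b: "AE \<omega> in Q. real_cond_exp Q ?F (\<lambda>\<omega>. indicator A (V \<omega>)) \<omega> = k (Z \<omega>)"
    using eq by (intro real_cond_exp_vimageI[OF Q Z]) (auto intro!: integrable_unit_bounded simp: k01)
  have a: "AE \<omega> in Q. real_cond_exp Q ?F (\<lambda>\<omega>. indicator A (V \<omega>) * indicator B (W \<omega>)) \<omega> =
      k (Z \<omega>) * real_cond_exp Q ?F (\<lambda>\<omega>. indicator B (W \<omega>)) \<omega>"
    using ind[unfolded cond_indep_def, rule_format, OF A B] b by eventually_elim simp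
  have "(\<integral>\<omega>. indicator C (Z \<omega>) * (indicator A (V \<omega>) * indicator B (W \<omega>)) \<partial>Q) =
    (\<integral>\<omega>. indicator C (Z \<omega>) * real_cond_exp Q ?F (\<lambda>\<omega>. indicator A (V \<omega>) * indicator B (W \<omega>)) \<omega> \<partial>Q)"
    by (rule real_cond_exp_intg(2)[symmetric]) (auto intro!: integrable_unit_bounded F simp: indicator_def)
  also have "\<dots> = (\<integral>\<omega>. indicator C (Z \<omega>) * k (Z \<omega>) * real_cond_exp Q ?F (\<lambda>\<omega>. indicator B (W \<omega>)) \<omega> \<partial>Q)"
    using a by (intro integral_cong_AE) (auto simp: mult.assoc)
  also have "\<dots> = (\<integral>\<omega>. indicator C (Z \<omega>) * k (Z \<omega>) * indicator B (W \<omega>) \<partial>Q)"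
    by (rule real_cond_exp_intg(2)) (auto intro!: integrable_unit_bounded F simp: indicator_def k01)
  finally show ?thesis by (simp add: mult.assoc)
qed

text \<open>With \<open>B\<close> the whole space, the replacement rule identifies
  \<open>k A\<close> as the conditional probability that \<open>V\<close> lies in \<open>A\<close>.
  For general \<open>B\<close> it identifies the conditional expectation of the product of
  indicators with that of \<open>k A (Z \<omega>) * indicator B (W \<omega>)\<close>, from which the
  first factor is pulled out.\<close>

lemma cond_indepI:
  fixes k :: "_ \<Rightarrow> _ \<Rightarrow> real"
  assumes Q: "prob_space Q" and V[measurable]: "V \<in> Q \<rightarrow>\<^sub>M MV" and W[measurable]: "W \<in> Q \<rightarrow>\<^sub>M MW"
    and Z[measurable]: "Z \<in> Q \<rightarrow>\<^sub>M MZ"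
    and k: "\<And>A. A \<in> sets MV \<Longrightarrow> k A \<in> borel_measurable MZ"
    and k01: "\<And>A z. 0 \<le> k A z" "\<And>A z. k A z \<le> 1"
    and eq: "\<And>A B C. A \<in> sets MV \<Longrightarrow> B \<in> sets MW \<Longrightarrow> C \<in> sets MZ \<Longrightarrow>
      (\<integral>\<omega>. indicator C (Z \<omega>) * (indicator A (V \<omega>) * indicator B (W \<omega>)) \<partial>Q) =
      (\<integral>\<omega>. indicator C (Z \<omega>) * (k A (Z \<omega>) * indicator B (W \<omega>)) \<partial>Q)"
  shows "cond_indep Q V MV W MW Z MZ"
  unfolding cond_indep_def
proof (intro ballI)
  fix A B assume A[measurable]: "A \<in> sets MV" and B[measurable]: "B \<in> sets MW"
  note k[OF A, measurable]
  interpret prob_space Q by fact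
  let ?F = "vimage_algebra (space Q) Z MZ"
  interpret sigma_finite_subalgebra Q ?F by (rule covariate_subalgebra[OF Q Z])
  note F = measurable_vimage_compose[OF Z]
  have W1: "space MW \<in> sets MW" by simp
  have b: "AE \<omega> in Q. real_cond_exp Q ?F (\<lambda>\<omega>. indicator A (V \<omega>)) \<omega> = k A (Z \<omega>)"
  proof (rule real_cond_exp_vimageI[OF Q Z])
    fix C assume C: "C \<in> sets MZ"
    have "(\<integral>\<omega>. indicator C (Z \<omega>) * indicator A (V \<omega>) \<partial>Q :: real) =
        (\<integral>\<omega>. indicator C (Z \<omega>) * (indicator A (V \<omega>) * indicator (space MW) (W \<omega>)) \<partial>Q)"
      using measurable_space[OF W] by (intro Bochner_Integration.integral_cong) auto
    also have "\<dots> = (\<integral>\<omega>. indicator C (Z \<omega>) * k A (Z \<omega>) \<partial>Q)"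
      unfolding eq[OF A W1 C] using measurable_space[OF W] by (intro Bochner_Integration.integral_cong) auto
    finally show "(\<integral>\<omega>. indicator C (Z \<omega>) * indicator A (V \<omega>) \<partial>Q) = (\<integral>\<omega>. indicator C (Z \<omega>) * k A (Z \<omega>) \<partial>Q)" .
  qed (auto intro!: integrable_unit_bounded simp: k01)
  have kF: "(\<lambda>\<omega>. k A (Z \<omega>)) \<in> borel_measurable ?F" by (rule F) simp
  have 1: "AE \<omega> in Q. real_cond_exp Q ?F (\<lambda>\<omega>. k A (Z \<omega>) * indicator B (W \<omega>)) \<omega> =
      k A (Z \<omega>) * real_cond_exp Q ?F (\<lambda>\<omega>. indicator B (W \<omega>)) \<omega>"
    by (rule real_cond_exp_mult[OF kF]) (auto intro!: integrable_unit_bounded simp: k01 indicator_def)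
  have 2: "AE \<omega> in Q. real_cond_exp Q ?F (\<lambda>\<omega>. indicator A (V \<omega>) * indicator B (W \<omega>)) \<omega> =
      real_cond_exp Q ?F (\<lambda>\<omega>. k A (Z \<omega>) * indicator B (W \<omega>)) \<omega>"
  proof (rule real_cond_exp_charact)
    fix D assume D: "D \<in> sets ?F"
    then obtain C where C: "C \<in> sets MZ" and DC: "D = Z -` C \<inter> space Q"
      using measurable_space[OF Z] by (auto simp: sets_vimage_algebra2)
    have s: "set_lebesgue_integral Q D h = (\<integral>\<omega>. indicator C (Z \<omega>) * h \<omega> \<partial>Q)" for h :: "_ \<Rightarrow> real"
      unfolding set_lebesgue_integral_def DC by (intro Bochner_Integration.integral_cong) (auto simp: indicator_def)
    have "set_lebesgue_integral Q D (\<lambda>\<omega>. indicator A (V \<omega>) * indicator B (W \<omega>)) =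
      set_lebesgue_integral Q D (\<lambda>\<omega>. k A (Z \<omega>) * indicator B (W \<omega>))"
      unfolding s by (rule eq[OF A B C])
    also have "\<dots> = set_lebesgue_integral Q D (real_cond_exp Q ?F (\<lambda>\<omega>. k A (Z \<omega>) * indicator B (W \<omega>)))"
      by (rule real_cond_exp_intA[OF _ D]) (auto intro!: integrable_unit_bounded simp: k01 indicator_def)
    finally show "set_lebesgue_integral Q D (\<lambda>\<omega>. indicator A (V \<omega>) * indicator B (W \<omega>)) = \<dots>" .
  qed (auto intro!: integrable_unit_bounded real_cond_exp_int simp: k01 indicator_def)
  show "AE \<omega> in Q. real_cond_exp Q ?F (\<lambda>\<omega>. indicator A (V \<omega>) * indicator B (W \<omega>)) \<omega> =
      real_cond_exp Q ?F (\<lambda>\<omega>. indicator A (V \<omega>)) \<omega> * real_cond_exp Q ?F (\<lambda>\<omega>. indicator B (W \<omega>)) \<omega>"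
    using 1 2 b by eventually_elim simp
qed

section \<open>Coordinates of the full data and their measurability\<close>

lemma full_projections:
  "outcome0 = fst" "outcome1 = (\<lambda>\<omega>. fst (snd \<omega>))" "treat = (\<lambda>\<omega>. fst (snd (snd \<omega>)))"
  "covar = (\<lambda>\<omega>. fst (snd (snd (snd \<omega>))))" "unmeas = (\<lambda>\<omega>. snd (snd (snd (snd \<omega>))))"
  by (auto simp: fun_eq_iff)

lemma full_space_measurable[measurable]:
  "outcome0 \<in> borel_measurable (full_space MU)" "outcome1 \<in> borel_measurable (full_space MU)"
  "treat \<in> full_space MU \<rightarrow>\<^sub>M count_space UNIV" "covar \<in> full_space MU \<rightarrow>\<^sub>M borel"
  "unmeas \<in> full_space MU \<rightarrow>\<^sub>M MU" "treat_covar \<in> full_space MU \<rightarrow>\<^sub>M TX_space"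
  "observed \<in> borel_measurable (full_space MU)"
  unfolding observed_def treat_covar_def full_projections full_space_def by measurable

lemma full_measurable:
  assumes "full_law MU Q"
  shows "outcome0 \<in> borel_measurable Q" "outcome1 \<in> borel_measurable Q" "treat \<in> Q \<rightarrow>\<^sub>M count_space UNIV"
    "covar \<in> Q \<rightarrow>\<^sub>M borel" "unmeas \<in> Q \<rightarrow>\<^sub>M MU" "treat_covar \<in> Q \<rightarrow>\<^sub>M TX_space" "observed \<in> borel_measurable Q"
  using full_space_measurable measurable_cong_sets[of Q "full_space MU", OF _ refl] assms
  by (auto simp: full_law_def)

section \<open>Bounds on the laws in the model\<close>

abbreviation Y01 :: "('x, 'u) full \<Rightarrow> real \<times> real" where "Y01 \<omega> \<equiv> (outcome0 \<omega>, outcome1 \<omega>)"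
abbreviation XU :: "('x, 'u) full \<Rightarrow> 'x \<times> 'u" where "XU \<omega> \<equiv> (covar \<omega>, unmeas \<omega>)"

text \<open>Let \<open>h\<close> be the indicator that X lies in the section at t of a null set of
  the law of \<open>(T, X)\<close>. Integrating \<open>h\<close> against the conditional probability
  of \<open>T = t\<close> gives the probability that \<open>T = t\<close> and X lies in the section,
  which is 0. Overlap makes that conditional probability positive, so \<open>h\<close> vanishes
  almost surely, for either t.\<close>

lemma overlap_AE:
  fixes P :: "('x::polish_space, 'v) full measure"
  assumes P: "full_law MV P" and ov: "overlap P"
    and AE: "AE v in distr P TX_space treat_covar. \<phi> v"
  shows "AE x in covar_law P. \<phi> (True, x) \<and> \<phi> (False, x)"
proof -
  interpret prob_space P using P by (simp add: full_law_def)
  note [measurable] = full_measurable[OF P]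
  let ?F = "vimage_algebra (space P) covar borel"
  let ?p = "real_cond_exp P ?F (\<lambda>\<omega>. of_bool (treat \<omega>))"
  interpret sigma_finite_subalgebra P ?F by (rule covariate_subalgebra[OF prob_space_axioms]) measurable
  obtain N where N: "N \<in> null_sets (distr P TX_space treat_covar)" "{v \<in> space TX_space. \<not> \<phi> v} \<subseteq> N"
    using AE by (auto elim!: AE_E2 simp: eventually_ae_filter)
  then have Nm[measurable]: "N \<in> sets TX_space" by auto
  have N0: "AE \<omega> in P. treat_covar \<omega> \<notin> N"
    using AE_not_in[OF N(1)] by (subst (asm) AE_distr_iff) auto
  have [measurable]: "Pair t -` N \<in> sets borel" for t
    using measurable_sets[OF measurable_Pair1' Nm, of t] by auto
  have sec: "AE \<omega> in P. covar \<omega> \<notin> Pair t -` N" for t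
  proof -
    define h :: "('x, 'v) full \<Rightarrow> real" where "h = (\<lambda>\<omega>. indicator (Pair t -` N) (covar \<omega>))"
    have hF[measurable]: "h \<in> borel_measurable ?F"
      unfolding h_def by (rule measurable_compose[OF measurable_vimage_algebra1]) auto
    have hP[measurable]: "h \<in> borel_measurable P" unfolding h_def by measurable
    have h01: "0 \<le> h \<omega>" "h \<omega> \<le> 1" for \<omega> by (auto simp: h_def)
    have p01: "AE \<omega> in P. 0 < ?p \<omega> \<and> ?p \<omega> < 1" using ov by (simp add: overlap_def)
    have hi: "integrable P h" "integrable P (\<lambda>\<omega>. h \<omega> * of_bool (treat \<omega>))"
      by (auto intro!: integrable_unit_bounded simp: h01)
    note hp = real_cond_exp_intg[OF hi(2) hF]
    have z: "AE \<omega> in P. h \<omega> * of_bool (treat \<omega> = t) = 0"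
      using N0
    proof eventually_elim
      case (elim \<omega>)
      then show ?case by (cases "treat \<omega>"; cases t) (simp_all add: h_def treat_covar_def)
    qed
    have "(\<integral>\<omega>. h \<omega> * (if t then ?p \<omega> else 1 - ?p \<omega>) \<partial>P) = (\<integral>\<omega>. h \<omega> * (if t then of_bool (treat \<omega>) else 1 - of_bool (treat \<omega>)) \<partial>P)"
      using hp hi by (cases t) (simp_all add: right_diff_distrib)
    also have "\<dots> = 0"
    proof (rule integral_eq_zero_AE)
      show "AE \<omega> in P. h \<omega> * (if t then of_bool (treat \<omega>) else 1 - of_bool (treat \<omega>)) = 0"
        using z
      proof eventually_elim
        case (elim \<omega>)
        then show ?case by (cases "treat \<omega>"; cases t) simp_all
      qed
    qed
    finally have "(\<integral>\<omega>. h \<omega> * (if t then ?p \<omega> else 1 - ?p \<omega>) \<partial>P) = 0" .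
    moreover have "integrable P (\<lambda>\<omega>. h \<omega> * (if t then ?p \<omega> else 1 - ?p \<omega>))"
      using hp hi by (cases t) (simp_all add: right_diff_distrib)
    moreover have "AE \<omega> in P. 0 \<le> h \<omega> * (if t then ?p \<omega> else 1 - ?p \<omega>)"
      using p01 by eventually_elim (auto simp: h01)
    ultimately have "AE \<omega> in P. h \<omega> * (if t then ?p \<omega> else 1 - ?p \<omega>) = 0"
      by (subst (asm) integral_nonneg_eq_0_iff_AE) auto
    then show ?thesis using p01
      by eventually_elim (auto simp: h_def split: if_splits)
  qed
  have "AE \<omega> in P. covar \<omega> \<notin> Pair True -` N \<and> covar \<omega> \<notin> Pair False -` N"
    using sec[of True] sec[of False] by eventually_elim simp
  then have "AE x in covar_law P. x \<notin> Pair True -` N \<and> x \<notin> Pair False -` N"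
    by (subst AE_distr_iff) auto
  then show ?thesis by eventually_elim (use N(2) in \<open>auto simp: space_pair_measure\<close>)
qed

lemma observed_law_eqD:
  assumes P: "full_law MV P" and Q: "full_law MU Q" and eq: "observed_law Q = observed_law P"
  shows "distr Q TX_space treat_covar = distr P TX_space treat_covar" "covar_law Q = covar_law P"
proof -
  note [measurable] = full_measurable[OF P] full_measurable[OF Q]
  have *: "distr (observed_law R) TX_space snd = distr R TX_space treat_covar" if "full_law M R" for M :: "'d measure" and R
    unfolding observed_law_def using full_measurable[OF that]
    by (subst distr_distr) (auto simp: comp_def treat_covar_def intro!: distr_cong)
  have **: "distr (observed_law R) borel (\<lambda>z. snd (snd z)) = covar_law R" if "full_law M R" for M :: "'d measure" and R
    unfolding observed_law_def using full_measurable[OF that]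
    by (subst distr_distr) (auto simp: comp_def treat_covar_def intro!: distr_cong)
  show "distr Q TX_space treat_covar = distr P TX_space treat_covar"
    unfolding *[OF P, symmetric] *[OF Q, symmetric] by (simp add: eq)
  show "covar_law Q = covar_law P"
    unfolding **[OF P, symmetric] **[OF Q, symmetric] by (simp add: eq)
qed

lemma observed_law_nn_integral:
  assumes P: "full_law MV P" and Q: "full_law MU Q" and eq: "observed_law Q = observed_law P"
    and f[measurable]: "f \<in> borel_measurable (borel \<Otimes>\<^sub>M (count_space UNIV \<Otimes>\<^sub>M borel))"
  shows "(\<integral>\<^sup>+\<omega>. f (observed \<omega>, treat \<omega>, covar \<omega>) \<partial>Q) = (\<integral>\<^sup>+\<omega>. f (observed \<omega>, treat \<omega>, covar \<omega>) \<partial>P)"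
proof -
  note [measurable] = full_measurable[OF P] full_measurable[OF Q]
  have "(\<integral>\<^sup>+\<omega>. f (observed \<omega>, treat \<omega>, covar \<omega>) \<partial>Q) = (\<integral>\<^sup>+z. f z \<partial>observed_law Q)"
    unfolding observed_law_def by (subst nn_integral_distr) auto
  also have "\<dots> = (\<integral>\<^sup>+\<omega>. f (observed \<omega>, treat \<omega>, covar \<omega>) \<partial>P)"
    unfolding eq unfolding observed_law_def by (subst nn_integral_distr) auto
  finally show ?thesis .
qed

text \<open>\<open>tau\<close> is the weight for which \<open>(1 - tau) * L2 + tau * L1 = 1\<close>:
  the probability of the lower value for a variable of mean 1 with values \<open>L1\<close> and
  \<open>L2\<close>. In the default case \<open>L1 = L2 = 1\<close> both equations read 0 = 0, so
  any weight would satisfy them.\<close>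

lemma tau_weights:
  assumes "L1 x \<le> (1::real)" "1 \<le> L2 x"
  shows "(1 - tau L1 L2 x) * (L2 x - L1 x) = 1 - L1 x" "tau L1 L2 x * (L2 x - L1 x) = L2 x - 1"
    "0 \<le> tau L1 L2 x" "tau L1 L2 x \<le> 1"
  using assms by (auto simp: tau_def field_simps)

text \<open>Each weight absorbs the length of its interval and leaves a distance to 1. The minima
  are then taken over the very products that \<open>mixture_bounds\<close> produces.\<close>

lemma bar_eq:
  assumes "\<Lambda>1 x \<le> 1" "1 \<le> \<Lambda>2 x" "\<Gamma>1 x \<le> 1" "1 \<le> \<Gamma>2 x"
  shows "bar1 \<Lambda>1 \<Lambda>2 \<Gamma>1 \<Gamma>2 x = 1 - min ((1 - \<Lambda>1 x) * (1 - \<Gamma>1 x)) ((\<Lambda>2 x - 1) * (\<Gamma>2 x - 1))" (is ?bar1)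
    "bar2 \<Lambda>1 \<Lambda>2 \<Gamma>1 \<Gamma>2 x = 1 + min ((1 - \<Lambda>1 x) * (\<Gamma>2 x - 1)) ((\<Lambda>2 x - 1) * (1 - \<Gamma>1 x))" (is ?bar2)
proof -
  have D: "0 \<le> (\<Lambda>2 x - \<Lambda>1 x) * (\<Gamma>2 x - \<Gamma>1 x)" using assms by simp
  have m: "c * min a b = min (c * a) (c * b)" if "0 \<le> c" for a b c :: real
    using that by (simp add: min_mult_distrib_left)
  note t = tau_weights[of \<Lambda>1 x \<Lambda>2, OF assms(1,2)] tau_weights[of \<Gamma>1 x \<Gamma>2, OF assms(3,4)]
  have "(\<Lambda>2 x - \<Lambda>1 x) * (\<Gamma>2 x - \<Gamma>1 x) * (a * b) = (a * (\<Lambda>2 x - \<Lambda>1 x)) * (b * (\<Gamma>2 x - \<Gamma>1 x))" for a b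
    by simp
  then show ?bar1 ?bar2
    unfolding bar1_def bar2_def m[OF D] by (simp_all only: t)
qed

text \<open>The finite upper bound keeps the Radon-Nikodym derivative away from infinity almost
  everywhere, so a nonnegative real function can stand for it and Bochner integrals become
  available.\<close>

lemma RN_deriv_bounds:
  assumes M: "prob_space M" and N: "prob_space N" and s: "sets N = sets M"
    and ac: "absolutely_continuous M N"
    and b: "AE u in M. RN_deriv M N u \<in> {ennreal l..ennreal r}" and lr: "0 \<le> l" "0 \<le> r"
  obtains d where "d \<in> borel_measurable M" "\<And>u. 0 \<le> d u" "AE u in M. l \<le> d u \<and> d u \<le> r"
    "N = density M (\<lambda>u. ennreal (d u))"
proof
  interpret M: prob_space M by fact
  interpret N: prob_space N by fact
  let ?d = "\<lambda>u. enn2real (RN_deriv M N u)"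
  show "?d \<in> borel_measurable M" by measurable
  have *: "AE u in M. RN_deriv M N u = ennreal (?d u)"
    using b by eventually_elim (auto simp: top_unique le_less_trans intro!: ennreal_enn2real[symmetric] dest: le_less_trans[OF _ ennreal_less_top])
  show "AE u in M. l \<le> ?d u \<and> ?d u \<le> r"
    using b * by eventually_elim (auto simp: lr, (metis enn2real_ennreal enn2real_mono ennreal_less_top lr)+)
  have "N = density M (RN_deriv M N)" by (rule M.density_RN_deriv[OF ac s, symmetric])
  also have "\<dots> = density M (\<lambda>u. ennreal (?d u))" using * by (intro density_cong) auto
  finally show "N = density M (\<lambda>u. ennreal (?d u))" .
qed simp

lemma RN_deriv_measure_bounds:
  assumes M: "prob_space M" and N: "prob_space N" and s: "sets N = sets M"
    and ac: "absolutely_continuous M N"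
    and b: "AE u in M. RN_deriv M N u \<in> {ennreal l..ennreal r}" and lr: "0 \<le> l" "0 \<le> r"
    and B[measurable]: "B \<in> sets M"
  shows "l * measure M B \<le> measure N B" "measure N B \<le> r * measure M B"
proof -
  interpret M: prob_space M by fact
  interpret N: prob_space N by fact
  obtain d where [measurable]: "d \<in> borel_measurable M" and d0: "\<And>u. 0 \<le> d u" and d: "AE u in M. l \<le> d u \<and> d u \<le> r"
    and Nd: "N = density M (\<lambda>u. ennreal (d u))"
    using RN_deriv_bounds[OF M N s ac b lr] by blast
  have i: "integrable M (\<lambda>u. indicator B u * d u)"
    using d d0 lr(2) by (intro M.integrable_const_bound[where B=r]) (auto simp: indicator_def)
  have NB: "measure N B = (\<integral>u. indicator B u * d u \<partial>M)"
  proof -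
    have "ennreal (measure N B) = (\<integral>\<^sup>+u. ennreal (d u) * indicator B u \<partial>M)"
      unfolding N.emeasure_eq_measure[symmetric] by (subst Nd) (auto simp: emeasure_density)
    also have "\<dots> = (\<integral>\<^sup>+u. ennreal (indicator B u * d u) \<partial>M)"
      by (intro nn_integral_cong) (auto simp: indicator_def)
    also have "\<dots> = ennreal (\<integral>u. indicator B u * d u \<partial>M)"
      using i d0 by (intro nn_integral_eq_integral) auto
    finally show ?thesis using d0 by (subst (asm) ennreal_inj) (auto intro!: integral_nonneg_AE)
  qed
  have iB: "integrable M (\<lambda>u. indicator B u * c)" for c :: real
    by (intro M.integrable_const_bound[where B="\<bar>c\<bar>"]) (auto simp: indicator_def)
  have "(\<integral>u. indicator B u * l \<partial>M) \<le> (\<integral>u. indicator B u * d u \<partial>M)"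
    using d by (intro integral_mono_AE iB i) (auto simp: indicator_def)
  then show "l * measure M B \<le> measure N B" by (simp add: NB mult.commute)
  have "(\<integral>u. indicator B u * d u \<partial>M) \<le> (\<integral>u. indicator B u * r \<partial>M)"
    using d by (intro integral_mono_AE iB i) (auto simp: indicator_def)
  then show "measure N B \<le> r * measure M B" by (simp add: NB mult.commute)
qed

text \<open>Here \<open>a\<close> and \<open>a'\<close> are the laws of U given \<open>T = 1\<close>
  and \<open>T = 0\<close>, and \<open>k u\<close> is the law of the outcome given U = u. With
  \<open>B\<close> fixed, \<open>\<kappa> u = measure (k u) B\<close> lies between
  \<open>g1 * f\<close> and \<open>g2 * f\<close>, the density \<open>d\<close> of \<open>a'\<close>
  lies between \<open>l1\<close> and \<open>l2\<close>, and under \<open>a\<close> the means of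
  \<kappa>, d and \<kappa> d are f, 1 and h. Each product of one nonnegative gap of \<kappa> with
  one of d has a nonnegative mean, which is an inequality between h and f.\<close>

lemma mixture_bounds:
  assumes a: "prob_space a" "prob_space a'" "sets a' = sets a"
    and F: "prob_space F" "sets F = sets borel"
    and k[measurable]: "k \<in> a \<rightarrow>\<^sub>M prob_algebra borel"
    and ac: "absolutely_continuous a a'"
    and \<lambda>: "AE u in a. RN_deriv a a' u \<in> {ennreal l1..ennreal l2}" and l: "0 \<le> l1" "0 \<le> l2"
    and \<omega>: "AE u in a. absolutely_continuous F (k u) \<and> (AE y in F. RN_deriv F (k u) y \<in> {ennreal g1..ennreal g2})"
    and g: "0 \<le> g1" "0 \<le> g2"
    and FB: "F = a \<bind> k" and B[measurable]: "B \<in> sets borel"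
  defines "f \<equiv> measure F B" and "h \<equiv> measure (a' \<bind> k) B"
  shows "h \<le> (1 + (1 - l1) * (g2 - 1)) * f" "h \<le> (1 + (l2 - 1) * (1 - g1)) * f"
    "(1 - (1 - l1) * (1 - g1)) * f \<le> h" "(1 - (l2 - 1) * (g2 - 1)) * f \<le> h"
proof -
  interpret a: prob_space a by fact
  interpret a': prob_space a' by fact
  have k'[measurable]: "k \<in> a' \<rightarrow>\<^sub>M prob_algebra borel" unfolding measurable_cong_sets[OF a(3) refl] by (rule k)
  note [measurable] = measurable_prob_algebraD[OF k] measurable_prob_algebraD[OF k']
  obtain d where [measurable]: "d \<in> borel_measurable a" and d0: "\<And>u. 0 \<le> d u" and d: "AE u in a. l1 \<le> d u \<and> d u \<le> l2"
    and ad: "a' = density a (\<lambda>u. ennreal (d u))"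
    using RN_deriv_bounds[OF a ac \<lambda> l] by blast
  define \<kappa> where "\<kappa> u = measure (k u) B" for u
  have kp: "prob_space (k u)" "sets (k u) = sets borel" if "u \<in> space a" for u
    using measurable_space[OF k that] by (auto simp: space_prob_algebra)
  have \<kappa>m[measurable]: "\<kappa> \<in> borel_measurable a" unfolding \<kappa>_def
    by (rule measurable_compose[OF k]) (rule measurable_measure_prob_algebra, simp)
  have \<kappa>b: "AE u in a. g1 * f \<le> \<kappa> u \<and> \<kappa> u \<le> g2 * f"
    using \<omega> AE_space
  proof eventually_elim
    case (elim u)
    then show ?case unfolding \<kappa>_def f_def
      using RN_deriv_measure_bounds[OF F(1) kp(1) _ _ _ g, of u B] kp(2)[of u] F(2) B by auto
  qed
  have \<kappa>01: "0 \<le> \<kappa> u" "u \<in> space a \<Longrightarrow> \<kappa> u \<le> 1" for u using kp by (auto simp: \<kappa>_def prob_space.prob_le_1)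
  have i\<kappa>: "integrable a \<kappa>" using \<kappa>01 by (intro a.integrable_const_bound[where B=1]) auto
  have id: "integrable a d" using d d0 by (intro a.integrable_const_bound[where B=l2]) auto
  have i\<kappa>d: "integrable a (\<lambda>u. \<kappa> u * d u)"
  proof (rule a.integrable_const_bound[where B=l2])
    show "AE u in a. norm (\<kappa> u * d u) \<le> l2"
      using d AE_space by eventually_elim (auto simp: d0 \<kappa>01 intro: order_trans[OF mult_left_le_one_le] )
  qed measurable
  have k1: "(\<integral>u. \<kappa> u \<partial>a) = f"
  proof -
    have "ennreal f = (\<integral>\<^sup>+u. emeasure (k u) B \<partial>a)"
      unfolding f_def using prob_space.emeasure_space_1 F(1)
      by (simp add: finite_measure.emeasure_eq_measure[OF prob_space.finite_measure, symmetric])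
        (subst FB, subst emeasure_bind[where N=borel], auto simp: a.not_empty)
    also have "\<dots> = (\<integral>\<^sup>+u. ennreal (\<kappa> u) \<partial>a)"
      unfolding \<kappa>_def using kp(1)
      by (intro nn_integral_cong) (simp add: finite_measure.emeasure_eq_measure[OF prob_space.finite_measure])
    also have "\<dots> = ennreal (\<integral>u. \<kappa> u \<partial>a)" using i\<kappa> \<kappa>01 by (intro nn_integral_eq_integral) auto
    finally show ?thesis by (subst (asm) ennreal_inj) (auto simp: f_def \<kappa>01 intro!: integral_nonneg_AE)
  qed
  have k2: "(\<integral>u. \<kappa> u * d u \<partial>a) = h"
  proof -
    have pb: "prob_space (a' \<bind> k)"
      by (rule prob_space_bind'[OF _ k]) (auto simp: space_prob_algebra a)
    have "ennreal h = (\<integral>\<^sup>+u. emeasure (k u) B \<partial>a')"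
      unfolding h_def finite_measure.emeasure_eq_measure[OF prob_space.finite_measure[OF pb], symmetric]
      by (subst emeasure_bind[where N=borel]) (auto simp: a'.not_empty)
    also have "\<dots> = (\<integral>\<^sup>+u. ennreal (d u) * emeasure (k u) B \<partial>a)"
      unfolding ad by (rule nn_integral_density) auto
    also have "\<dots> = (\<integral>\<^sup>+u. ennreal (\<kappa> u * d u) \<partial>a)"
      unfolding \<kappa>_def using kp(1) d0
      by (intro nn_integral_cong) (simp add: finite_measure.emeasure_eq_measure[OF prob_space.finite_measure] ennreal_mult mult.commute)
    also have "\<dots> = ennreal (\<integral>u. \<kappa> u * d u \<partial>a)" using i\<kappa>d \<kappa>01 d0 by (intro nn_integral_eq_integral) auto
    finally show ?thesis by (subst (asm) ennreal_inj) (auto simp: h_def \<kappa>01 d0 intro!: integral_nonneg_AE)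
  qed
  have k3: "(\<integral>u. d u \<partial>a) = 1"
  proof -
    have "1 = (\<integral>\<^sup>+u. 1 \<partial>a')" by (simp add: a'.emeasure_space_1)
    also have "\<dots> = (\<integral>\<^sup>+u. ennreal (d u) \<partial>a)"
      unfolding ad by (subst nn_integral_density) auto
    also have "\<dots> = ennreal (\<integral>u. d u \<partial>a)" using id d0 by (intro nn_integral_eq_integral) auto
    finally show ?thesis by simp
  qed
  \<comment> \<open>A product of an affine function of \<kappa> and one of d involves only the three
    means just computed; the four inequalities are four choices of its coefficients.\<close>
  have prod: "(\<integral>u. (s * \<kappa> u + p * f) * (t * d u + q) \<partial>a) = s * t * h + s * q * f + p * f * t + p * f * q" for s p t q
  proof -
    have "(\<integral>u. (s * \<kappa> u + p * f) * (t * d u + q) \<partial>a) =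
      (\<integral>u. s * t * (\<kappa> u * d u) + s * q * \<kappa> u + p * f * t * d u + p * f * q \<partial>a)"
      by (intro Bochner_Integration.integral_cong) (auto simp: algebra_simps)
    also have "\<dots> = s * t * h + s * q * f + p * f * t + p * f * q"
      using i\<kappa> id i\<kappa>d by (simp add: k1 k2 k3 a.prob_space)
    finally show ?thesis .
  qed
  have nn: "0 \<le> s * t * h + s * q * f + p * f * t + p * f * q"
    if "AE u in a. 0 \<le> (s * \<kappa> u + p * f) * (t * d u + q)" for s p t q
    unfolding prod[symmetric] by (rule integral_nonneg_AE) fact
  \<comment> \<open>The product is \<open>(g2 * f - \<kappa> u) * (d u - l1)\<close>. The next three
    are \<open>(\<kappa> u - g1 * f) * (l2 - d u)\<close>,
    \<open>(\<kappa> u - g1 * f) * (d u - l1)\<close> and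
    \<open>(g2 * f - \<kappa> u) * (l2 - d u)\<close>.\<close>
  have "0 \<le> (-1) * 1 * h + (-1) * (-l1) * f + g2 * f * 1 + g2 * f * (-l1)"
    using d \<kappa>b by (intro nn, eventually_elim, intro mult_nonneg_nonneg) auto
  then show "h \<le> (1 + (1 - l1) * (g2 - 1)) * f" by (simp add: algebra_simps)
  have "0 \<le> 1 * (-1) * h + 1 * l2 * f + (-g1) * f * (-1) + (-g1) * f * l2"
    using d \<kappa>b by (intro nn, eventually_elim, intro mult_nonneg_nonneg) auto
  then show "h \<le> (1 + (l2 - 1) * (1 - g1)) * f" by (simp add: algebra_simps)
  have "0 \<le> 1 * 1 * h + 1 * (-l1) * f + (-g1) * f * 1 + (-g1) * f * (-l1)"
    using d \<kappa>b by (intro nn, eventually_elim, intro mult_nonneg_nonneg) auto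
  then show "(1 - (1 - l1) * (1 - g1)) * f \<le> h" by (simp add: algebra_simps)
  have "0 \<le> (-1) * (-1) * h + (-1) * l2 * f + g2 * f * (-1) + g2 * f * l2"
    using d \<kappa>b by (intro nn, eventually_elim, intro mult_nonneg_nonneg) auto
  then show "(1 - (l2 - 1) * (g2 - 1)) * f \<le> h" by (simp add: algebra_simps)
qed

section \<open>The law of the treated outcome given treatment and covariates\<close>

lemma emeasure_split_treat:
  assumes Q: "full_law MU Q" and A[measurable]: "A \<in> sets TX_space" and B[measurable]: "B \<in> sets borel"
  shows "emeasure Q {\<omega> \<in> space Q. treat_covar \<omega> \<in> A \<and> outcome1 \<omega> \<in> B} =
    emeasure Q {\<omega> \<in> space Q. treat_covar \<omega> \<in> A \<inter> {True} \<times> UNIV \<and> outcome1 \<omega> \<in> B} +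
    emeasure Q {\<omega> \<in> space Q. treat_covar \<omega> \<in> A \<inter> {False} \<times> UNIV \<and> outcome1 \<omega> \<in> B}"
proof -
  note [measurable] = full_measurable[OF Q]
  have [measurable]: "A \<inter> {t} \<times> UNIV \<in> sets TX_space" for t by measurable
  show ?thesis
  proof (subst plus_emeasure)
    show "{\<omega> \<in> space Q. treat_covar \<omega> \<in> A \<inter> {True} \<times> UNIV \<and> outcome1 \<omega> \<in> B} \<inter>
      {\<omega> \<in> space Q. treat_covar \<omega> \<in> A \<inter> {False} \<times> UNIV \<and> outcome1 \<omega> \<in> B} = {}"
      by auto
    have "{\<omega> \<in> space Q. treat_covar \<omega> \<in> A \<and> outcome1 \<omega> \<in> B} =
      {\<omega> \<in> space Q. treat_covar \<omega> \<in> A \<inter> {True} \<times> UNIV \<and> outcome1 \<omega> \<in> B} \<union>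
      {\<omega> \<in> space Q. treat_covar \<omega> \<in> A \<inter> {False} \<times> UNIV \<and> outcome1 \<omega> \<in> B}"
      by (auto simp: treat_covar_def)
    then show "emeasure Q {\<omega> \<in> space Q. treat_covar \<omega> \<in> A \<and> outcome1 \<omega> \<in> B} =
      emeasure Q ({\<omega> \<in> space Q. treat_covar \<omega> \<in> A \<inter> {True} \<times> UNIV \<and> outcome1 \<omega> \<in> B} \<union>
      {\<omega> \<in> space Q. treat_covar \<omega> \<in> A \<inter> {False} \<times> UNIV \<and> outcome1 \<omega> \<in> B})" by simp
  qed measurable
qed

text \<open>By consistency the treated have \<open>Y = Y\<^sup>1\<close>, so the observed law, which
  \<open>Q\<close> shares with \<open>P\<close>, fixes the treated half of the kernel; the untreated
  half is whatever \<open>J\<close> says.\<close>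

lemma cond_law_outcome1_treated:
  fixes P :: "('x::polish_space, 'v) full measure" and Q :: "('x, 'u) full measure"
  assumes P: "full_law MV P" and Q: "full_law MU Q" and eq: "observed_law Q = observed_law P"
    and K: "cond_law P treat_covar TX_space observed borel K"
    and J: "cond_law Q treat_covar TX_space outcome1 borel J"
  shows "cond_law Q treat_covar TX_space outcome1 borel (\<lambda>v. if fst v then K v else J v)"
  unfolding cond_law_def
proof (intro conjI ballI)
  have K'[measurable]: "K \<in> TX_space \<rightarrow>\<^sub>M prob_algebra borel" and J'[measurable]: "J \<in> TX_space \<rightarrow>\<^sub>M prob_algebra borel"
    using K J by (auto simp: cond_law_def)
  show m: "(\<lambda>v. if fst v then K v else J v) \<in> TX_space \<rightarrow>\<^sub>M prob_algebra borel" by measurable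
  note [measurable] = full_measurable[OF P] full_measurable[OF Q]
    measurable_prob_algebraD[OF K'] measurable_prob_algebraD[OF J']
  fix A :: "(bool \<times> 'x) set" and B :: "real set"
  assume A[measurable]: "A \<in> sets TX_space" and B[measurable]: "B \<in> sets borel"
  have AT[measurable]: "A \<inter> {t} \<times> UNIV \<in> sets TX_space" for t by measurable
  have oP: "emeasure P {\<omega> \<in> space P. treat_covar \<omega> \<in> A \<inter> {True} \<times> UNIV \<and> observed \<omega> \<in> B} =
    (\<integral>\<^sup>+\<omega>. indicator (B \<times> (A \<inter> {True} \<times> UNIV)) (observed \<omega>, treat \<omega>, covar \<omega>) \<partial>P)"
    by (subst emeasure_Collect_nn_integral) (measurable, auto intro!: nn_integral_cong simp: treat_covar_def indicator_def of_bool_def)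
  have oQ: "emeasure Q {\<omega> \<in> space Q. treat_covar \<omega> \<in> A \<inter> {True} \<times> UNIV \<and> outcome1 \<omega> \<in> B} =
    (\<integral>\<^sup>+\<omega>. indicator (B \<times> (A \<inter> {True} \<times> UNIV)) (observed \<omega>, treat \<omega>, covar \<omega>) \<partial>Q)"
    by (subst emeasure_Collect_nn_integral)
      (measurable, auto intro!: nn_integral_cong simp: treat_covar_def indicator_def observed_def of_bool_def)
  have "emeasure Q {\<omega> \<in> space Q. treat_covar \<omega> \<in> A \<inter> {True} \<times> UNIV \<and> outcome1 \<omega> \<in> B} =
    emeasure P {\<omega> \<in> space P. treat_covar \<omega> \<in> A \<inter> {True} \<times> UNIV \<and> observed \<omega> \<in> B}"
    unfolding oP oQ by (rule observed_law_nn_integral[OF P Q eq]) measurable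
  also have "\<dots> = (\<integral>\<^sup>+\<omega>. indicator (A \<inter> {True} \<times> UNIV) (treat_covar \<omega>) * emeasure (K (treat_covar \<omega>)) B \<partial>P)"
    by (rule cond_lawD[OF K AT B])
  also have "\<dots> = (\<integral>\<^sup>+v. indicator (A \<inter> {True} \<times> UNIV) v * emeasure (K v) B \<partial>distr P TX_space treat_covar)"
    by (subst nn_integral_distr) measurable
  also have "\<dots> = (\<integral>\<^sup>+\<omega>. indicator (A \<inter> {True} \<times> UNIV) (treat_covar \<omega>) * emeasure (K (treat_covar \<omega>)) B \<partial>Q)"
    unfolding observed_law_eqD(1)[OF P Q eq, symmetric] by (subst nn_integral_distr) measurable
  finally have 1: "emeasure Q {\<omega> \<in> space Q. treat_covar \<omega> \<in> A \<inter> {True} \<times> UNIV \<and> outcome1 \<omega> \<in> B} = \<dots>" .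
  have 2: "emeasure Q {\<omega> \<in> space Q. treat_covar \<omega> \<in> A \<inter> {False} \<times> UNIV \<and> outcome1 \<omega> \<in> B} =
    (\<integral>\<^sup>+\<omega>. indicator (A \<inter> {False} \<times> UNIV) (treat_covar \<omega>) * emeasure (J (treat_covar \<omega>)) B \<partial>Q)"
    by (rule cond_lawD[OF J AT B])
  show "emeasure Q {\<omega> \<in> space Q. treat_covar \<omega> \<in> A \<and> outcome1 \<omega> \<in> B} =
    (\<integral>\<^sup>+\<omega>. indicator A (treat_covar \<omega>) * emeasure (if fst (treat_covar \<omega>) then K (treat_covar \<omega>) else J (treat_covar \<omega>)) B \<partial>Q)"
    unfolding emeasure_split_treat[OF Q A B] 1 2
    by (subst nn_integral_add[symmetric]) (auto intro!: nn_integral_cong simp: treat_covar_def indicator_def)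
qed

text \<open>Given \<open>(X, U)\<close> the outcome forgets T, so its law given
  \<open>(T, X)\<close> is the average of \<open>KY\<close> over the law of U given
  \<open>(T, X)\<close>. Applied in both arms, this exhibits the treated and untreated laws as
  mixtures of the same components.\<close>

lemma deMSM_untreated_law:
  fixes Q :: "('x::polish_space, 'u) full measure"
  assumes Q: "full_law MU Q"
    and ind: "cond_indep Q Y01 (borel \<Otimes>\<^sub>M borel) treat (count_space UNIV)
       XU (borel \<Otimes>\<^sub>M MU)"
    and KU: "cond_law Q treat_covar TX_space unmeas MU KU"
    and KY: "cond_law Q XU (borel \<Otimes>\<^sub>M MU) outcome1 borel KY"
  shows "cond_law Q treat_covar TX_space outcome1 borel (\<lambda>v. KU v \<bind> (\<lambda>u. KY (snd v, u)))"
  unfolding cond_law_def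
proof (intro conjI ballI)
  interpret prob_space Q using Q by (simp add: full_law_def)
  note [measurable] = full_measurable[OF Q]
  have KU'[measurable]: "KU \<in> TX_space \<rightarrow>\<^sub>M prob_algebra MU" and KY'[measurable]: "KY \<in> borel \<Otimes>\<^sub>M MU \<rightarrow>\<^sub>M prob_algebra borel"
    using KU KY by (auto simp: cond_law_def)
  note [measurable] = measurable_prob_algebraD[OF KU'] measurable_prob_algebraD[OF KY']
  show m: "(\<lambda>v. KU v \<bind> (\<lambda>u. KY (snd v, u))) \<in> TX_space \<rightarrow>\<^sub>M prob_algebra borel" by measurable
  fix A :: "(bool \<times> 'x) set" and B :: "real set"
  assume A[measurable]: "A \<in> sets TX_space" and B[measurable]: "B \<in> sets borel"
  define \<kappa> where "\<kappa> z = measure (KY z) B" for z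
  have \<kappa>m[measurable]: "\<kappa> \<in> borel_measurable (borel \<Otimes>\<^sub>M MU)" unfolding \<kappa>_def
    by (rule measurable_compose[OF KY']) (rule measurable_measure_prob_algebra, simp)
  \<comment> \<open>The values of \<kappa> are known to be probabilities only on the space of
    \<open>(X, U)\<close>. Clipping changes nothing there and gives the bounds at every point, as
    \<open>cond_indep_integral\<close> asks.\<close>
  define \<kappa>' where "\<kappa>' z = max 0 (min 1 (\<kappa> z))" for z
  have \<kappa>'m[measurable]: "\<kappa>' \<in> borel_measurable (borel \<Otimes>\<^sub>M MU)" unfolding \<kappa>'_def by measurable
  have \<kappa>'01: "0 \<le> \<kappa>' z" "\<kappa>' z \<le> 1" for z by (auto simp: \<kappa>'_def)
  have em: "emeasure (KY z) B = ennreal (\<kappa>' z)" if "z \<in> space (borel \<Otimes>\<^sub>M MU)" for z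
  proof -
    interpret k: prob_space "KY z" using cond_law_sets(1)[OF KY that] .
    show ?thesis using k.prob_le_1[of B] by (simp add: k.emeasure_eq_measure \<kappa>'_def \<kappa>_def)
  qed
  have XU[measurable]: "XU \<in> Q \<rightarrow>\<^sub>M borel \<Otimes>\<^sub>M MU" by measurable
  have emQ: "emeasure (KY (XU \<omega>)) B = ennreal (\<kappa>' (XU \<omega>))" if "\<omega> \<in> space Q" for \<omega>
    using measurable_space[OF XU that] by (rule em)
  have base: "(\<integral>\<omega>. indicator C (XU \<omega>) * indicator (UNIV \<times> B) (Y01 \<omega>) \<partial>Q) =
      (\<integral>\<omega>. indicator C (XU \<omega>) * \<kappa>' (XU \<omega>) \<partial>Q)"
    if C[measurable]: "C \<in> sets (borel \<Otimes>\<^sub>M MU)" for C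
  proof -
    have "ennreal (\<integral>\<omega>. indicator C (XU \<omega>) * indicator (UNIV \<times> B) (Y01 \<omega>) \<partial>Q) =
      (\<integral>\<^sup>+\<omega>. ennreal (indicator C (XU \<omega>) * indicator (UNIV \<times> B) (Y01 \<omega>)) \<partial>Q)"
      by (rule nn_integral_eq_integral[symmetric]) (auto intro!: integrable_unit_bounded simp: indicator_def)
    also have "\<dots> = emeasure Q {\<omega> \<in> space Q. (XU \<omega>) \<in> C \<and> outcome1 \<omega> \<in> B}"
      by (subst emeasure_Collect_nn_integral) (measurable, auto intro!: nn_integral_cong simp: indicator_def of_bool_def)
    also have "\<dots> = (\<integral>\<^sup>+\<omega>. indicator C (XU \<omega>) * emeasure (KY (XU \<omega>)) B \<partial>Q)"
      by (rule cond_lawD[OF KY C B])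
    also have "\<dots> = (\<integral>\<^sup>+\<omega>. ennreal (indicator C (XU \<omega>) * \<kappa>' (XU \<omega>)) \<partial>Q)"
      by (intro nn_integral_cong) (auto simp: emQ indicator_def)
    also have "\<dots> = ennreal (\<integral>\<omega>. indicator C (XU \<omega>) * \<kappa>' (XU \<omega>) \<partial>Q)"
      by (rule nn_integral_eq_integral) (auto intro!: integrable_unit_bounded simp: indicator_def \<kappa>'01)
    finally show ?thesis
      by (subst (asm) ennreal_inj) (auto intro!: integral_nonneg_AE simp: \<kappa>'01)
  qed
  have split: "(\<integral>\<^sup>+\<omega>. indicator (A \<inter> {t} \<times> UNIV) (treat_covar \<omega>) * indicator B (outcome1 \<omega>) \<partial>Q) =
    (\<integral>\<^sup>+\<omega>. indicator (A \<inter> {t} \<times> UNIV) (treat_covar \<omega>) * ennreal (\<kappa>' (XU \<omega>)) \<partial>Q)" for t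
  proof -
    have At[measurable]: "Pair t -` A \<in> sets borel"
      using measurable_sets[OF measurable_Pair1' A, of t] by auto
    \<comment> \<open>For fixed t the event in \<open>(T, X)\<close> becomes an event in X, and
      crossed with the whole space of U an event in the conditioning variable
      \<open>(X, U)\<close>.\<close>
    let ?C = "(Pair t -` A) \<times> space MU"
    have C[measurable]: "?C \<in> sets (borel \<Otimes>\<^sub>M MU)" by measurable
    have uM: "unmeas \<omega> \<in> space MU" if "\<omega> \<in> space Q" for \<omega>
      using measurable_space[OF full_measurable(5)[OF Q] that] .
    have "(\<integral>\<^sup>+\<omega>. indicator (A \<inter> {t} \<times> UNIV) (treat_covar \<omega>) * indicator B (outcome1 \<omega>) \<partial>Q) =
      (\<integral>\<^sup>+\<omega>. ennreal (indicator ?C (XU \<omega>) * (indicator (UNIV \<times> B) (Y01 \<omega>) * indicator {t} (treat \<omega>))) \<partial>Q)"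
      (is "(\<integral>\<^sup>+\<omega>. ?h1 \<omega> \<partial>_) = (\<integral>\<^sup>+\<omega>. ?h2 \<omega> \<partial>_)")
    proof (rule nn_integral_cong)
      fix \<omega> assume "\<omega> \<in> space Q"
      from uM[OF this] show "?h1 \<omega> = ?h2 \<omega>"
        by (cases "treat \<omega>"; cases t) (simp_all add: indicator_def treat_covar_def)
    qed
    also have "\<dots> = ennreal (\<integral>\<omega>. indicator ?C (XU \<omega>) * (indicator (UNIV \<times> B) (Y01 \<omega>) * indicator {t} (treat \<omega>)) \<partial>Q)"
      by (rule nn_integral_eq_integral) (auto intro!: integrable_unit_bounded simp: indicator_def)
    also have "(\<integral>\<omega>. indicator ?C (XU \<omega>) * (indicator (UNIV \<times> B) (Y01 \<omega>) * indicator {t} (treat \<omega>)) \<partial>Q) =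
      (\<integral>\<omega>. indicator ?C (XU \<omega>) * (\<kappa>' (XU \<omega>) * indicator {t} (treat \<omega>)) \<partial>Q)"
      by (rule cond_indep_integral[OF prob_space_axioms _ _ XU ind _ _ C \<kappa>'m \<kappa>'01 base]) measurable
    also have "ennreal \<dots> = (\<integral>\<^sup>+\<omega>. ennreal (indicator ?C (XU \<omega>) * (\<kappa>' (XU \<omega>) * indicator {t} (treat \<omega>))) \<partial>Q)"
      by (rule nn_integral_eq_integral[symmetric]) (auto intro!: integrable_unit_bounded simp: indicator_def \<kappa>'01)
    also have "\<dots> = (\<integral>\<^sup>+\<omega>. indicator (A \<inter> {t} \<times> UNIV) (treat_covar \<omega>) * ennreal (\<kappa>' (XU \<omega>)) \<partial>Q)"
      (is "(\<integral>\<^sup>+\<omega>. ?h1 \<omega> \<partial>_) = (\<integral>\<^sup>+\<omega>. ?h2 \<omega> \<partial>_)")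
    proof (rule nn_integral_cong)
      fix \<omega> assume "\<omega> \<in> space Q"
      from uM[OF this] show "?h1 \<omega> = ?h2 \<omega>"
        by (cases "treat \<omega>"; cases t) (simp_all add: indicator_def treat_covar_def)
    qed
    finally show ?thesis .
  qed
  have [measurable]: "A \<inter> {t} \<times> UNIV \<in> sets TX_space" for t by measurable
  have ind_split: "indicator A v = indicator (A \<inter> {True} \<times> UNIV) v + (indicator (A \<inter> {False} \<times> UNIV) v :: ennreal)" for v
    by (cases v) (auto simp: indicator_def)
  have "emeasure Q {\<omega> \<in> space Q. treat_covar \<omega> \<in> A \<and> outcome1 \<omega> \<in> B} =
    (\<integral>\<^sup>+\<omega>. indicator A (treat_covar \<omega>) * indicator B (outcome1 \<omega>) \<partial>Q)"
    by (subst emeasure_Collect_nn_integral) (measurable, auto intro!: nn_integral_cong simp: indicator_def of_bool_def)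
  also have "\<dots> = (\<integral>\<^sup>+\<omega>. indicator A (treat_covar \<omega>) * ennreal (\<kappa>' (XU \<omega>)) \<partial>Q)"
    unfolding ind_split distrib_right by (subst (1 2) nn_integral_add) (simp_all add: split)
  also have "\<dots> = (\<integral>\<^sup>+\<omega>. (\<lambda>(v, u). indicator A v * ennreal (\<kappa>' (snd v, u))) (treat_covar \<omega>, unmeas \<omega>) \<partial>Q)"
    by (simp add: treat_covar_def)
  also have "\<dots> = (\<integral>\<^sup>+\<omega>. (\<integral>\<^sup>+u. (\<lambda>(v, u). indicator A v * ennreal (\<kappa>' (snd v, u))) (treat_covar \<omega>, u) \<partial>KU (treat_covar \<omega>)) \<partial>Q)"
    by (rule cond_law_nn_integral[OF KU prob_space_axioms]) measurable
  also have "\<dots> = (\<integral>\<^sup>+\<omega>. indicator A (treat_covar \<omega>) * emeasure (KU (treat_covar \<omega>) \<bind> (\<lambda>u. KY (snd (treat_covar \<omega>), u))) B \<partial>Q)"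
  proof (rule nn_integral_cong)
    fix \<omega> assume "\<omega> \<in> space Q"
    then have v: "treat_covar \<omega> \<in> space TX_space" using measurable_space[OF full_measurable(6)[OF Q]] by auto
    note c = cond_law_sets[OF KU v]
    have [measurable]: "(\<lambda>u. KY (snd (treat_covar \<omega>), u)) \<in> KU (treat_covar \<omega>) \<rightarrow>\<^sub>M subprob_algebra borel"
      unfolding measurable_cong_sets[OF c(2) refl] by measurable
    have [measurable]: "(\<lambda>u. ennreal (\<kappa>' (snd (treat_covar \<omega>), u))) \<in> borel_measurable (KU (treat_covar \<omega>))"
      unfolding measurable_cong_sets[OF c(2) refl] by measurable
    have "emeasure (KU (treat_covar \<omega>) \<bind> (\<lambda>u. KY (snd (treat_covar \<omega>), u))) B =
      (\<integral>\<^sup>+u. emeasure (KY (snd (treat_covar \<omega>), u)) B \<partial>KU (treat_covar \<omega>))"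
      using prob_space.not_empty[OF c(1)] by (intro emeasure_bind[where N=borel]) measurable
    also have "\<dots> = (\<integral>\<^sup>+u. ennreal (\<kappa>' (snd (treat_covar \<omega>), u)) \<partial>KU (treat_covar \<omega>))"
      by (intro nn_integral_cong em) (auto simp: space_pair_measure c)
    finally show "(\<integral>\<^sup>+u. (\<lambda>(v, u). indicator A v * ennreal (\<kappa>' (snd v, u))) (treat_covar \<omega>, u) \<partial>KU (treat_covar \<omega>)) =
        indicator A (treat_covar \<omega>) * emeasure (KU (treat_covar \<omega>) \<bind> (\<lambda>u. KY (snd (treat_covar \<omega>), u))) B"
      by (simp add: nn_integral_cmult)
  qed
  finally show "emeasure Q {\<omega> \<in> space Q. treat_covar \<omega> \<in> A \<and> outcome1 \<omega> \<in> B} =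
    (\<integral>\<^sup>+\<omega>. indicator A (treat_covar \<omega>) * emeasure (KU (treat_covar \<omega>) \<bind> (\<lambda>u. KY (snd (treat_covar \<omega>), u))) B \<partial>Q)" .
qed

text \<open>The setwise form of the statement that the density of \<open>G\<close> with respect to
  \<open>F\<close> lies between \<open>b1\<close> and \<open>b2\<close>; it commits to no version of
  that density.\<close>

definition ratio_between :: "real \<Rightarrow> real \<Rightarrow> real measure \<Rightarrow> real measure \<Rightarrow> bool" where
  "ratio_between b1 b2 F G \<longleftrightarrow>
     (\<forall>B\<in>sets borel. b1 * measure F B \<le> measure G B \<and> measure G B \<le> b2 * measure F B)"

lemma deMSM_bounds:
  fixes P :: "('x::polish_space, 'v) full measure" and Q :: "('x, 'u) full measure"
  assumes P: "full_law MV P" and ov: "overlap P"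
    and \<Lambda>: "\<And>x. 0 \<le> \<Lambda>1 x" "\<And>x. \<Lambda>1 x \<le> 1" "\<And>x. 1 \<le> \<Lambda>2 x"
    and \<Gamma>: "\<And>x. 0 \<le> \<Gamma>1 x" "\<And>x. \<Gamma>1 x \<le> 1" "\<And>x. 1 \<le> \<Gamma>2 x"
    and K: "cond_law P treat_covar TX_space observed borel K"
    and Q: "deMSM P \<Lambda>1 \<Lambda>2 \<Gamma>1 \<Gamma>2 MU Q"
    and J: "cond_law Q treat_covar TX_space outcome1 borel J"
  shows "AE x in covar_law P. ratio_between (bar1 \<Lambda>1 \<Lambda>2 \<Gamma>1 \<Gamma>2 x) (bar2 \<Lambda>1 \<Lambda>2 \<Gamma>1 \<Gamma>2 x)
    (K (True, x)) (J (False, x))"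
proof -
  have fQ: "full_law MU Q" and oQ: "observed_law Q = observed_law P"
    and ind: "cond_indep Q Y01 (borel \<Otimes>\<^sub>M borel) treat (count_space UNIV)
       XU (borel \<Otimes>\<^sub>M MU)"
    and lc: "lambda_constraint \<Lambda>1 \<Lambda>2 MU Q" and oc: "omega_constraint \<Gamma>1 \<Gamma>2 MU Q"
    using Q by (auto simp: deMSM_def)
  note [measurable] = full_measurable[OF fQ]
  have pQ: "prob_space Q" using fQ by (simp add: full_law_def)
  obtain KU where KU: "cond_law Q treat_covar TX_space unmeas MU KU"
    and lam: "AE x in covar_law Q. absolutely_continuous (KU (True, x)) (KU (False, x)) \<and>
       (AE u in KU (True, x). RN_deriv (KU (True, x)) (KU (False, x)) u \<in> {ennreal (\<Lambda>1 x)..ennreal (\<Lambda>2 x)})"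
    using lc by (auto simp: lambda_constraint_def)
  obtain KY J0 where KY: "cond_law Q XU (borel \<Otimes>\<^sub>M MU) outcome1 borel KY"
    and J0: "cond_law Q treat_covar TX_space outcome1 borel J0"
    and om: "AE (x, u) in distr Q (borel \<Otimes>\<^sub>M MU) XU.
           absolutely_continuous (J0 (True, x)) (KY (x, u)) \<and>
           (AE y in J0 (True, x). RN_deriv (J0 (True, x)) (KY (x, u)) y \<in> {ennreal (\<Gamma>1 x)..ennreal (\<Gamma>2 x)})"
    using oc unfolding omega_constraint_def by blast
  let ?om = "\<lambda>x u. absolutely_continuous (J0 (True, x)) (KY (x, u)) \<and>
           (AE y in J0 (True, x). RN_deriv (J0 (True, x)) (KY (x, u)) y \<in> {ennreal (\<Gamma>1 x)..ennreal (\<Gamma>2 x)})"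
  let ?J' = "\<lambda>v. KU v \<bind> (\<lambda>u. KY (snd v, u))"
  note J' = deMSM_untreated_law[OF fQ ind KU KY]
  have KU'[measurable]: "KU \<in> TX_space \<rightarrow>\<^sub>M prob_algebra MU" and KY'[measurable]: "KY \<in> borel \<Otimes>\<^sub>M MU \<rightarrow>\<^sub>M prob_algebra borel"
    using KU KY by (auto simp: cond_law_def)
  have XU[measurable]: "XU \<in> Q \<rightarrow>\<^sub>M borel \<Otimes>\<^sub>M MU" by measurable
  obtain N where N: "N \<in> null_sets (distr Q (borel \<Otimes>\<^sub>M MU) XU)"
    and NP: "{z \<in> space (borel \<Otimes>\<^sub>M MU). \<not> (case z of (x, u) \<Rightarrow> ?om x u)} \<subseteq> N"
    using om by (auto simp: eventually_ae_filter)
  have Nm[measurable]: "N \<in> sets (borel \<Otimes>\<^sub>M MU)" using N by auto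
  \<comment> \<open>The exceptional set of the omega constraint, viewed inside
    \<open>(T, X, U)\<close>, so that it can be disintegrated along the law of U given
    \<open>(T, X)\<close>.\<close>
  define N' where "N' = {z \<in> space (TX_space \<Otimes>\<^sub>M MU). (snd (fst z), snd z) \<in> N}"
  have N'm: "N' \<in> sets (TX_space \<Otimes>\<^sub>M MU)" unfolding N'_def by measurable
  have "AE \<omega> in Q. (XU \<omega>) \<notin> N"
    using AE_not_in[OF N] by (subst (asm) AE_distr_iff) auto
  then have "AE \<omega> in Q. (treat_covar \<omega>, unmeas \<omega>) \<notin> N'"
    by eventually_elim (simp add: N'_def treat_covar_def)
  from cond_law_AE[OF KU pQ _ _ N'm this]
  have a1: "AE v in distr Q TX_space treat_covar. AE u in KU v. (v, u) \<notin> N'" by measurable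
  \<comment> \<open>Four kernels compete for the law of the outcome given \<open>(T, X)\<close>: the
    given \<open>J\<close>, the mixture over U, the \<open>J0\<close> chosen by the omega
    constraint, and, in the treated arm, \<open>K\<close> from the observed data. Uniqueness
    identifies them almost everywhere.\<close>
  have a2: "AE v in distr Q TX_space treat_covar. J v = ?J' v"
    by (rule cond_law_unique[OF J J' pQ]) measurable
  have a3: "AE v in distr Q TX_space treat_covar. J v = J0 v"
    by (rule cond_law_unique[OF J J0 pQ]) measurable
  have a4: "AE v in distr Q TX_space treat_covar. J v = (if fst v then K v else J v)"
    by (rule cond_law_unique[OF J cond_law_outcome1_treated[OF P fQ oQ K J] pQ]) measurable
  have "AE v in distr Q TX_space treat_covar. (AE u in KU v. (v, u) \<notin> N') \<and> J v = ?J' v \<and> J v = J0 v \<and> J v = (if fst v then K v else J v)"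
    using a1 a2 a3 a4 by eventually_elim simp
  \<comment> \<open>\<open>mixture_bounds\<close> compares the two arms at one and the same x, so
    the identifications must hold at \<open>(True, x)\<close> and \<open>(False, x)\<close>
    together; this is where overlap enters.\<close>
  from overlap_AE[OF P ov this[unfolded observed_law_eqD(1)[OF P fQ oQ]]]
  show ?thesis using lam[unfolded observed_law_eqD(2)[OF P fQ oQ]]
  proof eventually_elim
    case (elim x)
    have vs: "v \<in> space TX_space" for v :: "bool \<times> 'x" by (simp add: space_pair_measure)
    note U = cond_law_sets[OF KU vs]
    have F: "J0 (True, x) = K (True, x)" "K (True, x) = KU (True, x) \<bind> (\<lambda>u. KY (x, u))"
      "J (False, x) = KU (False, x) \<bind> (\<lambda>u. KY (x, u))"
      using elim by auto
    have omx: "AE u in KU (True, x). ?om x u"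
      using conjunct1[OF conjunct1[OF elim(1)]] AE_space
    proof eventually_elim
      case (elim u)
      then show ?case using NP by (auto simp: N'_def space_pair_measure U)
    qed
    have km: "(\<lambda>u. KY (x, u)) \<in> KU (True, x) \<rightarrow>\<^sub>M prob_algebra borel"
      unfolding measurable_cong_sets[OF U(2) refl] by measurable
    have s: "sets (KU (False, x)) = sets (KU (True, x))" by (simp add: U)
    note nn = \<Lambda>(1)[of x] order_trans[OF zero_le_one \<Lambda>(3)[of x]] \<Gamma>(1)[of x] order_trans[OF zero_le_one \<Gamma>(3)[of x]]
    have b: "bar1 \<Lambda>1 \<Lambda>2 \<Gamma>1 \<Gamma>2 x * measure (K (True, x)) B \<le> measure (J (False, x)) B \<and>
      measure (J (False, x)) B \<le> bar2 \<Lambda>1 \<Lambda>2 \<Gamma>1 \<Gamma>2 x * measure (K (True, x)) B" if B: "B \<in> sets borel" for B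
    proof -
      note mb = mixture_bounds[OF U(1) U(1) s cond_law_sets(1,2)[OF K vs] km conjunct1[OF elim(2)] conjunct2[OF elim(2)] nn(1,2)
          omx[unfolded F(1)] nn(3,4) F(2) B, folded F(3)]
      show ?thesis
        unfolding bar_eq[of \<Lambda>1 x \<Lambda>2 \<Gamma>1 \<Gamma>2, OF \<Lambda>(2,3) \<Gamma>(2,3)]
        using mb by (simp add: min_def)
    qed
    then show ?case by (simp add: ratio_between_def)
  qed
qed

section \<open>Extremal weights and quantiles\<close>

text \<open>The setwise inequalities say that \<open>G\<close> lies between two scalings of
  \<open>F\<close> in the order of measures, and integrals of nonnegative functions are monotone in
  the measure.\<close>

lemma ratio_between_nn_integral:
  assumes F: "real_distribution F" and G: "real_distribution G" and b: "0 \<le> b1" "0 \<le> b2"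
    and r: "ratio_between b1 b2 F G" and f[measurable]: "f \<in> borel_measurable borel"
  shows "ennreal b1 * (\<integral>\<^sup>+y. f y \<partial>F) \<le> (\<integral>\<^sup>+y. f y \<partial>G)" "(\<integral>\<^sup>+y. f y \<partial>G) \<le> ennreal b2 * (\<integral>\<^sup>+y. f y \<partial>F)"
proof -
  interpret F: real_distribution F by fact
  interpret G: real_distribution G by fact
  have [measurable]: "f \<in> borel_measurable F" by simp
  have "scale_measure (ennreal b1) F \<le> G"
    using r b by (subst le_measure) (auto simp: ratio_between_def F.emeasure_eq_measure G.emeasure_eq_measure
        ennreal_mult'[symmetric] intro!: ennreal_leI)
  from nn_integral_mono_measure[OF _ this, of f]
  show "ennreal b1 * (\<integral>\<^sup>+y. f y \<partial>F) \<le> (\<integral>\<^sup>+y. f y \<partial>G)"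
    by (simp add: nn_integral_scale_measure)
  have "G \<le> scale_measure (ennreal b2) F"
    using r b by (subst le_measure) (auto simp: ratio_between_def F.emeasure_eq_measure G.emeasure_eq_measure
        ennreal_mult'[symmetric] intro!: ennreal_leI)
  from nn_integral_mono_measure[OF _ this, of f]
  show "(\<integral>\<^sup>+y. f y \<partial>G) \<le> ennreal b2 * (\<integral>\<^sup>+y. f y \<partial>F)"
    by (simp add: nn_integral_scale_measure)
qed

lemma ratio_between_integrable:
  fixes f :: "real \<Rightarrow> real"
  assumes F: "real_distribution F" and G: "real_distribution G" and b: "0 \<le> b1" "0 \<le> b2"
    and r: "ratio_between b1 b2 F G" and f: "integrable F f"
  shows "integrable G f"
proof -
  interpret F: real_distribution F by fact
  interpret G: real_distribution G by fact
  have [measurable]: "f \<in> borel_measurable borel" using borel_measurable_integrable[OF f] by simp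
  have "(\<integral>\<^sup>+y. ennreal (norm (f y)) \<partial>G) \<le> ennreal b2 * (\<integral>\<^sup>+y. ennreal (norm (f y)) \<partial>F)"
    by (rule ratio_between_nn_integral(2)[OF F G b r]) measurable
  also have "\<dots> < \<infinity>" using f by (auto simp: integrable_iff_bounded ennreal_mult_less_top)
  finally show ?thesis by (auto simp: integrable_iff_bounded)
qed

lemma ratio_between_integral:
  fixes f :: "real \<Rightarrow> real"
  assumes F: "real_distribution F" and G: "real_distribution G" and b: "0 \<le> b1" "0 \<le> b2"
    and r: "ratio_between b1 b2 F G" and f: "integrable F f" "\<And>y. 0 \<le> f y"
  shows "b1 * (\<integral>y. f y \<partial>F) \<le> (\<integral>y. f y \<partial>G)" "(\<integral>y. f y \<partial>G) \<le> b2 * (\<integral>y. f y \<partial>F)"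
proof -
  interpret F: real_distribution F by fact
  interpret G: real_distribution G by fact
  have [measurable]: "f \<in> borel_measurable borel" using borel_measurable_integrable[OF f(1)] by simp
  note g = ratio_between_integrable[OF F G b r f(1)]
  have nn: "0 \<le> (\<integral>y. f y \<partial>F)" "0 \<le> (\<integral>y. f y \<partial>G)" by (auto intro!: integral_nonneg_AE f)
  have *: "(\<integral>\<^sup>+y. ennreal (f y) \<partial>F) = ennreal (\<integral>y. f y \<partial>F)" "(\<integral>\<^sup>+y. ennreal (f y) \<partial>G) = ennreal (\<integral>y. f y \<partial>G)"
    using f g by (auto intro!: nn_integral_eq_integral)
  have "(\<lambda>y. ennreal (f y)) \<in> borel_measurable borel" by measurable
  from ratio_between_nn_integral[OF F G b r this]
  show "b1 * (\<integral>y. f y \<partial>F) \<le> (\<integral>y. f y \<partial>G)" "(\<integral>y. f y \<partial>G) \<le> b2 * (\<integral>y. f y \<partial>F)"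
    using b nn by (simp_all add: * ennreal_mult[symmetric])
qed

section \<open>Minimisers of the check function are quantiles\<close>

lemma rho_diff_le:
  assumes "0 \<le> \<gamma>" "\<gamma> \<le> 1"
  shows "q < r \<Longrightarrow> rho \<gamma> y r - rho \<gamma> y q \<le> (r - q) * (indicator {..<r} y - \<gamma>)"
    "r < q \<Longrightarrow> rho \<gamma> y r - rho \<gamma> y q \<le> (q - r) * (\<gamma> - indicator {..r} y)"
proof -
  have *: "\<gamma> * a \<le> a" if "0 \<le> a" for a using assms that by (simp add: mult_left_le_one_le)
  have **: "0 \<le> \<gamma> * a" if "0 \<le> a" for a using assms that by simp
  show "q < r \<Longrightarrow> rho \<gamma> y r - rho \<gamma> y q \<le> (r - q) * (indicator {..<r} y - \<gamma>)"
    using *[of "y - q"] **[of "y - q"] by (auto simp: rho_def max_def indicator_def algebra_simps)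
  show "r < q \<Longrightarrow> rho \<gamma> y r - rho \<gamma> y q \<le> (q - r) * (\<gamma> - indicator {..r} y)"
    using *[of "q - y"] **[of "q - y"] by (auto simp: rho_def max_def indicator_def algebra_simps)
qed

lemma integrable_rho:
  assumes "prob_space F" and "integrable F f"
  shows "integrable F (\<lambda>y. rho \<gamma> (f y) q)"
proof -
  interpret prob_space F by fact
  show ?thesis unfolding rho_def using assms(2) by auto
qed

text \<open>\<open>rho\<close> is convex in its last argument, so \<open>rho_diff_le\<close> bounds
  a difference by a subgradient at the far end r. Since q is a minimiser, the mean difference is
  nonnegative, which bounds the distribution function at each r on either side of q. Letting r tend
  to q gives the value at q from the right and the left limit from the left; no derivative of the
  expected loss is taken.\<close>

lemma rho_minimizer_quantile:
  assumes F: "real_distribution F" and i: "integrable F (\<lambda>y. y)" and \<gamma>: "0 \<le> \<gamma>" "\<gamma> \<le> 1"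
    and min: "\<And>r. (\<integral>y. rho \<gamma> y q \<partial>F) \<le> (\<integral>y. rho \<gamma> y r \<partial>F)"
  shows "measure F {..<q} \<le> \<gamma>" "measure F {q<..} \<le> 1 - \<gamma>"
proof -
  interpret F: real_distribution F by fact
  have ir: "integrable F (\<lambda>y. rho \<gamma> y r)" for r by (rule integrable_rho[OF _ i]) unfold_locales
  have ii: "integrable F (\<lambda>y. c * (indicator A y - \<gamma>))" "integrable F (\<lambda>y. c * (\<gamma> - indicator A y))"
    if "A \<in> sets borel" for A c
    using that by (auto intro!: integrable_mult_right Bochner_Integration.integrable_diff simp: F.emeasure_eq_measure)
  have pF: "measure F UNIV = 1" using F.prob_space by simp
  have "\<gamma> \<le> cdf F r" if "q < r" for r
  proof -
    have "0 \<le> (\<integral>y. rho \<gamma> y r - rho \<gamma> y q \<partial>F)" using min[of r] ir by simp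
    also have "\<dots> \<le> (\<integral>y. (r - q) * (indicator {..<r} y - \<gamma>) \<partial>F)"
      using ir rho_diff_le(1)[OF \<gamma> that] by (intro integral_mono ii) auto
    also have "\<dots> = (r - q) * (measure F {..<r} - \<gamma>)" by (subst integral_mult_right_zero, subst Bochner_Integration.integral_diff) (auto simp: pF F.emeasure_eq_measure)
    finally have "\<gamma> \<le> measure F {..<r}" using that by (simp add: zero_le_mult_iff)
    also have "\<dots> \<le> cdf F r" unfolding cdf_def by (rule F.finite_measure_mono) auto
    finally show ?thesis .
  qed
  then have "\<forall>\<^sub>F r in at_right q. \<gamma> \<le> cdf F r" by (auto simp: eventually_at_filter)
  then have 1: "\<gamma> \<le> cdf F q"
    using F.cdf_is_right_cont[of q] by (intro tendsto_lowerbound[where F="at_right q"]) (auto simp: continuous_within)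
  have "measure F {q<..} = 1 - measure F {..q}"
    using F.prob_compl[of "{..q}"] by (simp add: Compl_eq_Diff_UNIV[symmetric])
  then show "measure F {q<..} \<le> 1 - \<gamma>" using 1 by (simp add: cdf_def)
  have "cdf F r \<le> \<gamma>" if "r < q" for r
  proof -
    have "0 \<le> (\<integral>y. rho \<gamma> y r - rho \<gamma> y q \<partial>F)" using min[of r] ir by simp
    also have "\<dots> \<le> (\<integral>y. (q - r) * (\<gamma> - indicator {..r} y) \<partial>F)"
      using ir rho_diff_le(2)[OF \<gamma> that] by (intro integral_mono ii) auto
    also have "\<dots> = (q - r) * (\<gamma> - measure F {..r})" by (subst integral_mult_right_zero, subst Bochner_Integration.integral_diff) (auto simp: pF F.emeasure_eq_measure)
    finally show ?thesis using that by (simp add: zero_le_mult_iff cdf_def)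
  qed
  then have "\<forall>\<^sub>F r in at_left q. cdf F r \<le> \<gamma>" by (auto simp: eventually_at_filter)
  then show "measure F {..<q} \<le> \<gamma>"
    using F.cdf_at_left[of q] by (intro tendsto_upperbound[where F="at_left q"]) auto
qed

text \<open>The Neyman-Pearson weight. The value at an atom q is whatever brings the mean to 1. If q
  carries no mass its value has no influence on integrals, and 1 is chosen because it lies between
  \<open>b1\<close> and \<open>b2\<close>. The nonzero factor \<open>s\<close> orients the line, so
  that one definition serves upper and lower tails.\<close>

definition opt_weight :: "real \<Rightarrow> real \<Rightarrow> real \<Rightarrow> real \<Rightarrow> real measure \<Rightarrow> real \<Rightarrow> real" where
  "opt_weight b1 b2 s q F y =
     (if s * q < s * y then b2 else if s * y < s * q then b1 else if measure F {q} = 0 then 1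
      else (1 - b2 * measure F {y. s * q < s * y} - b1 * measure F {y. s * y < s * q}) / measure F {q})"

context
  fixes F :: "real measure" and b1 b2 s q \<tau> :: real
  assumes F: "real_distribution F" and b: "b1 \<le> 1" "1 \<le> b2" and \<tau>: "(b2 - b1) * \<tau> = b2 - 1"
    and s: "s \<noteq> 0"
    and low: "measure F {y. s * y < s * q} \<le> \<tau>" and high: "measure F {y. s * q < s * y} \<le> 1 - \<tau>"
begin

interpretation F: real_distribution F by (rule F)

lemma opt_weight_masses:
  "measure F {y. s * q < s * y} + measure F {y. s * y < s * q} + measure F {q} = 1"
proof -
  have "measure F ({y. s * q < s * y} \<union> {y. s * y < s * q} \<union> {q}) =
    measure F {y. s * q < s * y} + measure F {y. s * y < s * q} + measure F {q}"
    by (subst F.finite_measure_Union; (subst F.finite_measure_Union)?) auto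
  moreover have "y \<in> {y. s * q < s * y} \<union> {y. s * y < s * q} \<union> {q}" for y
    using s linorder_neqE[of "s * y" "s * q"] by fastforce
  then have "{y. s * q < s * y} \<union> {y. s * y < s * q} \<union> {q} = space F" by auto
  ultimately show ?thesis using F.prob_space by simp
qed

text \<open>The two quantile inequalities are what keeps the value at the atom in range: the bound
  on the mass above q gives at least \<open>b1\<close>, and the bound on the mass below q gives at
  most \<open>b2\<close>.\<close>

lemma opt_weight_bounds: "b1 \<le> opt_weight b1 b2 s q F y" "opt_weight b1 b2 s q F y \<le> b2"
proof -
  have D: "0 \<le> b2 - b1" using b by simp
  have 1: "(b2 - b1) * measure F {y. s * y < s * q} \<le> b2 - 1"
    using mult_left_mono[OF low D] \<tau> by simp
  have 2: "(b2 - b1) * measure F {y. s * q < s * y} \<le> 1 - b1"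
    using mult_left_mono[OF high D] \<tau> by (simp add: algebra_simps)
  have m: "measure F {q} = 1 - measure F {y. s * q < s * y} - measure F {y. s * y < s * q}"
    using opt_weight_masses by simp
  have "b1 * measure F {q} \<le> 1 - b2 * measure F {y. s * q < s * y} - b1 * measure F {y. s * y < s * q}"
    "1 - b2 * measure F {y. s * q < s * y} - b1 * measure F {y. s * y < s * q} \<le> b2 * measure F {q}"
    using 1 2 unfolding m by (simp_all add: algebra_simps)
  then show "b1 \<le> opt_weight b1 b2 s q F y" "opt_weight b1 b2 s q F y \<le> b2"
    using b measure_nonneg[of F "{q}"] by (auto simp: opt_weight_def pos_le_divide_eq pos_divide_le_eq less_le)
qed

lemma opt_weight_integral: "(\<integral>y. opt_weight b1 b2 s q F y \<partial>F) = 1"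
proof -
  define c where "c = opt_weight b1 b2 s q F q"
  have w: "opt_weight b1 b2 s q F y =
     b2 * indicator {y. s * q < s * y} y + b1 * indicator {y. s * y < s * q} y + c * indicator {q} y" for y
    using s by (auto simp: opt_weight_def c_def indicator_def neq_iff mult_less_cancel_left)
  have "(\<integral>y. opt_weight b1 b2 s q F y \<partial>F) =
    b2 * measure F {y. s * q < s * y} + b1 * measure F {y. s * y < s * q} + c * measure F {q}"
    unfolding w by (subst Bochner_Integration.integral_add Bochner_Integration.integrable_add | auto simp: F.emeasure_eq_measure)+
  also have "\<dots> = 1"
  proof (cases "measure F {q} = 0")
    case True
    let ?h = "measure F {y. s * q < s * y}" and ?l = "measure F {y. s * y < s * q}"
    \<comment> \<open>Without an atom at q the two masses already fill the whole line, so the two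
      quantile inequalities must both be equalities, and the mean is
      \<open>b2 * (1 - \<tau>) + b1 * \<tau> = 1\<close>.\<close>
    have "?h + ?l = 1" using opt_weight_masses True by simp
    then have hl: "?l = \<tau>" "?h = 1 - \<tau>" using low high by auto
    show ?thesis unfolding hl True using \<tau> by (simp add: algebra_simps)
  qed (auto simp: c_def opt_weight_def)
  finally show ?thesis .
qed

lemma opt_weight_borel: "opt_weight b1 b2 s q F \<in> borel_measurable borel"
  unfolding opt_weight_def by measurable

text \<open>The hypotheses on \<phi> ask only that it exceed or fall below the level c on the
  correct side of q; ties at c are allowed. Where \<phi> equals c, the weight contributes through
  its mean alone, so its value at q never has to be known.\<close>

lemma opt_weight_integral_split:
  assumes \<phi>: "integrable F \<phi>" and gt: "\<And>y. c < \<phi> y \<Longrightarrow> s * q < s * y" and lt: "\<And>y. \<phi> y < c \<Longrightarrow> s * y < s * q"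
  shows "(\<integral>y. opt_weight b1 b2 s q F y * \<phi> y \<partial>F) =
    c + b2 * (\<integral>y. max (\<phi> y - c) 0 \<partial>F) - b1 * (\<integral>y. max (c - \<phi> y) 0 \<partial>F)"
    "integrable F (\<lambda>y. opt_weight b1 b2 s q F y * \<phi> y)"
proof -
  note [measurable] = opt_weight_borel
  have w: "opt_weight b1 b2 s q F y * \<phi> y = c * opt_weight b1 b2 s q F y + b2 * max (\<phi> y - c) 0 - b1 * max (c - \<phi> y) 0" for y
  proof -
    consider "c < \<phi> y" | "\<phi> y < c" | "\<phi> y = c" by linarith
    then show ?thesis
    proof cases
      case 1 then show ?thesis using gt[OF 1] by (simp add: opt_weight_def algebra_simps)
    next
      case 2 then show ?thesis using lt[OF 2] by (simp add: opt_weight_def algebra_simps)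
    qed (simp add: mult.commute)
  qed
  have i: "integrable F (opt_weight b1 b2 s q F)" "integrable F (\<lambda>y. max (\<phi> y - c) 0)" "integrable F (\<lambda>y. max (c - \<phi> y) 0)"
  proof -
    have "norm (opt_weight b1 b2 s q F y) \<le> \<bar>b1\<bar> + \<bar>b2\<bar>" for y
      using opt_weight_bounds[of y] by simp
    then show "integrable F (opt_weight b1 b2 s q F)"
      by (intro F.integrable_const_bound[where B="\<bar>b1\<bar> + \<bar>b2\<bar>"]) auto
  qed (use \<phi> in auto)
  show "(\<integral>y. opt_weight b1 b2 s q F y * \<phi> y \<partial>F) =
    c + b2 * (\<integral>y. max (\<phi> y - c) 0 \<partial>F) - b1 * (\<integral>y. max (c - \<phi> y) 0 \<partial>F)"
    unfolding w using i by (simp add: opt_weight_integral)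
  show "integrable F (\<lambda>y. opt_weight b1 b2 s q F y * \<phi> y)"
    unfolding w using i by simp
qed

text \<open>Write \<phi> as c plus the excess over c minus the shortfall below c. Under
  \<open>G\<close> the excess is worth at most \<open>b2\<close> times, and the shortfall at least
  \<open>b1\<close> times, its value under \<open>F\<close>, and the weight attains both. A general
  \<phi> is kept because negative parts are compared later as well.\<close>

lemma opt_weight_optimal:
  assumes \<phi>: "integrable F \<phi>" and gt: "\<And>y. c < \<phi> y \<Longrightarrow> s * q < s * y" and lt: "\<And>y. \<phi> y < c \<Longrightarrow> s * y < s * q"
    and G: "real_distribution G" "ratio_between b1 b2 F G" and b1: "0 \<le> b1"
  shows "(\<integral>y. \<phi> y \<partial>G) \<le> (\<integral>y. opt_weight b1 b2 s q F y * \<phi> y \<partial>F)"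
proof -
  interpret G: real_distribution G by (rule G)
  have b2: "0 \<le> b2" using b by simp
  note ib = ratio_between_integrable[OF F G(1) b1 b2 G(2)]
  note rb = ratio_between_integral[OF F G(1) b1 b2 G(2)]
  have i: "integrable F (\<lambda>y. max (\<phi> y - c) 0)" "integrable F (\<lambda>y. max (c - \<phi> y) 0)" using \<phi> by auto
  have "(\<integral>y. \<phi> y \<partial>G) = (\<integral>y. c + max (\<phi> y - c) 0 - max (c - \<phi> y) 0 \<partial>G)"
    by (intro Bochner_Integration.integral_cong) auto
  also have "\<dots> = c + (\<integral>y. max (\<phi> y - c) 0 \<partial>G) - (\<integral>y. max (c - \<phi> y) 0 \<partial>G)"
    using ib[OF i(1)] ib[OF i(2)] using G.prob_space by simp
  also have "\<dots> \<le> c + b2 * (\<integral>y. max (\<phi> y - c) 0 \<partial>F) - b1 * (\<integral>y. max (c - \<phi> y) 0 \<partial>F)"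
    using rb(2)[OF i(1)] rb(1)[OF i(2)] by simp
  finally show ?thesis by (simp add: opt_weight_integral_split(1)[OF \<phi> gt lt])
qed

text \<open>Let p and n be the mean excess and shortfall of s y relative to s q. The integral
  exceeds the mean of s y by \<open>(b2 - 1) * p + (1 - b1) * n\<close>, and \<tau> is the weight
  that turns this into \<open>b2 - b1\<close> times the expected check function.\<close>

lemma opt_weight_value:
  assumes i: "integrable F (\<lambda>y. y)"
  shows "(\<integral>y. opt_weight b1 b2 s q F y * (s * y) \<partial>F) =
    s * (\<integral>y. y \<partial>F) + (b2 - b1) * (\<integral>y. rho \<tau> (s * y) (s * q) \<partial>F)"
proof -
  let ?p = "\<integral>y. max (s * y - s * q) 0 \<partial>F" and ?n = "\<integral>y. max (s * q - s * y) 0 \<partial>F"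
  have i': "integrable F (\<lambda>y. max (s * y - s * q) 0)" "integrable F (\<lambda>y. max (s * q - s * y) 0)" "integrable F (\<lambda>y. s * y)"
    using i by auto
  have "(\<integral>y. s * y \<partial>F) = (\<integral>y. s * q + max (s * y - s * q) 0 - max (s * q - s * y) 0 \<partial>F)"
    by (intro Bochner_Integration.integral_cong) auto
  also have "\<dots> = s * q + ?p - ?n" using i' F.prob_space by simp
  finally have m: "s * (\<integral>y. y \<partial>F) = s * q + ?p - ?n" using i by simp
  have r: "(\<integral>y. rho \<tau> (s * y) (s * q) \<partial>F) = \<tau> * ?p + (1 - \<tau>) * ?n"
    unfolding rho_def using i' by simp
  have "(b2 - b1) * (1 - \<tau>) = 1 - b1" using \<tau> by (simp add: algebra_simps)
  then have "(b2 - b1) * (\<tau> * ?p + (1 - \<tau>) * ?n) = (b2 - 1) * ?p + (1 - b1) * ?n"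
    unfolding \<tau>[symmetric] by (simp add: distrib_left mult.assoc[symmetric])
  then show ?thesis
    unfolding m r by (subst opt_weight_integral_split(1)[OF i'(3), where c="s * q"]) (auto simp: algebra_simps)
qed

end

lemma bar_weights:
  assumes "0 \<le> \<Lambda>1 x" "\<Lambda>1 x \<le> 1" "1 \<le> \<Lambda>2 x" "0 \<le> \<Gamma>1 x" "\<Gamma>1 x \<le> 1" "1 \<le> \<Gamma>2 x"
  shows "0 \<le> bar1 \<Lambda>1 \<Lambda>2 \<Gamma>1 \<Gamma>2 x" "bar1 \<Lambda>1 \<Lambda>2 \<Gamma>1 \<Gamma>2 x \<le> 1" "1 \<le> bar2 \<Lambda>1 \<Lambda>2 \<Gamma>1 \<Gamma>2 x"
    "(bar2 \<Lambda>1 \<Lambda>2 \<Gamma>1 \<Gamma>2 x - bar1 \<Lambda>1 \<Lambda>2 \<Gamma>1 \<Gamma>2 x) * tau_bar \<Lambda>1 \<Lambda>2 \<Gamma>1 \<Gamma>2 x = bar2 \<Lambda>1 \<Lambda>2 \<Gamma>1 \<Gamma>2 x - 1"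
    "0 \<le> tau_bar \<Lambda>1 \<Lambda>2 \<Gamma>1 \<Gamma>2 x" "tau_bar \<Lambda>1 \<Lambda>2 \<Gamma>1 \<Gamma>2 x \<le> 1"
proof -
  note b = bar_eq[of \<Lambda>1 x \<Lambda>2 \<Gamma>1 \<Gamma>2, OF assms(2,3,5,6)]
  \<comment> \<open>The minimum in \<open>bar1\<close> is at most this product of two numbers in the
    unit interval, so the lower bound on the weight is never negative.\<close>
  have "(1 - \<Lambda>1 x) * (1 - \<Gamma>1 x) \<le> 1" using assms by (intro mult_le_one) auto
  then show "0 \<le> bar1 \<Lambda>1 \<Lambda>2 \<Gamma>1 \<Gamma>2 x" unfolding b by (simp add: min_def)
  show 1: "bar1 \<Lambda>1 \<Lambda>2 \<Gamma>1 \<Gamma>2 x \<le> 1" "1 \<le> bar2 \<Lambda>1 \<Lambda>2 \<Gamma>1 \<Gamma>2 x" unfolding b using assms by (auto simp: min_def)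
  from tau_weights[of "bar1 \<Lambda>1 \<Lambda>2 \<Gamma>1 \<Gamma>2" x "bar2 \<Lambda>1 \<Lambda>2 \<Gamma>1 \<Gamma>2", OF this]
  show "(bar2 \<Lambda>1 \<Lambda>2 \<Gamma>1 \<Gamma>2 x - bar1 \<Lambda>1 \<Lambda>2 \<Gamma>1 \<Gamma>2 x) * tau_bar \<Lambda>1 \<Lambda>2 \<Gamma>1 \<Gamma>2 x = bar2 \<Lambda>1 \<Lambda>2 \<Gamma>1 \<Gamma>2 x - 1"
    "0 \<le> tau_bar \<Lambda>1 \<Lambda>2 \<Gamma>1 \<Gamma>2 x" "tau_bar \<Lambda>1 \<Lambda>2 \<Gamma>1 \<Gamma>2 x \<le> 1"
    by (simp_all add: tau_bar_def mult.commute)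
qed

section \<open>A law in the model with a given density ratio\<close>

lemma measurable_density_kernel:
  assumes L[measurable]: "L \<in> M \<rightarrow>\<^sub>M prob_algebra N" and f[measurable]: "f \<in> borel_measurable (M \<Otimes>\<^sub>M N)"
    and one: "\<And>x. x \<in> space M \<Longrightarrow> (\<integral>\<^sup>+y. f (x, y) \<partial>L x) = 1"
  shows "(\<lambda>x. density (L x) (\<lambda>y. f (x, y))) \<in> M \<rightarrow>\<^sub>M prob_algebra N"
proof (rule measurable_prob_algebraI)
  note [measurable] = measurable_prob_algebraD[OF L]
  have s: "sets (L x) = sets N" if "x \<in> space M" for x
    using measurable_space[OF L that] by (simp add: space_prob_algebra)
  have fx: "(\<lambda>y. f (x, y)) \<in> borel_measurable (L x)" if "x \<in> space M" for x
    unfolding measurable_cong_sets[OF s[OF that] refl] using that by measurable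
  show p: "prob_space (density (L x) (\<lambda>y. f (x, y)))" if "x \<in> space M" for x
  proof
    show "emeasure (density (L x) (\<lambda>y. f (x, y))) (space (density (L x) (\<lambda>y. f (x, y)))) = 1"
      using fx[OF that] one[OF that]
      by (subst emeasure_density) (auto intro!: trans[OF nn_integral_cong one[OF that]] simp: indicator_def)
  qed
  show "(\<lambda>x. density (L x) (\<lambda>y. f (x, y))) \<in> M \<rightarrow>\<^sub>M subprob_algebra N"
  proof (rule measurable_subprob_algebra)
    fix A assume A[measurable]: "A \<in> sets N"
    have "(\<lambda>x. \<integral>\<^sup>+y. f (x, y) * indicator A y \<partial>L x) \<in> borel_measurable M"
      by (rule nn_integral_measurable_subprob_algebra2[where N=N]) measurable
    then show "(\<lambda>x. emeasure (density (L x) (\<lambda>y. f (x, y))) A) \<in> borel_measurable M"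
      by (rule measurable_cong[THEN iffD2, rotated]) (subst emeasure_density, auto simp: fx s)
  qed (auto simp: s p prob_space_imp_subprob_space)
qed

lemma RN_deriv_density_range:
  assumes M: "prob_space M" and d[measurable]: "d \<in> borel_measurable M" and b: "\<And>u. l \<le> d u" "\<And>u. d u \<le> r"
  shows "absolutely_continuous M (density M (\<lambda>u. ennreal (d u)))"
    "AE u in M. RN_deriv M (density M (\<lambda>u. ennreal (d u))) u \<in> {ennreal l..ennreal r}"
proof -
  interpret prob_space M by fact
  show "absolutely_continuous M (density M (\<lambda>u. ennreal (d u)))"
    by (rule absolutely_continuousI_density) measurable
  have "AE u in M. ennreal (d u) = RN_deriv M (density M (\<lambda>u. ennreal (d u))) u"
    by (rule RN_deriv_unique) auto
  then show "AE u in M. RN_deriv M (density M (\<lambda>u. ennreal (d u))) u \<in> {ennreal l..ennreal r}"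
  proof eventually_elim
    case (elim u)
    show ?case unfolding elim[symmetric] using b[of u] by (auto intro: ennreal_leI)
  qed
qed

section \<open>The two density ratios of the construction\<close>

abbreviation uniform01 :: "real measure" where
  "uniform01 \<equiv> uniform_measure lborel {0..1}"

lemma prob_space_uniform01: "prob_space uniform01"
  by (rule prob_space_uniform_measure) auto

lemma nn_integral_uniform01_step:
  assumes s: "0 \<le> s" "s \<le> 1"
  shows "(\<integral>\<^sup>+u. (if u < s then a else b) \<partial>uniform01) = ennreal s * a + ennreal (1 - s) * b"
proof -
  interpret prob_space uniform01 by (rule prob_space_uniform01)
  have "emeasure uniform01 {..<s} = ennreal s"
  proof -
    have "{0..1} \<inter> {..<s} = {0..<s}" using s by auto
    then show ?thesis using s by (simp add: emeasure_uniform_measure divide_ennreal_def)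
  qed
  moreover have "emeasure uniform01 {s..} = ennreal (1 - s)"
  proof -
    have "{0..1} \<inter> {s..} = {s..1}" using s by auto
    then show ?thesis using s by (simp add: emeasure_uniform_measure divide_ennreal_def)
  qed
  moreover have "(if u < s then a else b) = a * indicator {..<s} u + b * indicator {s..} u" for u
    by (auto simp: indicator_def)
  ultimately show ?thesis
    by (simp add: nn_integral_add nn_integral_cmult mult.commute)
qed

lemma standard_borel_real: "standard_borel (borel :: real measure)"
  unfolding standard_borel_def
proof (intro exI conjI)
  show "completely_metrizable_space (euclidean :: real topology)" by (rule completely_metrizable_space_euclidean)
  show "second_countable (euclidean :: real topology)"
  proof -
    obtain B :: "real set set" where B: "countable B" "\<And>V. V \<in> B \<Longrightarrow> open V" "\<And>S. open S \<Longrightarrow> \<exists>U. U \<subseteq> B \<and> S = \<Union>U"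
      using univ_second_countable by blast
    show ?thesis
      unfolding second_countable_def open_openin[symmetric]
    proof (intro exI[of _ B] conjI ballI allI impI)
      fix U x assume "open U \<and> (x::real) \<in> U"
      then obtain V where "V \<subseteq> B" "U = \<Union>V" "x \<in> U" using B(3) by blast
      then show "\<exists>V\<in>B. x \<in> V \<and> V \<subseteq> U" by blast
    qed (use B in auto)
  qed
qed (simp_all add: borel_def)

text \<open>\<open>w\<close> is the prescribed density of the untreated law with respect to the
  treated one. Its bounds and its mean are imposed for every x, so no null sets enter below.\<close>

locale sensitivity_construction =
  fixes P :: "('x::polish_space, 'v) full measure"
    and MV :: "'v measure"
    and \<Lambda>1 \<Lambda>2 \<Gamma>1 \<Gamma>2 :: "'x \<Rightarrow> real"
    and K :: "bool \<times> 'x \<Rightarrow> real measure"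
    and w :: "'x \<Rightarrow> real \<Rightarrow> real"
  assumes P: "full_law MV P"
    and \<Lambda>\<Gamma>_measurable[measurable]: "\<Lambda>1 \<in> borel_measurable borel" "\<Lambda>2 \<in> borel_measurable borel"
      "\<Gamma>1 \<in> borel_measurable borel" "\<Gamma>2 \<in> borel_measurable borel"
    and \<Lambda>: "\<And>x. 0 \<le> \<Lambda>1 x" "\<And>x. \<Lambda>1 x \<le> 1" "\<And>x. 1 \<le> \<Lambda>2 x"
    and \<Gamma>: "\<And>x. 0 \<le> \<Gamma>1 x" "\<And>x. \<Gamma>1 x \<le> 1" "\<And>x. 1 \<le> \<Gamma>2 x"
    and K: "cond_law P treat_covar TX_space observed borel K"
    and w_measurable[measurable]: "case_prod w \<in> borel_measurable (borel \<Otimes>\<^sub>M borel)"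
    and w_bounds: "\<And>x y. bar1 \<Lambda>1 \<Lambda>2 \<Gamma>1 \<Gamma>2 x \<le> w x y" "\<And>x y. w x y \<le> bar2 \<Lambda>1 \<Lambda>2 \<Gamma>1 \<Gamma>2 x"
    and w_integral: "\<And>x. (\<integral>y. w x y \<partial>K (True, x)) = 1"
begin

text \<open>U is uniform given \<open>T = 1\<close> and serves as a coin: \<open>s x\<close> is the
  probability of the event on which \<lambda> takes its upper value, and it is forced by the
  requirement that \<lambda> have mean 1.\<close>

definition s :: "'x \<Rightarrow> real" where "s x = 1 - tau \<Lambda>1 \<Lambda>2 x"

definition lam :: "'x \<Rightarrow> real \<Rightarrow> real" where
  "lam x u = (if u < s x then \<Lambda>2 x else \<Lambda>1 x)"

text \<open>In the degenerate case \<open>\<Lambda>1 x = 1\<close> or \<open>\<Lambda>2 x = 1\<close> both bounds on \<open>w x\<close> are 1, and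
  since division by 0 gives 0 this is the constant 1.\<close>

definition om :: "'x \<Rightarrow> real \<Rightarrow> real \<Rightarrow> real" where
  "om x u y = (if u < s x then 1 + (w x y - 1) / (1 - \<Lambda>1 x) else 1 - (w x y - 1) / (\<Lambda>2 x - 1))"

definition lamT :: "bool \<times> 'x \<Rightarrow> real \<Rightarrow> real" where
  "lamT v u = (if fst v then 1 else lam (snd v) u)"

definition wT :: "bool \<times> 'x \<Rightarrow> real \<Rightarrow> real" where
  "wT v y = (if fst v then 1 else w (snd v) y)"

lemma s01: "0 \<le> s x" "s x \<le> 1" "s x * (\<Lambda>2 x - \<Lambda>1 x) = 1 - \<Lambda>1 x" "(1 - s x) * (\<Lambda>2 x - \<Lambda>1 x) = \<Lambda>2 x - 1"
  using tau_weights[of \<Lambda>1 x \<Lambda>2] \<Lambda> by (auto simp: s_def)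

lemmas bars = bar_eq[of \<Lambda>1 _ \<Lambda>2 \<Gamma>1 \<Gamma>2, OF \<Lambda>(2,3) \<Gamma>(2,3)]

lemma w_diff:
  "w x y - 1 \<le> (1 - \<Lambda>1 x) * (\<Gamma>2 x - 1)" "w x y - 1 \<le> (\<Lambda>2 x - 1) * (1 - \<Gamma>1 x)"
  "1 - w x y \<le> (1 - \<Lambda>1 x) * (1 - \<Gamma>1 x)" "1 - w x y \<le> (\<Lambda>2 x - 1) * (\<Gamma>2 x - 1)"
  using w_bounds[of x y] unfolding bars by (auto simp: min_def split: if_splits)

lemma w_nonneg: "0 \<le> w x y"
  using w_bounds(1)[of x y] bar_weights(1)[of \<Lambda>1 x \<Lambda>2 \<Gamma>1 \<Gamma>2] \<Lambda>[of x] \<Gamma>[of x] by linarith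

lemma w_trivial: "w x y = 1" if "\<Lambda>1 x = 1 \<or> \<Lambda>2 x = 1"
  using w_diff[where x=x and y=y] that by auto

text \<open>Divided by \<open>1 - \<Lambda>1 x\<close> or \<open>\<Lambda>2 x - 1\<close>, the four
  inequalities of \<open>w_diff\<close> become an upper and a lower bound on each of the two
  branches of \<open>om\<close>. Each product in the bars is used exactly once.\<close>

lemma om_bounds: "\<Gamma>1 x \<le> om x u y" "om x u y \<le> \<Gamma>2 x"
proof -
  have "\<Gamma>1 x \<le> om x u y \<and> om x u y \<le> \<Gamma>2 x"
  proof (cases "\<Lambda>1 x = 1 \<or> \<Lambda>2 x = 1")
    case True then show ?thesis using w_trivial[OF True] \<Gamma> by (simp add: om_def)
  next
    case False
    then have p: "0 < 1 - \<Lambda>1 x" "0 < \<Lambda>2 x - 1" using \<Lambda>[of x] by auto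
    have "(w x y - 1) / (1 - \<Lambda>1 x) \<le> \<Gamma>2 x - 1" "- ((w x y - 1) / (1 - \<Lambda>1 x)) \<le> 1 - \<Gamma>1 x"
      "(w x y - 1) / (\<Lambda>2 x - 1) \<le> 1 - \<Gamma>1 x" "- ((w x y - 1) / (\<Lambda>2 x - 1)) \<le> \<Gamma>2 x - 1"
      unfolding minus_divide_left using w_diff[where x=x and y=y] p by (auto simp: pos_divide_le_eq mult.commute)
    then show ?thesis by (simp add: om_def)
  qed
  then show "\<Gamma>1 x \<le> om x u y" "om x u y \<le> \<Gamma>2 x" by auto
qed

lemma om_nonneg: "0 \<le> om x u y" using om_bounds(1)[of x u y] \<Gamma>(1)[of x] by linarith

lemma s_measurable[measurable]: "s \<in> borel_measurable borel"
  unfolding s_def tau_def by measurable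

lemma weights_measurable[measurable]:
  "(\<lambda>(v, u). lamT v u) \<in> borel_measurable (TX_space \<Otimes>\<^sub>M borel)"
  "(\<lambda>(x, u, y). om x u y) \<in> borel_measurable (borel \<Otimes>\<^sub>M (borel \<Otimes>\<^sub>M borel))"
  "(\<lambda>(v, y). wT v y) \<in> borel_measurable (TX_space \<Otimes>\<^sub>M borel)"
  unfolding lamT_def lam_def om_def wT_def case_prod_unfold
  using w_measurable[unfolded case_prod_unfold] by (measurable)

lemma space_TX: "v \<in> space TX_space"
  by (simp add: space_pair_measure)

lemma K_kernel: "K \<in> TX_space \<rightarrow>\<^sub>M prob_algebra borel"
  using K by (simp add: cond_law_def)

lemma real_distribution_K: "real_distribution (K v)"
  using cond_law_sets(1,2)[OF K space_TX, of v] by (simp add: real_distribution_def real_distribution_axioms_def)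

lemma lamT_integral: "(\<integral>\<^sup>+u. ennreal (lamT v u) \<partial>uniform01) = 1"
proof (cases "fst v")
  case True
  interpret prob_space uniform01 by (rule prob_space_uniform01)
  show ?thesis using True emeasure_space_1 by (simp add: lamT_def)
next
  case False
  have "(\<integral>\<^sup>+u. ennreal (lamT v u) \<partial>uniform01) =
    (\<integral>\<^sup>+u. (if u < s (snd v) then ennreal (\<Lambda>2 (snd v)) else ennreal (\<Lambda>1 (snd v))) \<partial>uniform01)"
    using False by (intro nn_integral_cong) (simp add: lamT_def lam_def)
  also have "\<dots> = ennreal (s (snd v) * \<Lambda>2 (snd v) + (1 - s (snd v)) * \<Lambda>1 (snd v))"
    using s01[of "snd v"] \<Lambda>[of "snd v"]
    by (subst nn_integral_uniform01_step) (auto simp: ennreal_mult[symmetric] ennreal_plus[symmetric] simp del: ennreal_plus)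
  also have "s (snd v) * \<Lambda>2 (snd v) + (1 - s (snd v)) * \<Lambda>1 (snd v) = 1"
    using s01(3)[of "snd v"] by (simp add: algebra_simps)
  finally show ?thesis by simp
qed

lemma w_integrable: "integrable (K (True, x)) (w x)"
proof -
  interpret F: real_distribution "K (True, x)" by (rule real_distribution_K)
  have [measurable]: "w x \<in> borel_measurable borel"
    using measurable_compose[OF measurable_Pair1' w_measurable, of x] by simp
  show "integrable (K (True, x)) (w x)"
    using w_nonneg[of x] w_bounds(2)[of x]
    by (intro F.integrable_const_bound[where B="bar2 \<Lambda>1 \<Lambda>2 \<Gamma>1 \<Gamma>2 x"]) auto
qed

text \<open>For fixed u, \<open>om\<close> is 1 plus a multiple of \<open>w - 1\<close>, which has
  mean 0.\<close>

lemma om_integral: "(\<integral>\<^sup>+y. ennreal (om x u y) \<partial>K (True, x)) = 1"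
proof -
  interpret F: real_distribution "K (True, x)" by (rule real_distribution_K)
  note i = w_integrable[of x]
  have io: "integrable (K (True, x)) (\<lambda>y. om x u y)" using i by (cases "u < s x") (simp_all add: om_def)
  have "(\<integral>y. om x u y \<partial>K (True, x)) = 1"
    using i F.prob_space by (cases "u < s x") (simp_all add: om_def w_integral)
  then show ?thesis
    using io om_nonneg by (subst nn_integral_eq_integral) auto
qed

lemma wT_integral: "(\<integral>\<^sup>+y. ennreal (wT v y) \<partial>K (True, snd v)) = 1"
proof -
  interpret F: real_distribution "K (True, snd v)" by (rule real_distribution_K)
  show ?thesis
    using w_integrable[of "snd v"] F.emeasure_space_1 w_nonneg by (cases "fst v") (simp_all add: wT_def w_integral nn_integral_eq_integral)
qed

text \<open>Averaging over U with the first ratio as weight turns the second into the prescribed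
  density: 1 in the treated arm, where the two slopes cancel, and w in the untreated arm, where the
  different values of \<lambda> leave a net slope of 1.\<close>

lemma lam_om_integral: "(\<integral>\<^sup>+u. ennreal (lamT v u) * ennreal (om (snd v) u y) \<partial>uniform01) = ennreal (wT v y)"
proof -
  let ?x = "snd v"
  let ?a1 = "1 + (w ?x y - 1) / (1 - \<Lambda>1 ?x)" and ?a0 = "1 - (w ?x y - 1) / (\<Lambda>2 ?x - 1)"
  let ?l2 = "if fst v then 1 else \<Lambda>2 ?x" and ?l1 = "if fst v then 1 else \<Lambda>1 ?x"
  \<comment> \<open>The points \<open>s ?x - 1\<close> and \<open>s ?x\<close> lie on either side of
    the threshold, so each selects one branch of \<open>om\<close>.\<close>
  have a: "0 \<le> ?a1" "0 \<le> ?a0"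
    using om_nonneg[of ?x "s ?x - 1" y] om_nonneg[of ?x "s ?x" y] by (simp_all add: om_def)
  have "(\<integral>\<^sup>+u. ennreal (lamT v u) * ennreal (om ?x u y) \<partial>uniform01) =
    (\<integral>\<^sup>+u. (if u < s ?x then ennreal (?l2 * ?a1) else ennreal (?l1 * ?a0)) \<partial>uniform01)"
    using a \<Lambda>(1,3)[of ?x] by (intro nn_integral_cong) (auto simp: lamT_def lam_def om_def ennreal_mult)
  also have "\<dots> = ennreal (s ?x * (?l2 * ?a1) + (1 - s ?x) * (?l1 * ?a0))"
    using s01[of ?x] \<Lambda>(1,3)[of ?x] a
    by (subst nn_integral_uniform01_step) (auto simp: ennreal_mult[symmetric] ennreal_plus[symmetric] simp del: ennreal_plus)
  also have "s ?x * (?l2 * ?a1) + (1 - s ?x) * (?l1 * ?a0) = wT v y"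
  proof (cases "\<Lambda>1 ?x = 1 \<or> \<Lambda>2 ?x = 1")
    case True
    have "s ?x * \<Lambda>2 ?x + (1 - s ?x) * \<Lambda>1 ?x = 1" using s01(3)[of ?x] by (simp add: algebra_simps)
    then show ?thesis using w_trivial[OF True] by (simp add: wT_def)
  next
    case False
    define D where "D = \<Lambda>2 ?x - \<Lambda>1 ?x"
    have p: "0 < 1 - \<Lambda>1 ?x" "0 < \<Lambda>2 ?x - 1" "0 < D" using \<Lambda>[of ?x] False by (auto simp: D_def)
    \<comment> \<open>The probability of each branch contains the denominator of its slope as a
      factor, so both deviations from 1 carry the same weighted size
      \<open>(w ?x y - 1) / D\<close>.\<close>
    have "s ?x = (1 - \<Lambda>1 ?x) / D" "1 - s ?x = (\<Lambda>2 ?x - 1) / D"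
      using s01(3,4)[of ?x] p by (auto simp: D_def[symmetric] eq_divide_eq)
    moreover have "a / D * (c / a) = c / D" if "0 < a" for a c using that by simp
    ultimately have "s ?x * ((w ?x y - 1) / (1 - \<Lambda>1 ?x)) = (w ?x y - 1) / D"
      "(1 - s ?x) * ((w ?x y - 1) / (\<Lambda>2 ?x - 1)) = (w ?x y - 1) / D"
      using p by (simp_all only:)
    then have 1: "s ?x * ?a1 = s ?x + (w ?x y - 1) / D" "(1 - s ?x) * ?a0 = (1 - s ?x) - (w ?x y - 1) / D"
      by (simp_all only: distrib_left right_diff_distrib[of "1 - s ?x"] mult_1_right)
    have "s ?x * (?l2 * ?a1) + (1 - s ?x) * (?l1 * ?a0) = ?l2 * (s ?x * ?a1) + ?l1 * ((1 - s ?x) * ?a0)"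
      by (simp only: mult.left_commute)
    also have "\<dots> = (?l2 * s ?x + ?l1 * (1 - s ?x)) + (?l2 - ?l1) * ((w ?x y - 1) / D)"
      unfolding 1 by (simp only: algebra_simps)
    also have "\<dots> = wT v y"
    proof (cases "fst v")
      case True then show ?thesis by (simp add: wT_def)
    next
      case False
      have "\<Lambda>2 ?x * s ?x + \<Lambda>1 ?x * (1 - s ?x) = 1" using s01(3)[of ?x] by (simp add: algebra_simps)
      moreover have "(\<Lambda>2 ?x - \<Lambda>1 ?x) * ((w ?x y - 1) / D) = w ?x y - 1" using p by (simp add: D_def[symmetric])
      ultimately show ?thesis using False by (simp add: wT_def)
    qed
    finally show ?thesis .
  qed
  finally show ?thesis .
qed

lemma weights_compose[measurable (raw)]:
  "f \<in> M \<rightarrow>\<^sub>M TX_space \<Longrightarrow> g \<in> borel_measurable M \<Longrightarrow> (\<lambda>z. lamT (f z) (g z)) \<in> borel_measurable M"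
  "f \<in> M \<rightarrow>\<^sub>M TX_space \<Longrightarrow> g \<in> borel_measurable M \<Longrightarrow> (\<lambda>z. wT (f z) (g z)) \<in> borel_measurable M"
  "h \<in> M \<rightarrow>\<^sub>M borel \<Longrightarrow> g \<in> borel_measurable M \<Longrightarrow> k \<in> borel_measurable M \<Longrightarrow> (\<lambda>z. om (h z) (g z) (k z)) \<in> borel_measurable M"
  using measurable_compose[OF measurable_Pair weights_measurable(1)]
    measurable_compose[OF measurable_Pair weights_measurable(3)]
    measurable_compose[OF measurable_Pair[OF _ measurable_Pair] weights_measurable(2)]
  by simp_all

lemma K_sets[simp, measurable_cong]: "sets (K v) = sets borel"
  using cond_law_sets(2)[OF K space_TX] .

lemma prob_space_K: "prob_space (K v)"
  using cond_law_sets(1)[OF K space_TX] .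

lemma KT_kernel[measurable]: "(\<lambda>x. K (t, x)) \<in> borel \<rightarrow>\<^sub>M prob_algebra borel"
  by (rule measurable_compose[OF _ K_kernel]) measurable

lemma KT_kernel'[measurable]: "(\<lambda>v. K (t, snd v)) \<in> TX_space \<rightarrow>\<^sub>M prob_algebra borel"
  by (rule measurable_compose[OF _ K_kernel]) measurable

section \<open>The constructed joint law and its integrals\<close>

definition D :: "(bool \<times> 'x) measure" where "D = distr P TX_space treat_covar"

definition base :: "bool \<times> 'x \<Rightarrow> (real \<times> real \<times> real) measure" where
  "base v = uniform01 \<Otimes>\<^sub>M (K (False, snd v) \<Otimes>\<^sub>M K (True, snd v))"

definition base_full :: "bool \<times> 'x \<Rightarrow> ('x, real) full measure" where
  "base_full v = distr (base v) (full_space borel) (\<lambda>(u, y0, y1). (y0, y1, fst v, snd v, u))"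

text \<open>The law of \<open>(T, X)\<close> is that of \<open>P\<close>. Given it, U,
  \<open>Y\<^sup>0\<close> and \<open>Y\<^sup>1\<close> are drawn independently from the uniform,
  the untreated and the treated law, whatever T is. Then \<open>lamT\<close> tilts U when
  \<open>T = 0\<close>, and \<open>om\<close> tilts \<open>Y\<^sup>1\<close> in both arms.\<close>

definition Q :: "('x, real) full measure" where
  "Q = density (D \<bind> base_full)
     (\<lambda>\<omega>. ennreal (lamT (treat_covar \<omega>) (unmeas \<omega>)) * ennreal (om (covar \<omega>) (unmeas \<omega>) (outcome1 \<omega>)))"

lemma sets_D[simp, measurable_cong]: "sets D = sets TX_space" by (simp add: D_def)

lemma prob_space_D: "prob_space D"
  unfolding D_def using P full_measurable(6)[OF P] by (auto simp: full_law_def intro!: prob_space.prob_space_distr)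

lemma base_kernel: "base \<in> TX_space \<rightarrow>\<^sub>M prob_algebra (borel \<Otimes>\<^sub>M (borel \<Otimes>\<^sub>M borel))"
proof -
  have [measurable]: "(\<lambda>v. uniform01) \<in> TX_space \<rightarrow>\<^sub>M prob_algebra borel"
    by (rule measurable_const) (simp add: space_prob_algebra prob_space_uniform01)
  show ?thesis unfolding base_def[abs_def] by measurable
qed

lemma base_full_kernel: "base_full \<in> TX_space \<rightarrow>\<^sub>M prob_algebra (full_space borel)"
  unfolding base_full_def[abs_def] full_space_def
  by (rule measurable_distr_prob_space2[OF base_kernel]) measurable

lemma sets_base: "sets (D \<bind> base_full) = sets (full_space borel)"
  using sets_bind[of D base_full "full_space borel"] prob_space.not_empty[OF prob_space_D]
    measurable_space[OF base_full_kernel] by (auto simp: space_prob_algebra space_TX)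

abbreviation "dens v u y1 \<equiv> ennreal (lamT v u) * ennreal (om (snd v) u y1)"

lemma sets_Q[simp, measurable_cong]: "sets Q = sets (full_space borel)"
  by (simp add: Q_def sets_base)

text \<open>All later computations start from this iterated integral. With \<open>Y\<^sup>1\<close>
  innermost and U outside, \<open>om\<close> integrates to 1 first and \<open>lamT\<close>
  afterwards.\<close>

lemma nn_integral_Q:
  fixes f :: "('x, real) full \<Rightarrow> ennreal"
  assumes f[measurable]: "f \<in> borel_measurable (full_space borel)"
  shows "(\<integral>\<^sup>+\<omega>. f \<omega> \<partial>Q) = (\<integral>\<^sup>+v. (\<integral>\<^sup>+u. (\<integral>\<^sup>+y0. (\<integral>\<^sup>+y1.
    dens v u y1 * f (y0, y1, fst v, snd v, u)
      \<partial>K (True, snd v)) \<partial>K (False, snd v)) \<partial>uniform01) \<partial>D)"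
proof -
  have f'[measurable]: "f \<in> borel_measurable (borel \<Otimes>\<^sub>M (borel \<Otimes>\<^sub>M (count_space UNIV \<Otimes>\<^sub>M (borel \<Otimes>\<^sub>M borel))))"
    using f by (simp add: full_space_def)
  let ?g = "\<lambda>\<omega>. ennreal (lamT (treat_covar \<omega>) (unmeas \<omega>)) * ennreal (om (covar \<omega>) (unmeas \<omega>) (outcome1 \<omega>))"
  have g[measurable]: "?g \<in> borel_measurable (full_space borel)" by measurable
  have bk: "base_full \<in> D \<rightarrow>\<^sub>M subprob_algebra (full_space borel)"
    unfolding measurable_cong_sets[OF sets_D refl] by (rule measurable_prob_algebraD[OF base_full_kernel])
  have "(\<integral>\<^sup>+\<omega>. f \<omega> \<partial>Q) = (\<integral>\<^sup>+\<omega>. ?g \<omega> * f \<omega> \<partial>(D \<bind> base_full))"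
    unfolding Q_def by (rule nn_integral_density) (simp_all add: measurable_cong_sets[OF sets_base refl])
  also have "\<dots> = (\<integral>\<^sup>+v. (\<integral>\<^sup>+\<omega>. ?g \<omega> * f \<omega> \<partial>base_full v) \<partial>D)"
    by (rule nn_integral_bind[OF _ bk]) measurable
  also have "\<dots> = (\<integral>\<^sup>+v. (\<integral>\<^sup>+u. (\<integral>\<^sup>+y0. (\<integral>\<^sup>+y1.
    dens v u y1 * f (y0, y1, fst v, snd v, u)
      \<partial>K (True, snd v)) \<partial>K (False, snd v)) \<partial>uniform01) \<partial>D)"
  proof (rule nn_integral_cong)
    fix v :: "bool \<times> 'x"
    interpret KT: prob_space "K (True, snd v)" by (rule prob_space_K)
    interpret KF: prob_space "K (False, snd v)" by (rule prob_space_K)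
    interpret KK: pair_prob_space "K (False, snd v)" "K (True, snd v)" ..
    let ?h = "\<lambda>(u, y0, y1). dens v u y1 * f (y0, y1, fst v, snd v, u)"
    have v[measurable]: "v \<in> space TX_space" by (rule space_TX)
    have h[measurable]: "?h \<in> borel_measurable (borel \<Otimes>\<^sub>M (borel \<Otimes>\<^sub>M borel))" by measurable
    have sb: "sets (base v) = sets (borel \<Otimes>\<^sub>M (borel \<Otimes>\<^sub>M borel))"
      unfolding base_def by (intro sets_pair_measure_cong) auto
    have "(\<integral>\<^sup>+\<omega>. ?g \<omega> * f \<omega> \<partial>base_full v) = (\<integral>\<^sup>+z. ?h z \<partial>base v)"
    proof -
      have t: "(\<lambda>(u, y0, y1). (y0, y1, fst v, snd v, u)) \<in> base v \<rightarrow>\<^sub>M full_space borel"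
        unfolding measurable_cong_sets[OF sb refl] full_space_def by measurable
      have gf: "(\<lambda>\<omega>. ?g \<omega> * f \<omega>) \<in> borel_measurable (distr (base v) (full_space borel) (\<lambda>(u, y0, y1). (y0, y1, fst v, snd v, u)))"
        unfolding measurable_distr_eq1 by measurable
      show ?thesis
        unfolding base_full_def nn_integral_distr[OF t gf]
        by (auto simp: treat_covar_def intro!: nn_integral_cong)
    qed
    also have "\<dots> = (\<integral>\<^sup>+u. (\<integral>\<^sup>+y. ?h (u, y) \<partial>(K (False, snd v) \<Otimes>\<^sub>M K (True, snd v))) \<partial>uniform01)"
      unfolding base_def by (rule KK.nn_integral_fst[symmetric]) measurable
    also have "\<dots> = (\<integral>\<^sup>+u. (\<integral>\<^sup>+y0. (\<integral>\<^sup>+y1. ?h (u, y0, y1) \<partial>K (True, snd v)) \<partial>K (False, snd v)) \<partial>uniform01)"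
      by (intro nn_integral_cong KT.nn_integral_fst[symmetric]) measurable
    finally show "(\<integral>\<^sup>+\<omega>. ?g \<omega> * f \<omega> \<partial>base_full v) = (\<integral>\<^sup>+u. (\<integral>\<^sup>+y0. (\<integral>\<^sup>+y1.
        dens v u y1 * f (y0, y1, fst v, snd v, u)
      \<partial>K (True, snd v)) \<partial>K (False, snd v)) \<partial>uniform01)" by simp
  qed
  finally show ?thesis .
qed

text \<open>The outcomes are drawn from a kernel in \<open>(X, U)\<close> alone, whence their conditional independence of \<open>T\<close>.\<close>

definition outcome_mean :: "(real \<times> real \<Rightarrow> ennreal) \<Rightarrow> 'x \<times> real \<Rightarrow> ennreal" where
  "outcome_mean f z = (\<integral>\<^sup>+y0. (\<integral>\<^sup>+y1. ennreal (om (fst z) (snd z) y1) * f (y0, y1) \<partial>K (True, fst z)) \<partial>K (False, fst z))"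

lemma outcome_mean_measurable:
  assumes f[measurable]: "f \<in> borel_measurable (borel \<Otimes>\<^sub>M borel)"
  shows "outcome_mean f \<in> borel_measurable (borel \<Otimes>\<^sub>M borel)"
proof -
  have k1: "(\<lambda>z. K (True, fst (fst z))) \<in> (borel \<Otimes>\<^sub>M borel) \<Otimes>\<^sub>M borel \<rightarrow>\<^sub>M subprob_algebra borel"
    by (rule measurable_prob_algebraD, rule measurable_compose[OF _ KT_kernel]) measurable
  have k2: "(\<lambda>z. K (False, fst z)) \<in> borel \<Otimes>\<^sub>M borel \<rightarrow>\<^sub>M subprob_algebra borel"
    by (rule measurable_prob_algebraD, rule measurable_compose[OF _ KT_kernel]) measurable
  have "(\<lambda>z. \<integral>\<^sup>+y1. ennreal (om (fst (fst z)) (snd (fst z)) y1) * f (snd z, y1) \<partial>K (True, fst (fst z)))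
    \<in> borel_measurable ((borel \<Otimes>\<^sub>M borel) \<Otimes>\<^sub>M borel)"
    by (rule nn_integral_measurable_subprob_algebra2[OF _ k1]) measurable
  note [measurable] = this
  show ?thesis unfolding outcome_mean_def[abs_def]
    by (rule nn_integral_measurable_subprob_algebra2[OF _ k2]) (simp add: case_prod_unfold)
qed

lemma outcome_mean_const: "outcome_mean (\<lambda>_. c) z = c"
proof -
  interpret KF: prob_space "K (False, fst z)" by (rule prob_space_K)
  show ?thesis
    by (simp add: outcome_mean_def nn_integral_multc om_integral KF.emeasure_space_1)
qed

section \<open>Marginals of the constructed law\<close>

lemma nn_integral_Q_unmeas:
  assumes f[measurable]: "f \<in> borel_measurable (TX_space \<Otimes>\<^sub>M borel)"
  shows "(\<integral>\<^sup>+\<omega>. f (treat_covar \<omega>, unmeas \<omega>) \<partial>Q) = (\<integral>\<^sup>+v. (\<integral>\<^sup>+u. ennreal (lamT v u) * f (v, u) \<partial>uniform01) \<partial>D)"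
proof -
  have "(\<integral>\<^sup>+\<omega>. f (treat_covar \<omega>, unmeas \<omega>) \<partial>Q) = (\<integral>\<^sup>+v. (\<integral>\<^sup>+u. (\<integral>\<^sup>+y0. (\<integral>\<^sup>+y1.
    dens v u y1 * f (v, u)
      \<partial>K (True, snd v)) \<partial>K (False, snd v)) \<partial>uniform01) \<partial>D)"
    by (subst nn_integral_Q) (simp_all add: treat_covar_def)
  also have "\<dots> = (\<integral>\<^sup>+v. (\<integral>\<^sup>+u. ennreal (lamT v u) * f (v, u) \<partial>uniform01) \<partial>D)"
  proof (intro nn_integral_cong)
    fix v :: "bool \<times> 'x" and u
    interpret KF: prob_space "K (False, snd v)" by (rule prob_space_K)
    have v[measurable]: "v \<in> space TX_space" by (rule space_TX)
    have "(\<integral>\<^sup>+y1. dens v u y1 * f (v, u) \<partial>K (True, snd v)) =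
      (\<integral>\<^sup>+y1. (ennreal (lamT v u) * f (v, u)) * ennreal (om (snd v) u y1) \<partial>K (True, snd v))"
      by (simp only: ac_simps)
    also have "\<dots> = ennreal (lamT v u) * f (v, u)"
      by (subst nn_integral_cmult) (simp_all add: om_integral)
    finally show "(\<integral>\<^sup>+y0. (\<integral>\<^sup>+y1. dens v u y1 * f (v, u) \<partial>K (True, snd v)) \<partial>K (False, snd v)) =
      ennreal (lamT v u) * f (v, u)" by (simp add: KF.emeasure_space_1)
  qed
  finally show ?thesis .
qed

text \<open>The factor \<open>lamT\<close> does not involve the outcomes, and \<open>om\<close> and
  the two outcome laws do not involve T. A function of the outcomes may therefore be replaced by its
  mean given \<open>(X, U)\<close>, even next to a function of T. Both the conditional independence
  and the law of \<open>Y\<^sup>1\<close> given \<open>(X, U)\<close> rest on this.\<close>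

lemma nn_integral_Q_outcomes:
  assumes f[measurable]: "f \<in> borel_measurable (borel \<Otimes>\<^sub>M borel)" and g[measurable]: "g \<in> borel_measurable (TX_space \<Otimes>\<^sub>M borel)"
  shows "(\<integral>\<^sup>+\<omega>. f (Y01 \<omega>) * g (treat_covar \<omega>, unmeas \<omega>) \<partial>Q) =
    (\<integral>\<^sup>+\<omega>. outcome_mean f (XU \<omega>) * g (treat_covar \<omega>, unmeas \<omega>) \<partial>Q)"
proof -
  note [measurable] = outcome_mean_measurable[OF f]
  have k1: "(\<lambda>z. K (True, x)) \<in> borel \<rightarrow>\<^sub>M subprob_algebra borel" for x
    by (rule measurable_prob_algebraD, rule measurable_compose[OF _ KT_kernel]) measurable
  have "(\<integral>\<^sup>+\<omega>. f (Y01 \<omega>) * g (treat_covar \<omega>, unmeas \<omega>) \<partial>Q) = (\<integral>\<^sup>+v. (\<integral>\<^sup>+u. (\<integral>\<^sup>+y0. (\<integral>\<^sup>+y1.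
    dens v u y1 * (f (y0, y1) * g (v, u))
      \<partial>K (True, snd v)) \<partial>K (False, snd v)) \<partial>uniform01) \<partial>D)"
    by (subst nn_integral_Q) (simp_all add: treat_covar_def)
  also have "\<dots> = (\<integral>\<^sup>+v. (\<integral>\<^sup>+u. ennreal (lamT v u) * (outcome_mean f (snd v, u) * g (v, u)) \<partial>uniform01) \<partial>D)"
  proof (intro nn_integral_cong)
    fix v :: "bool \<times> 'x" and u
    have v[measurable]: "v \<in> space TX_space" by (rule space_TX)
    have m: "(\<lambda>y0. \<integral>\<^sup>+y1. ennreal (om (snd v) u y1) * f (y0, y1) \<partial>K (True, snd v)) \<in> borel_measurable (K (False, snd v))"
      unfolding measurable_cong_sets[OF K_sets refl]
      by (rule nn_integral_measurable_subprob_algebra2[OF _ k1]) measurable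
    have "(\<integral>\<^sup>+y1. dens v u y1 * (f (y0, y1) * g (v, u)) \<partial>K (True, snd v)) =
      (ennreal (lamT v u) * g (v, u)) * (\<integral>\<^sup>+y1. ennreal (om (snd v) u y1) * f (y0, y1) \<partial>K (True, snd v))" for y0
      by (subst nn_integral_cmult[symmetric]) (auto simp: ac_simps)
    then have "(\<integral>\<^sup>+y0. (\<integral>\<^sup>+y1. dens v u y1 * (f (y0, y1) * g (v, u)) \<partial>K (True, snd v)) \<partial>K (False, snd v)) =
      (\<integral>\<^sup>+y0. (ennreal (lamT v u) * g (v, u)) * (\<integral>\<^sup>+y1. ennreal (om (snd v) u y1) * f (y0, y1) \<partial>K (True, snd v)) \<partial>K (False, snd v))"
      by simp
    also have "\<dots> = (ennreal (lamT v u) * g (v, u)) * outcome_mean f (snd v, u)"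
      unfolding nn_integral_cmult[OF m] by (simp add: outcome_mean_def)
    finally show "(\<integral>\<^sup>+y0. (\<integral>\<^sup>+y1. dens v u y1 * (f (y0, y1) * g (v, u)) \<partial>K (True, snd v)) \<partial>K (False, snd v)) =
      ennreal (lamT v u) * (outcome_mean f (snd v, u) * g (v, u))"
      by (simp only: ac_simps)
  qed
  also have "\<dots> = (\<integral>\<^sup>+\<omega>. outcome_mean f (XU \<omega>) * g (treat_covar \<omega>, unmeas \<omega>) \<partial>Q)"
    by (subst nn_integral_Q_unmeas[where f="\<lambda>(v, u). outcome_mean f (snd v, u) * g (v, u)", simplified, symmetric])
       (simp_all add: treat_covar_def)
  finally show ?thesis .
qed

lemma nn_integral_Q_outcome0:
  assumes f[measurable]: "f \<in> borel_measurable (borel \<Otimes>\<^sub>M TX_space)"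
  shows "(\<integral>\<^sup>+\<omega>. f (outcome0 \<omega>, treat_covar \<omega>) \<partial>Q) = (\<integral>\<^sup>+v. (\<integral>\<^sup>+y. f (y, v) \<partial>K (False, snd v)) \<partial>D)"
proof -
  have "(\<integral>\<^sup>+\<omega>. f (outcome0 \<omega>, treat_covar \<omega>) \<partial>Q) = (\<integral>\<^sup>+v. (\<integral>\<^sup>+u. (\<integral>\<^sup>+y0. (\<integral>\<^sup>+y1.
    dens v u y1 * f (y0, v)
      \<partial>K (True, snd v)) \<partial>K (False, snd v)) \<partial>uniform01) \<partial>D)"
    by (subst nn_integral_Q) (simp_all add: treat_covar_def)
  also have "\<dots> = (\<integral>\<^sup>+v. (\<integral>\<^sup>+y. f (y, v) \<partial>K (False, snd v)) \<partial>D)"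
  proof (rule nn_integral_cong)
    fix v :: "bool \<times> 'x"
    have v[measurable]: "v \<in> space TX_space" by (rule space_TX)
    have "(\<integral>\<^sup>+y1. dens v u y1 * f (y0, v) \<partial>K (True, snd v)) = ennreal (lamT v u) * f (y0, v)" for u y0
      by (simp add: nn_integral_cmult nn_integral_multc om_integral)
    then show "(\<integral>\<^sup>+u. (\<integral>\<^sup>+y0. (\<integral>\<^sup>+y1. dens v u y1 * f (y0, v)
      \<partial>K (True, snd v)) \<partial>K (False, snd v)) \<partial>uniform01) = (\<integral>\<^sup>+y. f (y, v) \<partial>K (False, snd v))"
      by (simp add: nn_integral_cmult nn_integral_multc lamT_integral)
  qed
  finally show ?thesis .
qed

text \<open>Exchanging the order and integrating U first, at fixed y, lets
  \<open>lam_om_integral\<close> collapse the two ratios to \<open>wT\<close>.\<close>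

lemma nn_integral_Q_outcome1:
  assumes f[measurable]: "f \<in> borel_measurable (borel \<Otimes>\<^sub>M TX_space)"
  shows "(\<integral>\<^sup>+\<omega>. f (outcome1 \<omega>, treat_covar \<omega>) \<partial>Q) = (\<integral>\<^sup>+v. (\<integral>\<^sup>+y. ennreal (wT v y) * f (y, v) \<partial>K (True, snd v)) \<partial>D)"
proof -
  have "(\<integral>\<^sup>+\<omega>. f (outcome1 \<omega>, treat_covar \<omega>) \<partial>Q) = (\<integral>\<^sup>+v. (\<integral>\<^sup>+u. (\<integral>\<^sup>+y0. (\<integral>\<^sup>+y1.
    dens v u y1 * f (y1, v)
      \<partial>K (True, snd v)) \<partial>K (False, snd v)) \<partial>uniform01) \<partial>D)"
    by (subst nn_integral_Q) (simp_all add: treat_covar_def)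
  also have "\<dots> = (\<integral>\<^sup>+v. (\<integral>\<^sup>+y. ennreal (wT v y) * f (y, v) \<partial>K (True, snd v)) \<partial>D)"
  proof (rule nn_integral_cong)
    fix v :: "bool \<times> 'x"
    have v[measurable]: "v \<in> space TX_space" by (rule space_TX)
    interpret KT: prob_space "K (True, snd v)" by (rule prob_space_K)
    interpret KF: prob_space "K (False, snd v)" by (rule prob_space_K)
    interpret U: prob_space uniform01 by (rule prob_space_uniform01)
    interpret UK: pair_prob_space uniform01 "K (True, snd v)" ..
    have "(\<integral>\<^sup>+u. (\<integral>\<^sup>+y1. dens v u y1 * f (y1, v) \<partial>K (True, snd v)) \<partial>uniform01) =
      (\<integral>\<^sup>+y1. (\<integral>\<^sup>+u. dens v u y1 * f (y1, v) \<partial>uniform01) \<partial>K (True, snd v))"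
      by (rule UK.Fubini'[symmetric]) measurable
    also have "\<dots> = (\<integral>\<^sup>+y. ennreal (wT v y) * f (y, v) \<partial>K (True, snd v))"
      by (intro nn_integral_cong) (simp add: nn_integral_multc lam_om_integral)
    finally show "(\<integral>\<^sup>+u. (\<integral>\<^sup>+y0. (\<integral>\<^sup>+y1. dens v u y1 * f (y1, v)
      \<partial>K (True, snd v)) \<partial>K (False, snd v)) \<partial>uniform01) = (\<integral>\<^sup>+y. ennreal (wT v y) * f (y, v) \<partial>K (True, snd v))"
      by (simp add: KF.emeasure_space_1)
  qed
  finally show ?thesis .
qed

lemma full_law_Q: "full_law borel Q"
  unfolding full_law_def
proof (intro conjI standard_borel_real sets_Q)
  interpret D: prob_space D by (rule prob_space_D)
  show "prob_space Q"
  proof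
    have "emeasure Q (space Q) = (\<integral>\<^sup>+\<omega>. 1 \<partial>Q)" by simp
    also have "\<dots> = (\<integral>\<^sup>+v. (\<integral>\<^sup>+u. ennreal (lamT v u) * 1 \<partial>uniform01) \<partial>D)"
      by (rule nn_integral_Q_unmeas) simp
    also have "\<dots> = 1" by (simp add: lamT_integral D.emeasure_space_1)
    finally show "emeasure Q (space Q) = 1" .
  qed
qed

lemma prob_space_Q: "prob_space Q" using full_law_Q by (simp add: full_law_def)

lemmas Q_measurable[measurable] = full_measurable[OF full_law_Q]

lemma D_nn_integral: "f \<in> borel_measurable TX_space \<Longrightarrow> (\<integral>\<^sup>+v. f v \<partial>D) = (\<integral>\<^sup>+\<omega>. f (treat_covar \<omega>) \<partial>P)"
  unfolding D_def using full_measurable(6)[OF P] by (subst nn_integral_distr) auto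

lemma nn_integral_Q_treat_covar:
  assumes f[measurable]: "f \<in> borel_measurable TX_space"
  shows "(\<integral>\<^sup>+\<omega>. f (treat_covar \<omega>) \<partial>Q) = (\<integral>\<^sup>+v. f v \<partial>D)"
proof -
  have "(\<integral>\<^sup>+\<omega>. f (treat_covar \<omega>) \<partial>Q) = (\<integral>\<^sup>+v. (\<integral>\<^sup>+u. ennreal (lamT v u) * f v \<partial>uniform01) \<partial>D)"
    using nn_integral_Q_unmeas[where f="\<lambda>z. f (fst z)"] by simp
  also have "\<dots> = (\<integral>\<^sup>+v. f v \<partial>D)"
  proof (rule nn_integral_cong)
    fix v :: "bool \<times> 'x"
    have v[measurable]: "v \<in> space TX_space" by (rule space_TX)
    show "(\<integral>\<^sup>+u. ennreal (lamT v u) * f v \<partial>uniform01) = f v"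
      by (simp add: nn_integral_multc lamT_integral)
  qed
  finally show ?thesis .
qed

text \<open>A test function splits by T. The treated part sees only \<open>Y\<^sup>1\<close>, whose
  weight \<open>wT\<close> is 1 there, and the untreated part sees only \<open>Y\<^sup>0\<close>,
  which was never tilted; both reproduce \<open>K\<close>.\<close>

lemma observed_law_Q: "observed_law Q = observed_law P"
proof (rule measure_eqI)
  show "sets (observed_law Q) = sets (observed_law P)" by (simp add: observed_law_def)
next
  note [measurable] = full_measurable[OF P]
  have pP: "prob_space P" using P by (simp add: full_law_def)
  have k: "(\<lambda>v. K (t, snd v)) \<in> TX_space \<rightarrow>\<^sub>M subprob_algebra borel" for t
    by (rule measurable_prob_algebraD) measurable
  fix A :: "(real \<times> bool \<times> 'x) set" assume "A \<in> sets (observed_law Q)"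
  then have A[measurable]: "A \<in> sets (borel \<Otimes>\<^sub>M TX_space)" by (simp add: observed_law_def)
  define h where "h = (indicator A :: real \<times> bool \<times> 'x \<Rightarrow> ennreal)"
  have h[measurable]: "h \<in> borel_measurable (borel \<Otimes>\<^sub>M TX_space)" unfolding h_def by measurable
  define f1 where "f1 z = (if fst (snd z) then h z else 0)" for z
  define f0 where "f0 z = (if fst (snd z) then 0 else h z)" for z
  have f[measurable]: "f1 \<in> borel_measurable (borel \<Otimes>\<^sub>M TX_space)" "f0 \<in> borel_measurable (borel \<Otimes>\<^sub>M TX_space)"
    unfolding f1_def f0_def by measurable
  have i1: "(\<lambda>v. \<integral>\<^sup>+y. ennreal (wT v y) * f1 (y, v) \<partial>K (True, snd v)) \<in> borel_measurable TX_space"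
    by (rule nn_integral_measurable_subprob_algebra2[OF _ k]) measurable
  have i0: "(\<lambda>v. \<integral>\<^sup>+y. f0 (y, v) \<partial>K (False, snd v)) \<in> borel_measurable TX_space"
    by (rule nn_integral_measurable_subprob_algebra2[OF _ k]) measurable
  have iK: "(\<lambda>v. \<integral>\<^sup>+y. h (y, v) \<partial>K v) \<in> borel_measurable TX_space"
    by (rule nn_integral_measurable_subprob_algebra2[OF _ measurable_prob_algebraD[OF K_kernel]]) measurable
  have o: "emeasure (observed_law R) A = (\<integral>\<^sup>+\<omega>. h (observed \<omega>, treat_covar \<omega>) \<partial>R)" if "full_law M R" for M :: "'c measure" and R
  proof -
    note [measurable] = full_measurable[OF that]
    have "emeasure (observed_law R) A = (\<integral>\<^sup>+z. h z \<partial>observed_law R)"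
      unfolding h_def by (rule nn_integral_indicator[symmetric]) (simp add: observed_law_def A)
    also have "\<dots> = (\<integral>\<^sup>+\<omega>. h (observed \<omega>, treat_covar \<omega>) \<partial>R)"
      unfolding observed_law_def treat_covar_def by (subst nn_integral_distr) measurable
    finally show ?thesis .
  qed
  have "(\<integral>\<^sup>+\<omega>. h (observed \<omega>, treat_covar \<omega>) \<partial>Q) = (\<integral>\<^sup>+\<omega>. f1 (outcome1 \<omega>, treat_covar \<omega>) + f0 (outcome0 \<omega>, treat_covar \<omega>) \<partial>Q)"
    by (intro nn_integral_cong) (simp add: f1_def f0_def observed_def treat_covar_def)
  also have "\<dots> = (\<integral>\<^sup>+\<omega>. f1 (outcome1 \<omega>, treat_covar \<omega>) \<partial>Q) + (\<integral>\<^sup>+\<omega>. f0 (outcome0 \<omega>, treat_covar \<omega>) \<partial>Q)"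
    by (rule nn_integral_add) measurable
  also have "\<dots> = (\<integral>\<^sup>+v. (\<integral>\<^sup>+y. ennreal (wT v y) * f1 (y, v) \<partial>K (True, snd v)) + (\<integral>\<^sup>+y. f0 (y, v) \<partial>K (False, snd v)) \<partial>D)"
    unfolding nn_integral_Q_outcome1[OF f(1)] nn_integral_Q_outcome0[OF f(2)]
    by (rule nn_integral_add[symmetric]) (simp_all add: measurable_cong_sets[OF sets_D refl] i1 i0)
  also have "\<dots> = (\<integral>\<^sup>+v. (\<integral>\<^sup>+y. h (y, v) \<partial>K v) \<partial>D)"
  proof (rule nn_integral_cong)
    fix v :: "bool \<times> 'x"
    show "(\<integral>\<^sup>+y. ennreal (wT v y) * f1 (y, v) \<partial>K (True, snd v)) + (\<integral>\<^sup>+y. f0 (y, v) \<partial>K (False, snd v)) = (\<integral>\<^sup>+y. h (y, v) \<partial>K v)"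
      by (cases v; cases "fst v") (simp_all add: f1_def f0_def wT_def)
  qed
  also have "\<dots> = (\<integral>\<^sup>+\<omega>. (\<integral>\<^sup>+y. h (y, treat_covar \<omega>) \<partial>K (treat_covar \<omega>)) \<partial>P)"
    by (rule D_nn_integral[OF iK])
  also have "\<dots> = (\<integral>\<^sup>+\<omega>. (\<lambda>(v, y). h (y, v)) (treat_covar \<omega>, observed \<omega>) \<partial>P)"
  proof -
    have "(\<lambda>(v, y). h (y, v)) \<in> borel_measurable (TX_space \<Otimes>\<^sub>M borel)" by measurable
    from cond_law_nn_integral[OF K pP full_measurable(6,7)[OF P] this] show ?thesis by simp
  qed
  finally show "emeasure (observed_law Q) A = emeasure (observed_law P) A"
    unfolding o[OF P] o[OF full_law_Q] by simp
qed

section \<open>Conditional laws of the construction and membership in the model\<close>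

lemma cond_lawI_density:
  assumes L: "L \<in> M \<rightarrow>\<^sub>M prob_algebra N" and f: "f \<in> borel_measurable (M \<Otimes>\<^sub>M N)"
    and one: "\<And>x. x \<in> space M \<Longrightarrow> (\<integral>\<^sup>+y. f (x, y) \<partial>L x) = 1"
    and V[measurable]: "V \<in> Q \<rightarrow>\<^sub>M M" and W[measurable]: "W \<in> Q \<rightarrow>\<^sub>M N"
    and eq: "\<And>A B. A \<in> sets M \<Longrightarrow> B \<in> sets N \<Longrightarrow> (\<integral>\<^sup>+\<omega>. indicator A (V \<omega>) * indicator B (W \<omega>) \<partial>Q) =
       (\<integral>\<^sup>+\<omega>. indicator A (V \<omega>) * (\<integral>\<^sup>+y. f (V \<omega>, y) * indicator B y \<partial>L (V \<omega>)) \<partial>Q)"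
  shows "cond_law Q V M W N (\<lambda>x. density (L x) (\<lambda>y. f (x, y)))"
  unfolding cond_law_def
proof (intro conjI ballI)
  show "(\<lambda>x. density (L x) (\<lambda>y. f (x, y))) \<in> M \<rightarrow>\<^sub>M prob_algebra N"
    by (rule measurable_density_kernel[OF L f one])
next
  fix A B assume [measurable]: "A \<in> sets M" "B \<in> sets N"
  have "emeasure Q {\<omega> \<in> space Q. V \<omega> \<in> A \<and> W \<omega> \<in> B} = (\<integral>\<^sup>+\<omega>. indicator A (V \<omega>) * indicator B (W \<omega>) \<partial>Q)"
    by (subst emeasure_Collect_nn_integral) (measurable, auto intro!: nn_integral_cong simp: indicator_def of_bool_def)
  also have "\<dots> = (\<integral>\<^sup>+\<omega>. indicator A (V \<omega>) * (\<integral>\<^sup>+y. f (V \<omega>, y) * indicator B y \<partial>L (V \<omega>)) \<partial>Q)"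
    by (rule eq) fact+
  also have "\<dots> = (\<integral>\<^sup>+\<omega>. indicator A (V \<omega>) * emeasure (density (L (V \<omega>)) (\<lambda>y. f (V \<omega>, y))) B \<partial>Q)"
  proof (rule nn_integral_cong)
    fix \<omega> assume "\<omega> \<in> space Q"
    then have v: "V \<omega> \<in> space M" using measurable_space[OF V] by auto
    have s: "sets (L (V \<omega>)) = sets N" using measurable_space[OF L v] by (simp add: space_prob_algebra)
    have "(\<lambda>y. f (V \<omega>, y)) \<in> borel_measurable (L (V \<omega>))"
      unfolding measurable_cong_sets[OF s refl] using measurable_compose[OF measurable_Pair1'[OF v] f] .
    then show "indicator A (V \<omega>) * (\<integral>\<^sup>+y. f (V \<omega>, y) * indicator B y \<partial>L (V \<omega>)) =
      indicator A (V \<omega>) * emeasure (density (L (V \<omega>)) (\<lambda>y. f (V \<omega>, y))) B"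
      using \<open>B \<in> sets N\<close> by (simp add: emeasure_density s)
  qed
  finally show "emeasure Q {\<omega> \<in> space Q. V \<omega> \<in> A \<and> W \<omega> \<in> B} =
    (\<integral>\<^sup>+\<omega>. indicator A (V \<omega>) * emeasure (density (L (V \<omega>)) (\<lambda>y. f (V \<omega>, y))) B \<partial>Q)" .
qed

text \<open>\<open>JQ\<close>, \<open>UQ\<close> and \<open>YQ\<close> will be the laws of
  \<open>Y\<^sup>1\<close> given \<open>(T, X)\<close>, of U given \<open>(T, X)\<close> and of
  \<open>Y\<^sup>1\<close> given \<open>(X, U)\<close>. Each is written as a density with respect to
  its treated reference law, so that the model's Radon-Nikodym derivatives can be read off.\<close>

definition JQ :: "bool \<times> 'x \<Rightarrow> real measure" where
  "JQ v = density (K (True, snd v)) (\<lambda>y. ennreal (wT v y))"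

definition UQ :: "bool \<times> 'x \<Rightarrow> real measure" where
  "UQ v = density uniform01 (\<lambda>u. ennreal (lamT v u))"

definition YQ :: "'x \<times> real \<Rightarrow> real measure" where
  "YQ z = density (K (True, fst z)) (\<lambda>y. ennreal (om (fst z) (snd z) y))"

lemma cond_law_JQ: "cond_law Q treat_covar TX_space outcome1 borel JQ"
proof -
  have k: "(\<lambda>v. K (True, snd v)) \<in> TX_space \<rightarrow>\<^sub>M prob_algebra borel"
    by measurable
  have "cond_law Q treat_covar TX_space outcome1 borel (\<lambda>v. density (K (True, snd v)) (\<lambda>y. (\<lambda>(v, y). ennreal (wT v y)) (v, y)))"
  proof (rule cond_lawI_density[OF k])
    fix A :: "(bool \<times> 'x) set" and B :: "real set"
    assume [measurable]: "A \<in> sets TX_space" "B \<in> sets borel"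
    have [measurable]: "(\<lambda>v. \<integral>\<^sup>+y. ennreal (wT v y) * indicator B y \<partial>K (True, snd v)) \<in> borel_measurable TX_space"
      by (rule nn_integral_measurable_subprob_algebra2[OF _ measurable_prob_algebraD[OF k]]) measurable
    have "(\<integral>\<^sup>+\<omega>. indicator A (treat_covar \<omega>) * indicator B (outcome1 \<omega>) \<partial>Q) =
       (\<integral>\<^sup>+v. (\<integral>\<^sup>+y. ennreal (wT v y) * (indicator A v * indicator B y) \<partial>K (True, snd v)) \<partial>D)"
      by (subst nn_integral_Q_outcome1[where f="\<lambda>(y, v). indicator A v * indicator B y", simplified, symmetric]) measurable
    also have "\<dots> = (\<integral>\<^sup>+v. indicator A v * (\<integral>\<^sup>+y. ennreal (wT v y) * indicator B y \<partial>K (True, snd v)) \<partial>D)"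
    proof (rule nn_integral_cong)
      fix v :: "bool \<times> 'x"
      have [measurable]: "v \<in> space TX_space" by (rule space_TX)
      show "(\<integral>\<^sup>+y. ennreal (wT v y) * (indicator A v * indicator B y) \<partial>K (True, snd v)) =
        indicator A v * (\<integral>\<^sup>+y. ennreal (wT v y) * indicator B y \<partial>K (True, snd v))"
        by (subst nn_integral_cmult[symmetric]) (auto simp: ac_simps)
    qed
    also have "\<dots> = (\<integral>\<^sup>+\<omega>. indicator A (treat_covar \<omega>) * (\<integral>\<^sup>+y. ennreal (wT (treat_covar \<omega>) y) * indicator B y \<partial>K (True, snd (treat_covar \<omega>))) \<partial>Q)"
      by (rule nn_integral_Q_treat_covar[symmetric]) measurable
    finally show "(\<integral>\<^sup>+\<omega>. indicator A (treat_covar \<omega>) * indicator B (outcome1 \<omega>) \<partial>Q) =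
       (\<integral>\<^sup>+\<omega>. indicator A (treat_covar \<omega>) * (\<integral>\<^sup>+y. (\<lambda>(v, y). ennreal (wT v y)) (treat_covar \<omega>, y) * indicator B y \<partial>K (True, snd (treat_covar \<omega>))) \<partial>Q)"
      by simp
  qed (simp_all add: wT_integral)
  then show ?thesis by (simp add: JQ_def[abs_def])
qed

lemma cond_law_UQ: "cond_law Q treat_covar TX_space unmeas borel UQ"
proof -
  have k: "(\<lambda>v::bool \<times> 'x. uniform01) \<in> TX_space \<rightarrow>\<^sub>M prob_algebra borel"
    by (rule measurable_const) (simp add: space_prob_algebra prob_space_uniform01)
  have "cond_law Q treat_covar TX_space unmeas borel (\<lambda>v. density uniform01 (\<lambda>y. (\<lambda>(v, y). ennreal (lamT v y)) (v, y)))"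
  proof (rule cond_lawI_density[OF k])
    fix A :: "(bool \<times> 'x) set" and B :: "real set"
    assume [measurable]: "A \<in> sets TX_space" "B \<in> sets borel"
    have [measurable]: "(\<lambda>v. \<integral>\<^sup>+y. ennreal (lamT v y) * indicator B y \<partial>uniform01) \<in> borel_measurable TX_space"
      by (rule nn_integral_measurable_subprob_algebra2[OF _ measurable_prob_algebraD[OF k]]) measurable
    have "(\<integral>\<^sup>+\<omega>. indicator A (treat_covar \<omega>) * indicator B (unmeas \<omega>) \<partial>Q) =
       (\<integral>\<^sup>+v. (\<integral>\<^sup>+y. ennreal (lamT v y) * (indicator A v * indicator B y) \<partial>uniform01) \<partial>D)"
      by (subst nn_integral_Q_unmeas[where f="\<lambda>(v, y). indicator A v * indicator B y", simplified, symmetric]) measurable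
    also have "\<dots> = (\<integral>\<^sup>+v. indicator A v * (\<integral>\<^sup>+y. ennreal (lamT v y) * indicator B y \<partial>uniform01) \<partial>D)"
    proof (rule nn_integral_cong)
      fix v :: "bool \<times> 'x"
      have [measurable]: "v \<in> space TX_space" by (rule space_TX)
      show "(\<integral>\<^sup>+y. ennreal (lamT v y) * (indicator A v * indicator B y) \<partial>uniform01) =
        indicator A v * (\<integral>\<^sup>+y. ennreal (lamT v y) * indicator B y \<partial>uniform01)"
        by (subst nn_integral_cmult[symmetric]) (auto simp: ac_simps)
    qed
    also have "\<dots> = (\<integral>\<^sup>+\<omega>. indicator A (treat_covar \<omega>) * (\<integral>\<^sup>+y. ennreal (lamT (treat_covar \<omega>) y) * indicator B y \<partial>uniform01) \<partial>Q)"
      by (rule nn_integral_Q_treat_covar[symmetric]) measurable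
    finally show "(\<integral>\<^sup>+\<omega>. indicator A (treat_covar \<omega>) * indicator B (unmeas \<omega>) \<partial>Q) =
       (\<integral>\<^sup>+\<omega>. indicator A (treat_covar \<omega>) * (\<integral>\<^sup>+y. (\<lambda>(v, y). ennreal (lamT v y)) (treat_covar \<omega>, y) * indicator B y \<partial>uniform01) \<partial>Q)"
      by simp
  qed (simp_all add: lamT_integral)
  then show ?thesis by (simp add: UQ_def[abs_def])
qed

lemma cond_law_YQ: "cond_law Q XU (borel \<Otimes>\<^sub>M borel) outcome1 borel YQ"
proof -
  have k: "(\<lambda>z. K (True, fst z)) \<in> borel \<Otimes>\<^sub>M borel \<rightarrow>\<^sub>M prob_algebra borel"
    by (rule measurable_compose[OF _ KT_kernel]) measurable
  have "cond_law Q XU (borel \<Otimes>\<^sub>M borel) outcome1 borel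
    (\<lambda>z. density (K (True, fst z)) (\<lambda>y. (\<lambda>(z, y). ennreal (om (fst z) (snd z) y)) (z, y)))"
  proof (rule cond_lawI_density[OF k])
    fix A :: "('x \<times> real) set" and B :: "real set"
    assume [measurable]: "A \<in> sets (borel \<Otimes>\<^sub>M borel)" "B \<in> sets borel"
    have "(\<integral>\<^sup>+\<omega>. indicator A (XU \<omega>) * indicator B (outcome1 \<omega>) \<partial>Q) =
       (\<integral>\<^sup>+\<omega>. (\<lambda>z. indicator B (snd z)) (Y01 \<omega>) * (\<lambda>z. indicator A (snd (fst z), snd z)) (treat_covar \<omega>, unmeas \<omega>) \<partial>Q)"
      by (simp add: treat_covar_def mult.commute)
    also have "\<dots> = (\<integral>\<^sup>+\<omega>. outcome_mean (\<lambda>z. indicator B (snd z)) (XU \<omega>) * (\<lambda>z. indicator A (snd (fst z), snd z)) (treat_covar \<omega>, unmeas \<omega>) \<partial>Q)"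
      by (rule nn_integral_Q_outcomes) measurable
    also have "\<dots> = (\<integral>\<^sup>+\<omega>. indicator A (XU \<omega>) * (\<integral>\<^sup>+y. ennreal (om (covar \<omega>) (unmeas \<omega>) y) * indicator B y \<partial>K (True, covar \<omega>)) \<partial>Q)"
      by (simp add: outcome_mean_def treat_covar_def prob_space.emeasure_space_1[OF prob_space_K] mult.commute)
    finally show "(\<integral>\<^sup>+\<omega>. indicator A (XU \<omega>) * indicator B (outcome1 \<omega>) \<partial>Q) =
      (\<integral>\<^sup>+\<omega>. indicator A (XU \<omega>) * (\<integral>\<^sup>+y. (\<lambda>(z, y). ennreal (om (fst z) (snd z) y)) ((XU \<omega>), y) * indicator B y \<partial>K (True, fst (XU \<omega>))) \<partial>Q)"
      by simp
  qed (simp_all add: om_integral)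
  then show ?thesis by (simp add: YQ_def[abs_def])
qed

text \<open>The conditional probability of an outcome event is its \<open>outcome_mean\<close>, a
  function of \<open>(X, U)\<close> alone. It is at most 1, so passing between extended and real
  values loses nothing.\<close>

lemma cond_indep_Q:
  "cond_indep Q Y01 (borel \<Otimes>\<^sub>M borel) treat (count_space UNIV)
     XU (borel \<Otimes>\<^sub>M borel)"
proof (rule cond_indepI[OF prob_space_Q, where k="\<lambda>A z. enn2real (outcome_mean (indicator A) z)"])
  interpret prob_space Q by (rule prob_space_Q)
  have mean_le: "outcome_mean (indicator A) z \<le> 1" for A :: "(real \<times> real) set" and z
  proof -
    have "outcome_mean (indicator A) z \<le> outcome_mean (\<lambda>_. 1) z"
      unfolding outcome_mean_def by (intro nn_integral_mono mult_left_mono) (auto simp: indicator_def)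
    then show ?thesis by (simp only: outcome_mean_const)
  qed
  show "0 \<le> enn2real (outcome_mean (indicator A) z)" for A :: "(real \<times> real) set" and z by simp
  show e1: "enn2real (outcome_mean (indicator A) z) \<le> 1" for A :: "(real \<times> real) set" and z
    using enn2real_mono[OF mean_le[of A z]] by simp
  fix A :: "(real \<times> real) set" assume [measurable]: "A \<in> sets (borel \<Otimes>\<^sub>M borel)"
  have [measurable]: "outcome_mean (indicator A) \<in> borel_measurable (borel \<Otimes>\<^sub>M borel)"
    by (rule outcome_mean_measurable) measurable
  show "(\<lambda>z. enn2real (outcome_mean (indicator A) z)) \<in> borel_measurable (borel \<Otimes>\<^sub>M borel)" by measurable
  fix B :: "bool set" and C :: "('x \<times> real) set"
  assume [measurable]: "B \<in> sets (count_space UNIV)" "C \<in> sets (borel \<Otimes>\<^sub>M borel)"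
  let ?m = "\<lambda>\<omega>. enn2real (outcome_mean (indicator A) (XU \<omega>))"
  have em: "ennreal (enn2real (outcome_mean (indicator A) z)) = outcome_mean (indicator A) z" for A :: "(real \<times> real) set" and z
    using mean_le[of A z] by (intro ennreal_enn2real) (auto simp: order_le_less_trans[OF _ ennreal_one_less_top])
  have "ennreal (\<integral>\<omega>. indicator C (XU \<omega>) * (indicator A (Y01 \<omega>) * indicator B (treat \<omega>)) \<partial>Q) =
    (\<integral>\<^sup>+\<omega>. ennreal (indicator C (XU \<omega>) * (indicator A (Y01 \<omega>) * indicator B (treat \<omega>))) \<partial>Q)"
    by (rule nn_integral_eq_integral[symmetric]) (auto intro!: integrable_unit_bounded simp: indicator_def)
  also have "\<dots> = (\<integral>\<^sup>+\<omega>. indicator A (Y01 \<omega>) * (\<lambda>z. indicator C (snd (fst z), snd z) * indicator B (fst (fst z))) (treat_covar \<omega>, unmeas \<omega>) \<partial>Q)"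
    by (intro nn_integral_cong) (simp add: treat_covar_def indicator_def)
  also have "\<dots> = (\<integral>\<^sup>+\<omega>. outcome_mean (indicator A) (XU \<omega>) * (\<lambda>z. indicator C (snd (fst z), snd z) * indicator B (fst (fst z))) (treat_covar \<omega>, unmeas \<omega>) \<partial>Q)"
    by (rule nn_integral_Q_outcomes) measurable
  also have "\<dots> = (\<integral>\<^sup>+\<omega>. ennreal (indicator C (XU \<omega>) * (?m \<omega> * indicator B (treat \<omega>))) \<partial>Q)"
    by (intro nn_integral_cong) (simp add: treat_covar_def indicator_def em)
  also have "\<dots> = ennreal (\<integral>\<omega>. indicator C (XU \<omega>) * (?m \<omega> * indicator B (treat \<omega>)) \<partial>Q)"
    by (rule nn_integral_eq_integral) (auto intro!: integrable_unit_bounded simp: indicator_def e1)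
  finally show "(\<integral>\<omega>. indicator C (XU \<omega>) * (indicator A (Y01 \<omega>) * indicator B (treat \<omega>)) \<partial>Q) =
    (\<integral>\<omega>. indicator C (XU \<omega>) * (?m \<omega> * indicator B (treat \<omega>)) \<partial>Q)"
    by (subst (asm) ennreal_inj) (auto intro!: integral_nonneg_AE)
qed measurable

lemma JQ_True: "JQ (True, x) = K (True, x)"
  by (simp add: JQ_def wT_def density_1)

lemma JQ_False: "JQ (False, x) = density (K (True, x)) (\<lambda>y. ennreal (w x y))"
  by (simp add: JQ_def wT_def)

lemma deMSM_Q: "deMSM P \<Lambda>1 \<Lambda>2 \<Gamma>1 \<Gamma>2 borel Q"
  unfolding deMSM_def
proof (intro conjI full_law_Q observed_law_Q cond_indep_Q)
  show "lambda_constraint \<Lambda>1 \<Lambda>2 borel Q"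
    unfolding lambda_constraint_def
  proof (intro exI[of _ UQ] conjI AE_I2[where M="covar_law Q"])
    fix x
    \<comment> \<open>The treated law of U carries no tilt, so \<open>lam x\<close> itself is the
      density ratio in the constraint and takes only its two extreme values.\<close>
    have U: "UQ (True, x) = uniform01" by (simp add: UQ_def lamT_def density_1)
    have UF: "UQ (False, x) = density uniform01 (\<lambda>u. ennreal (lam x u))" by (simp add: UQ_def lamT_def)
    have l: "lam x \<in> borel_measurable uniform01" unfolding lam_def by measurable
    have b: "\<Lambda>1 x \<le> lam x u" "lam x u \<le> \<Lambda>2 x" for u using \<Lambda>(2,3)[of x] by (auto simp: lam_def)
    show "absolutely_continuous (UQ (True, x)) (UQ (False, x))"
      "AE u in UQ (True, x). RN_deriv (UQ (True, x)) (UQ (False, x)) u \<in> {ennreal (\<Lambda>1 x)..ennreal (\<Lambda>2 x)}"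
      unfolding U UF using RN_deriv_density_range[OF prob_space_uniform01 l b] by auto
  qed (rule cond_law_UQ)
  show "omega_constraint \<Gamma>1 \<Gamma>2 borel Q"
    unfolding omega_constraint_def
  proof (intro exI[of _ YQ] exI[of _ JQ] conjI)
    have "absolutely_continuous (JQ (True, x)) (YQ (x, u)) \<and>
      (AE y in JQ (True, x). RN_deriv (JQ (True, x)) (YQ (x, u)) y \<in> {ennreal (\<Gamma>1 x)..ennreal (\<Gamma>2 x)})" for x u
    proof -
      have Y: "YQ (x, u) = density (K (True, x)) (\<lambda>y. ennreal (om x u y))" by (simp add: YQ_def)
      have o: "om x u \<in> borel_measurable (K (True, x))" by measurable
      show ?thesis
        unfolding JQ_True Y using RN_deriv_density_range[OF prob_space_K o om_bounds] by auto
    qed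
    then show "AE (x, u) in distr Q (borel \<Otimes>\<^sub>M borel) XU.
      absolutely_continuous (JQ (True, x)) (YQ (x, u)) \<and>
      (AE y in JQ (True, x). RN_deriv (JQ (True, x)) (YQ (x, u)) y \<in> {ennreal (\<Gamma>1 x)..ennreal (\<Gamma>2 x)})"
      by simp
  qed (rule cond_law_YQ cond_law_JQ)+
qed

end

section \<open>Means in the extended reals\<close>

text \<open>\<open>a\<close> and \<open>b\<close> need not be the positive and negative parts of f:
  they may share a common amount. Still f and its negative are dominated by \<open>a\<close> and
  \<open>b\<close>, and adding the opposite part to each side gives an identity free of subtraction;
  it integrates to one between four extended integrals, which can be solved once \<open>a\<close> or
  \<open>b\<close> has a finite integral.\<close>

lemma ext_integral_diff:
  fixes a b :: "'a \<Rightarrow> ennreal" and f :: "'a \<Rightarrow> real"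
  assumes [measurable]: "a \<in> borel_measurable M" "b \<in> borel_measurable M" "f \<in> borel_measurable M"
    and fin: "AE x in M. a x < \<infinity> \<and> b x < \<infinity>"
    and one: "(\<integral>\<^sup>+x. a x \<partial>M) < \<infinity> \<or> (\<integral>\<^sup>+x. b x \<partial>M) < \<infinity>"
    and f: "AE x in M. f x = enn2real (a x) - enn2real (b x)"
  shows "quasi_integrable M f" "ext_integral M f = enn2ereal (\<integral>\<^sup>+x. a x \<partial>M) - enn2ereal (\<integral>\<^sup>+x. b x \<partial>M)"
proof -
  let ?p = "\<integral>\<^sup>+x. ennreal (f x) \<partial>M" and ?n = "\<integral>\<^sup>+x. ennreal (- f x) \<partial>M"
  let ?a = "\<integral>\<^sup>+x. a x \<partial>M" and ?b = "\<integral>\<^sup>+x. b x \<partial>M"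
  have pw: "AE x in M. ennreal (f x) + b x = ennreal (- f x) + a x \<and> ennreal (f x) \<le> a x \<and> ennreal (- f x) \<le> b x"
    using fin f
  proof eventually_elim
    case (elim x)
    obtain r s where r: "a x = ennreal r" "0 \<le> r" and s: "b x = ennreal s" "0 \<le> s"
      using elim by (cases "a x"; cases "b x") auto
    have fx: "f x = r - s" using elim r s by simp
    show ?case
    proof (cases "s \<le> r")
      case True
      then show ?thesis unfolding fx r s using r(2) s(2) by (simp add: ennreal_plus[symmetric] ennreal_neg ennreal_leI del: ennreal_plus)
    next
      case False
      then show ?thesis unfolding fx r s using r(2) s(2) by (simp add: ennreal_plus[symmetric] ennreal_neg ennreal_leI del: ennreal_plus)
    qed
  qed
  have pa: "?p \<le> ?a" by (rule nn_integral_mono_AE) (use pw in eventually_elim, simp)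
  have nb: "?n \<le> ?b" by (rule nn_integral_mono_AE) (use pw in eventually_elim, simp)
  have "(\<integral>\<^sup>+x. ennreal (f x) + b x \<partial>M) = (\<integral>\<^sup>+x. ennreal (- f x) + a x \<partial>M)"
    by (rule nn_integral_cong_AE) (use pw in eventually_elim, simp)
  then have eq: "?p + ?b = ?n + ?a" by (simp add: nn_integral_add)
  show "quasi_integrable M f"
    unfolding quasi_integrable_def using one pa nb by (auto intro: le_less_trans)
  show "ext_integral M f = enn2ereal ?a - enn2ereal ?b"
  proof -
    show ?thesis unfolding ext_integral_def using one pa nb eq
      by (cases ?p rule: ennreal_cases; cases ?n rule: ennreal_cases; cases ?a rule: ennreal_cases; cases ?b rule: ennreal_cases)
         (auto simp: ennreal_plus[symmetric] top_unique enn2ereal_ennreal simp del: ennreal_plus)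
  qed
qed

lemma ext_integral_mono_AE:
  assumes "AE x in M. f x \<le> g x"
  shows "ext_integral M f \<le> ext_integral M g"
  unfolding ext_integral_def
proof (rule ereal_minus_mono)
  show "enn2ereal (\<integral>\<^sup>+x. ennreal (f x) \<partial>M) \<le> enn2ereal (\<integral>\<^sup>+x. ennreal (g x) \<partial>M)"
    using assms by (auto simp: less_eq_ennreal.rep_eq[symmetric] intro!: nn_integral_mono_AE ennreal_leI elim!: eventually_mono)
  show "enn2ereal (\<integral>\<^sup>+x. ennreal (- g x) \<partial>M) \<le> enn2ereal (\<integral>\<^sup>+x. ennreal (- f x) \<partial>M)"
    using assms by (auto simp: less_eq_ennreal.rep_eq[symmetric] intro!: nn_integral_mono_AE ennreal_leI elim!: eventually_mono)
qed

text \<open>The right-hand side is an integral under \<open>P\<close> in which \<open>Q\<close>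
  enters only through its untreated kernel. Two laws of the model can thus be compared pointwise
  under one measure.\<close>

lemma nn_integral_outcome1:
  fixes P :: "('x::polish_space, 'v) full measure" and Q :: "('x, 'u) full measure" and f :: "real \<Rightarrow> ennreal"
  assumes P: "full_law MV P" and Q: "full_law MU Q" and eq: "observed_law Q = observed_law P"
    and J: "cond_law Q treat_covar TX_space outcome1 borel J" and f[measurable]: "f \<in> borel_measurable borel"
  shows "(\<integral>\<^sup>+\<omega>. f (outcome1 \<omega>) \<partial>Q) =
    (\<integral>\<^sup>+\<omega>. (if treat \<omega> then f (observed \<omega>) else (\<integral>\<^sup>+y. f y \<partial>J (False, covar \<omega>))) \<partial>P)"
proof -
  note [measurable] = full_measurable[OF Q]
  have pQ: "prob_space Q" using Q by (simp add: full_law_def)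
  have J'[measurable]: "J \<in> TX_space \<rightarrow>\<^sub>M prob_algebra borel" using J by (simp add: cond_law_def)
  note [measurable] = measurable_prob_algebraD[OF J']
  define h where "h z = (if fst (snd z) then f (fst z) else (\<integral>\<^sup>+y. f y \<partial>J (False, snd (snd z))))"
    for z :: "real \<times> bool \<times> 'x"
  have JF: "(\<lambda>x. J (False, x)) \<in> borel \<rightarrow>\<^sub>M subprob_algebra borel"
    by (rule measurable_compose[OF _ measurable_prob_algebraD[OF J']]) measurable
  have JFi[measurable]: "(\<lambda>x. \<integral>\<^sup>+y. f y \<partial>J (False, x)) \<in> borel_measurable borel"
    by (rule nn_integral_measurable_subprob_algebra2[OF _ JF]) measurable
  have Ji[measurable]: "(\<lambda>v. \<integral>\<^sup>+y. f y \<partial>J v) \<in> borel_measurable TX_space"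
    by (rule nn_integral_measurable_subprob_algebra2[OF _ measurable_prob_algebraD[OF J']]) measurable
  have h[measurable]: "h \<in> borel_measurable (borel \<Otimes>\<^sub>M TX_space)" unfolding h_def by measurable
  let ?g = "\<lambda>z. of_bool (\<not> fst (fst z)) * f (snd z)"
  have g: "?g \<in> borel_measurable (TX_space \<Otimes>\<^sub>M borel)" by measurable
  have "(\<integral>\<^sup>+\<omega>. f (outcome1 \<omega>) \<partial>Q) = (\<integral>\<^sup>+\<omega>. of_bool (treat \<omega>) * f (observed \<omega>) + ?g (treat_covar \<omega>, outcome1 \<omega>) \<partial>Q)"
    by (intro nn_integral_cong) (simp add: observed_def treat_covar_def)
  also have "\<dots> = (\<integral>\<^sup>+\<omega>. of_bool (treat \<omega>) * f (observed \<omega>) \<partial>Q) + (\<integral>\<^sup>+\<omega>. ?g (treat_covar \<omega>, outcome1 \<omega>) \<partial>Q)"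
    by (rule nn_integral_add) measurable
  also have "(\<integral>\<^sup>+\<omega>. ?g (treat_covar \<omega>, outcome1 \<omega>) \<partial>Q) = (\<integral>\<^sup>+\<omega>. (\<integral>\<^sup>+y. ?g (treat_covar \<omega>, y) \<partial>J (treat_covar \<omega>)) \<partial>Q)"
    by (rule cond_law_nn_integral[OF J pQ _ _ g]) measurable
  also have "(\<integral>\<^sup>+\<omega>. of_bool (treat \<omega>) * f (observed \<omega>) \<partial>Q) + (\<integral>\<^sup>+\<omega>. (\<integral>\<^sup>+y. ?g (treat_covar \<omega>, y) \<partial>J (treat_covar \<omega>)) \<partial>Q) =
    (\<integral>\<^sup>+\<omega>. h (observed \<omega>, treat \<omega>, covar \<omega>) \<partial>Q)"
  proof -
    have *: "(\<integral>\<^sup>+y. ?g (treat_covar \<omega>, y) \<partial>J (treat_covar \<omega>)) = of_bool (\<not> treat \<omega>) * (\<integral>\<^sup>+y. f y \<partial>J (False, covar \<omega>))" for \<omega> :: "('x, 'u) full"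
      by (cases "treat \<omega>") (simp_all add: treat_covar_def)
    show ?thesis unfolding *
      by (subst nn_integral_add[symmetric]) (auto intro!: nn_integral_cong simp: h_def)
  qed
  also have "\<dots> = (\<integral>\<^sup>+\<omega>. h (observed \<omega>, treat \<omega>, covar \<omega>) \<partial>P)"
    by (rule observed_law_nn_integral[OF P Q eq h])
  finally show ?thesis unfolding h_def fst_conv snd_conv .
qed

lemma impute_measurable:
  assumes P: "full_law MV P" and g: "g \<in> borel_measurable borel"
  shows "impute g \<in> borel_measurable P"
  unfolding impute_def using full_measurable[OF P] g by measurable

text \<open>The positive and negative parts of \<open>Y\<^sup>1\<close> are imputed separately.
  Averaged over the untreated law, both can be positive at the same x, so they are not the two parts
  of \<open>impute g\<close>, and \<open>ext_integral_diff\<close> is needed to compare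
  means.\<close>

lemma ext_integral_outcome1:
  fixes P :: "('x::polish_space, 'v) full measure" and Q :: "('x, 'u) full measure"
  assumes P: "full_law MV P" and Q: "full_law MU Q" and eq: "observed_law Q = observed_law P"
    and J: "cond_law Q treat_covar TX_space outcome1 borel J"
    and g[measurable]: "g \<in> borel_measurable borel"
    and gJ: "AE x in covar_law P. g x = (\<integral>y. y \<partial>J (False, x))"
    and i: "AE x in covar_law P. integrable (J (False, x)) (\<lambda>y. y)"
    and qi: "quasi_integrable Q outcome1"
  shows "quasi_integrable P (impute g)" "ext_integral Q outcome1 = ext_integral P (impute g)"
proof -
  note [measurable] = full_measurable[OF P] impute_measurable[OF P g]
  let ?v = "\<lambda>f \<omega>. if treat \<omega> then f (observed \<omega>) else (\<integral>\<^sup>+y. f y \<partial>J (False, covar \<omega>))"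
  have J': "J \<in> TX_space \<rightarrow>\<^sub>M prob_algebra borel" using J by (simp add: cond_law_def)
  have JF: "(\<lambda>x. J (False, x)) \<in> borel \<rightarrow>\<^sub>M subprob_algebra borel"
    by (rule measurable_compose[OF _ measurable_prob_algebraD[OF J']]) measurable
  have v: "?v f \<in> borel_measurable P" if [measurable]: "f \<in> borel_measurable borel" for f :: "real \<Rightarrow> ennreal"
  proof -
    have [measurable]: "(\<lambda>x. \<integral>\<^sup>+y. f y \<partial>J (False, x)) \<in> borel_measurable borel"
      by (rule nn_integral_measurable_subprob_algebra2[OF _ JF]) measurable
    show ?thesis by measurable
  qed
  have vQ: "(\<integral>\<^sup>+\<omega>. f (outcome1 \<omega>) \<partial>Q) = (\<integral>\<^sup>+\<omega>. ?v f \<omega> \<partial>P)" if "f \<in> borel_measurable borel" for f :: "real \<Rightarrow> ennreal"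
    by (rule nn_integral_outcome1[OF P Q eq J that])
  have m: "(\<lambda>y. ennreal y) \<in> borel_measurable borel" "(\<lambda>y. ennreal (- y)) \<in> borel_measurable borel" by measurable
  have [measurable]: "covar \<in> P \<rightarrow>\<^sub>M borel" by measurable
  have "AE x in covar_law P. integrable (J (False, x)) (\<lambda>y. y) \<and> g x = (\<integral>y. y \<partial>J (False, x))"
    using i gJ by eventually_elim simp
  then have AEP: "AE \<omega> in P. integrable (J (False, covar \<omega>)) (\<lambda>y. y) \<and> g (covar \<omega>) = (\<integral>y. y \<partial>J (False, covar \<omega>))"
    by (rule AE_distrD[rotated]) measurable
  have fin: "AE \<omega> in P. ?v ennreal \<omega> < \<infinity> \<and> ?v (\<lambda>y. ennreal (- y)) \<omega> < \<infinity>"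
    using AEP
  proof eventually_elim
    case (elim \<omega>)
    have "(\<integral>\<^sup>+y. ennreal y \<partial>J (False, covar \<omega>)) < \<infinity>" "(\<integral>\<^sup>+y. ennreal (- y) \<partial>J (False, covar \<omega>)) < \<infinity>"
      using elim by (auto simp: real_integrable_def less_top)
    then show ?case by simp
  qed
  have im: "AE \<omega> in P. impute g \<omega> = enn2real (?v ennreal \<omega>) - enn2real (?v (\<lambda>y. ennreal (- y)) \<omega>)"
    using AEP
  proof eventually_elim
    case (elim \<omega>)
    show ?case
    proof (cases "treat \<omega>")
      case True
      then show ?thesis by (cases "0 \<le> observed \<omega>") (simp_all add: impute_def ennreal_neg)
    next
      case False
      have "impute g \<omega> = g (covar \<omega>)" using False by (simp add: impute_def)
      also have "\<dots> = enn2real (\<integral>\<^sup>+y. ennreal y \<partial>J (False, covar \<omega>)) - enn2real (\<integral>\<^sup>+y. ennreal (- y) \<partial>J (False, covar \<omega>))"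
        using elim by (simp add: real_lebesgue_integral_def)
      finally show ?thesis using False by simp
    qed
  qed
  have one: "(\<integral>\<^sup>+\<omega>. ?v ennreal \<omega> \<partial>P) < \<infinity> \<or> (\<integral>\<^sup>+\<omega>. ?v (\<lambda>y. ennreal (- y)) \<omega> \<partial>P) < \<infinity>"
    using qi unfolding quasi_integrable_def vQ[OF m(1), symmetric] vQ[OF m(2), symmetric] by simp
  note d = ext_integral_diff[OF v[OF m(1)] v[OF m(2)] impute_measurable[OF P g] fin one im]
  show "quasi_integrable P (impute g)" by (rule d(1))
  show "ext_integral Q outcome1 = ext_integral P (impute g)"
    unfolding d(2) unfolding ext_integral_def vQ[OF m(1)] vQ[OF m(2)] ..
qed

text \<open>The mean of |Y| is finite, so its conditional mean is finite for almost every
  \<open>(T, X)\<close>; overlap selects the treated arm for almost every x.\<close>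

lemma integrable_treated:
  fixes P :: "('x::polish_space, 'v) full measure"
  assumes P: "full_law MV P" and ov: "overlap P" and i: "integrable P observed"
    and K: "cond_law P treat_covar TX_space observed borel K"
  shows "AE x in covar_law P. integrable (K (True, x)) (\<lambda>y. y)"
proof -
  note [measurable] = full_measurable[OF P]
  have pP: "prob_space P" using P by (simp add: full_law_def)
  have K'[measurable]: "K \<in> TX_space \<rightarrow>\<^sub>M subprob_algebra borel"
    using K by (auto simp: cond_law_def intro: measurable_prob_algebraD)
  have m[measurable]: "(\<lambda>v. \<integral>\<^sup>+y. ennreal \<bar>y\<bar> \<partial>K v) \<in> borel_measurable TX_space"
    by (rule nn_integral_measurable_subprob_algebra2[OF _ K']) measurable
  have g: "(\<lambda>z. ennreal \<bar>snd z\<bar>) \<in> borel_measurable (TX_space \<Otimes>\<^sub>M borel)" by measurable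
  have "(\<integral>\<^sup>+v. (\<integral>\<^sup>+y. ennreal \<bar>y\<bar> \<partial>K v) \<partial>distr P TX_space treat_covar) = (\<integral>\<^sup>+\<omega>. (\<integral>\<^sup>+y. ennreal \<bar>y\<bar> \<partial>K (treat_covar \<omega>)) \<partial>P)"
    by (subst nn_integral_distr) auto
  also have "\<dots> = (\<integral>\<^sup>+\<omega>. ennreal \<bar>observed \<omega>\<bar> \<partial>P)"
    using cond_law_nn_integral[OF K pP _ _ g] by simp
  also have "\<dots> < \<infinity>" using i by (simp add: integrable_iff_bounded)
  finally have "AE v in distr P TX_space treat_covar. (\<integral>\<^sup>+y. ennreal \<bar>y\<bar> \<partial>K v) \<noteq> \<infinity>"
    by (intro nn_integral_noteq_infinite) auto
  from overlap_AE[OF P ov this] show ?thesis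
  proof eventually_elim
    case (elim x)
    have sK: "sets (K (True, x)) = sets borel" using cond_law_sets(2)[OF K] by (simp add: space_pair_measure)
    have "(\<lambda>y. y) \<in> borel_measurable (K (True, x))"
      unfolding measurable_cong_sets[OF sK refl] by measurable
    then show ?case using elim by (auto simp: integrable_iff_bounded less_top)
  qed
qed

lemma real_distribution_cond_law:
  fixes J :: "bool \<times> 'x::polish_space \<Rightarrow> real measure"
  assumes "cond_law Q treat_covar TX_space W borel J"
  shows "real_distribution (J v)"
  using cond_law_sets(1,2)[OF assms, of v]
  by (simp add: space_pair_measure real_distribution_def real_distribution_axioms_def)

section \<open>Sharp bounds\<close>

locale deMSM_setting =
  fixes P :: "('x::polish_space, 'v) full measure"
    and MV :: "'v measure"
    and \<Lambda>1 \<Lambda>2 \<Gamma>1 \<Gamma>2 :: "'x \<Rightarrow> real"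
    and K :: "bool \<times> 'x \<Rightarrow> real measure"
  assumes P: "full_law MV P" and ov: "overlap P" and intY: "integrable P observed"
    and \<Lambda>\<Gamma>_measurable[measurable]: "\<Lambda>1 \<in> borel_measurable borel" "\<Lambda>2 \<in> borel_measurable borel"
      "\<Gamma>1 \<in> borel_measurable borel" "\<Gamma>2 \<in> borel_measurable borel"
    and \<Lambda>: "\<And>x. 0 \<le> \<Lambda>1 x" "\<And>x. \<Lambda>1 x \<le> 1" "\<And>x. 1 \<le> \<Lambda>2 x"
    and \<Gamma>: "\<And>x. 0 \<le> \<Gamma>1 x" "\<And>x. \<Gamma>1 x \<le> 1" "\<And>x. 1 \<le> \<Gamma>2 x"
    and K: "cond_law P treat_covar TX_space observed borel K"
begin

abbreviation "F x \<equiv> K (True, x)"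
abbreviation "b1 \<equiv> bar1 \<Lambda>1 \<Lambda>2 \<Gamma>1 \<Gamma>2"
abbreviation "b2 \<equiv> bar2 \<Lambda>1 \<Lambda>2 \<Gamma>1 \<Gamma>2"
abbreviation "\<tau> \<equiv> tau_bar \<Lambda>1 \<Lambda>2 \<Gamma>1 \<Gamma>2"
abbreviation "model \<equiv> deMSM P \<Lambda>1 \<Lambda>2 \<Gamma>1 \<Gamma>2"
abbreviation "\<Q> \<equiv> deMSM_laws P \<Lambda>1 \<Lambda>2 \<Gamma>1 \<Gamma>2"

lemmas bw = bar_weights[of \<Lambda>1 _ \<Lambda>2 \<Gamma>1 \<Gamma>2, OF \<Lambda> \<Gamma>]

lemma bar_measurable[measurable]: "b1 \<in> borel_measurable borel" "b2 \<in> borel_measurable borel" "\<tau> \<in> borel_measurable borel"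
proof -
  have [measurable]: "tau \<Lambda>1 \<Lambda>2 \<in> borel_measurable borel" "tau \<Gamma>1 \<Gamma>2 \<in> borel_measurable borel"
    unfolding tau_def[abs_def] by measurable
  show [measurable]: "b1 \<in> borel_measurable borel" "b2 \<in> borel_measurable borel"
    unfolding bar1_def[abs_def] bar2_def[abs_def] by measurable
  show "\<tau> \<in> borel_measurable borel"
    unfolding tau_bar_def tau_def[abs_def] by measurable
qed

lemma F_kernel: "(\<lambda>x. F x) \<in> borel \<rightarrow>\<^sub>M prob_algebra borel"
  by (rule measurable_compose[of _ _ TX_space]) (use K in \<open>simp_all add: cond_law_def\<close>)

lemma F_distribution: "real_distribution (F x)"
  by (rule real_distribution_cond_law[OF K])

lemma F_sets[simp, measurable_cong]: "sets (F x) = sets borel"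
  using real_distribution.events_eq_borel[OF F_distribution] .

lemma integrable_F: "AE x in covar_law P. integrable (F x) (\<lambda>y. y)"
  by (rule integrable_treated[OF P ov intY K])

text \<open>The sign \<open>\<sigma>\<close> treats both bounds at once: \<open>\<sigma> = 1\<close> gives the upper bound, and \<open>\<sigma> = -1\<close> gives
  the upper bound for \<open>-Y\<^sup>1\<close>, that is, the negative of the lower bound.\<close>

definition nu :: "real \<Rightarrow> ('x \<Rightarrow> real) \<Rightarrow> 'x \<Rightarrow> real" where
  "nu \<sigma> q x = \<sigma> * (\<integral>y. y \<partial>F x) + (b2 x - b1 x) * (\<integral>y. rho (\<tau> x) (\<sigma> * y) (\<sigma> * q x) \<partial>F x)"

text \<open>With \<sigma> = -1 the inequalities reverse, and the condition says that
  \<open>q x\<close> is a \<open>1 - \<tau> x\<close> quantile of Y among the treated, the one that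
  appears in the lower bound.\<close>

definition quantile_at :: "real \<Rightarrow> ('x \<Rightarrow> real) \<Rightarrow> 'x \<Rightarrow> bool" where
  "quantile_at \<sigma> q x \<longleftrightarrow>
     measure (F x) {y. \<sigma> * y < \<sigma> * q x} \<le> \<tau> x \<and> measure (F x) {y. \<sigma> * q x < \<sigma> * y} \<le> 1 - \<tau> x"

abbreviation "ow \<sigma> q x \<equiv> opt_weight (b1 x) (b2 x) \<sigma> (q x) (F x)"

lemma measure_F_measurable:
  assumes "{z \<in> space (borel \<Otimes>\<^sub>M borel). A (fst z) (snd z)} \<in> sets (borel \<Otimes>\<^sub>M borel)"
  shows "(\<lambda>x. measure (F x) {y. A x y}) \<in> borel_measurable borel"
proof (rule measure_measurable_prob_algebra2[OF _ F_kernel])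
  have "(SIGMA x:space borel. {y. A x y}) = {z \<in> space (borel \<Otimes>\<^sub>M borel). A (fst z) (snd z)}"
    by (auto simp: space_pair_measure)
  then show "(SIGMA x:space borel. {y. A x y}) \<in> sets (borel \<Otimes>\<^sub>M borel)" using assms by simp
qed

text \<open>The weight in \<open>extremal_law\<close> is defined by cases on
  \<open>quantile_at\<close>, so the set of good x must be measurable, as must the masses inside
  \<open>opt_weight\<close>.\<close>

lemma quantile_masses_measurable:
  assumes [measurable]: "q \<in> borel_measurable borel"
  shows "(\<lambda>x. measure (F x) {y. \<sigma> * y < \<sigma> * q x}) \<in> borel_measurable borel"
    "(\<lambda>x. measure (F x) {y. \<sigma> * q x < \<sigma> * y}) \<in> borel_measurable borel"
    "(\<lambda>x. measure (F x) {q x}) \<in> borel_measurable borel"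
proof -
  show "(\<lambda>x. measure (F x) {y. \<sigma> * y < \<sigma> * q x}) \<in> borel_measurable borel"
    "(\<lambda>x. measure (F x) {y. \<sigma> * q x < \<sigma> * y}) \<in> borel_measurable borel"
    by (rule measure_F_measurable; measurable)+
  have "(\<lambda>x. measure (F x) {y. y = q x}) \<in> borel_measurable borel"
    by (rule measure_F_measurable; measurable)
  then show "(\<lambda>x. measure (F x) {q x}) \<in> borel_measurable borel" by simp
qed

lemma nu_measurable:
  assumes q[measurable]: "q \<in> borel_measurable borel"
  shows "nu \<sigma> q \<in> borel_measurable borel"
proof -
  have m1: "(\<lambda>x. \<integral>y. y \<partial>F x) \<in> borel_measurable borel"
    by (rule measurable_compose[OF measurable_prob_algebraD[OF F_kernel] integral_measurable_subprob_algebra]) simp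
  \<comment> \<open>The nonnegative integral is measurable along a kernel even when its integrand
    depends on x; \<open>rho\<close> is nonnegative because \<open>\<tau> x\<close> lies in the unit
    interval.\<close>
  have r: "(\<integral>y. rho (\<tau> x) (\<sigma> * y) (\<sigma> * q x) \<partial>F x) = enn2real (\<integral>\<^sup>+y. ennreal (rho (\<tau> x) (\<sigma> * y) (\<sigma> * q x)) \<partial>F x)" for x
    using bw(5,6)[of x] by (intro integral_eq_nn_integral) (auto simp: rho_def)
  have "(\<lambda>x. \<integral>\<^sup>+y. ennreal (rho (\<tau> x) (\<sigma> * y) (\<sigma> * q x)) \<partial>F x) \<in> borel_measurable borel"
    unfolding rho_def by (rule nn_integral_measurable_subprob_algebra2[OF _ measurable_prob_algebraD[OF F_kernel]]) measurable
  note [measurable] = this m1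
  show ?thesis unfolding nu_def[abs_def] r by measurable
qed

lemma quantile_atD:
  assumes "quantile_at \<sigma> q x"
  shows "measure (F x) {y. \<sigma> * y < \<sigma> * q x} \<le> \<tau> x" "measure (F x) {y. \<sigma> * q x < \<sigma> * y} \<le> 1 - \<tau> x"
  using assms by (auto simp: quantile_at_def)

lemma ow_measurable: "ow \<sigma> q x \<in> borel_measurable borel"
  unfolding opt_weight_def by measurable

lemma extremal_law:
  assumes \<sigma>: "\<sigma> \<noteq> 0" and q[measurable]: "q \<in> borel_measurable borel" and qa: "AE x in covar_law P. quantile_at \<sigma> q x"
  obtains Q J where "model (borel :: real measure) Q" "cond_law Q treat_covar TX_space outcome1 borel J"
    "AE x in covar_law P. J (False, x) = density (F x) (\<lambda>y. ennreal (ow \<sigma> q x y))"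
proof -
  \<comment> \<open>The quantile property is known for almost every x only. Weight 1 elsewhere meets
    all requirements of the construction and changes the result on a null set of x.\<close>
  define w where "w x y = (if quantile_at \<sigma> q x then ow \<sigma> q x y else 1)" for x y
  note [measurable] = quantile_masses_measurable[OF q]
  interpret sensitivity_construction P MV \<Lambda>1 \<Lambda>2 \<Gamma>1 \<Gamma>2 K w
  proof
    show "case_prod w \<in> borel_measurable (borel \<Otimes>\<^sub>M borel)"
      unfolding w_def opt_weight_def quantile_at_def by measurable
    show "b1 x \<le> w x y" "w x y \<le> b2 x" for x y
      using opt_weight_bounds[OF F_distribution bw(2,3,4) \<sigma> quantile_atD[of \<sigma> q x]] bw(2,3)[of x]
      by (cases "quantile_at \<sigma> q x"; simp add: w_def)+
    show "(\<integral>y. w x y \<partial>F x) = 1" for x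
    proof (cases "quantile_at \<sigma> q x")
      case True
      then show ?thesis
        using opt_weight_integral[OF F_distribution bw(2,3,4) \<sigma> quantile_atD[OF True]] by (simp add: w_def)
    next
      case False
      interpret F: real_distribution "F x" by (rule F_distribution)
      show ?thesis using False F.prob_space by (simp add: w_def)
    qed
  qed (rule P \<Lambda>\<Gamma>_measurable \<Lambda> \<Gamma> K)+
  have "AE x in covar_law P. JQ (False, x) = density (F x) (\<lambda>y. ennreal (ow \<sigma> q x y))"
    using qa by eventually_elim (simp add: JQ_False w_def)
  with deMSM_Q cond_law_JQ show thesis by (rule that)
qed

lemma model_ratio:
  assumes Q: "model MU Q" and J: "cond_law Q treat_covar TX_space outcome1 borel J"
  shows "AE x in covar_law P. integrable (F x) (\<lambda>y. y) \<and> ratio_between (b1 x) (b2 x) (F x) (J (False, x)) \<and>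
    integrable (J (False, x)) (\<lambda>y. y)"
  using integrable_F deMSM_bounds[OF P ov \<Lambda> \<Gamma> K Q J]
proof eventually_elim
  case (elim x)
  have b2: "0 \<le> b2 x" using bw(3)[of x] by simp
  show ?case
    using elim ratio_between_integrable[OF F_distribution real_distribution_cond_law[OF J] bw(1) b2 elim(2) elim(1)] by simp
qed

lemma cond_mean_le_nu:
  assumes \<sigma>: "\<sigma> \<noteq> 0" and qa: "AE x in covar_law P. quantile_at \<sigma> q x"
    and Q: "model MU Q" and J: "cond_law Q treat_covar TX_space outcome1 borel J"
  shows "AE x in covar_law P. \<sigma> * (\<integral>y. y \<partial>J (False, x)) \<le> nu \<sigma> q x"
  using qa model_ratio[OF Q J]
proof eventually_elim
  case (elim x)
  note o = F_distribution bw(2,3,4) \<sigma> quantile_atD[OF elim(1)]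
  have "\<sigma> * (\<integral>y. y \<partial>J (False, x)) = (\<integral>y. \<sigma> * y \<partial>J (False, x))" by simp
  also have "\<dots> \<le> (\<integral>y. ow \<sigma> q x y * (\<sigma> * y) \<partial>F x)"
    using elim(2) by (intro opt_weight_optimal[OF o, where c="\<sigma> * q x"] real_distribution_cond_law[OF J] bw(1)) auto
  also have "\<dots> = nu \<sigma> q x"
    unfolding nu_def using elim(2) by (intro opt_weight_value[OF o]) simp
  finally show ?case .
qed

lemma extremal_cond_mean:
  assumes \<sigma>: "\<sigma> \<noteq> 0" and qa: "AE x in covar_law P. quantile_at \<sigma> q x"
    and J: "AE x in covar_law P. J (False, x) = density (F x) (\<lambda>y. ennreal (ow \<sigma> q x y))"
  shows "AE x in covar_law P. \<sigma> * (\<integral>y. y \<partial>J (False, x)) = nu \<sigma> q x"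
  using qa J integrable_F
proof eventually_elim
  case (elim x)
  note o = F_distribution bw(2,3,4) \<sigma> quantile_atD[OF elim(1)]
  have nn: "0 \<le> ow \<sigma> q x y" for y using opt_weight_bounds(1)[OF o, of y] bw(1)[of x] by linarith
  note [measurable] = ow_measurable[of x \<sigma> q]
  have "\<sigma> * (\<integral>y. y \<partial>J (False, x)) = \<sigma> * (\<integral>y. ow \<sigma> q x y * y \<partial>F x)"
    unfolding elim(2) by (subst integral_density) (auto simp: nn)
  also have "\<dots> = (\<integral>y. ow \<sigma> q x y * (\<sigma> * y) \<partial>F x)"
    by (subst integral_mult_right_zero[symmetric]) (simp only: ac_simps)
  also have "\<dots> = nu \<sigma> q x"
    unfolding nu_def using elim(3) by (intro opt_weight_value[OF o])
  finally show ?case .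
qed

text \<open>The extremal law is extremal for every monotone function of \<open>\<sigma> Y\<^sup>1\<close>, hence also for its
  negative part. This makes its mean exist as soon as some law in the model has an integrable \<open>Y\<^sup>1\<close>.\<close>

lemma extremal_negative_part:
  assumes \<sigma>: "\<sigma> \<noteq> 0" and qa: "AE x in covar_law P. quantile_at \<sigma> q x"
    and J: "AE x in covar_law P. J (False, x) = density (F x) (\<lambda>y. ennreal (ow \<sigma> q x y))"
    and Q': "model MU Q'" and J': "cond_law Q' treat_covar TX_space outcome1 borel J'"
  shows "AE x in covar_law P. (\<integral>\<^sup>+y. ennreal (- (\<sigma> * y)) \<partial>J (False, x)) \<le> (\<integral>\<^sup>+y. ennreal (- (\<sigma> * y)) \<partial>J' (False, x))"
  using qa J model_ratio[OF Q' J']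
proof eventually_elim
  case (elim x)
  note o = F_distribution bw(2,3,4) \<sigma> quantile_atD[OF elim(1)]
  have nn: "0 \<le> ow \<sigma> q x y" for y using opt_weight_bounds(1)[OF o, of y] bw(1)[of x] by linarith
  note [measurable] = ow_measurable[of x \<sigma> q]
  interpret J': real_distribution "J' (False, x)" by (rule real_distribution_cond_law[OF J'])
  \<comment> \<open>Maximising the mean of this function minimises the mean negative part of
    \<sigma> y. It is monotone in \<sigma> y and constant where \<sigma> y is positive, so its level
    at q determines the side of q whenever \<phi> differs from that level.\<close>
  let ?\<phi> = "\<lambda>y. min (\<sigma> * y) 0"
  have \<phi>: "integrable (F x) ?\<phi>" "integrable (J' (False, x)) ?\<phi>" using elim(3) by auto
  have gt: "min (\<sigma> * q x) 0 < ?\<phi> y \<Longrightarrow> \<sigma> * q x < \<sigma> * y" and lt: "?\<phi> y < min (\<sigma> * q x) 0 \<Longrightarrow> \<sigma> * y < \<sigma> * q x" for y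
    by (auto simp: min_def split: if_splits)
  have i: "integrable (F x) (\<lambda>y. ow \<sigma> q x y * ?\<phi> y)"
    by (rule opt_weight_integral_split(2)[OF o \<phi>(1) gt lt])
  have neg: "ennreal (- (\<sigma> * y)) = ennreal (- ?\<phi> y)" for y by (auto simp: min_def ennreal_neg)
  have "(\<integral>\<^sup>+y. ennreal (- (\<sigma> * y)) \<partial>J (False, x)) = (\<integral>\<^sup>+y. ennreal (ow \<sigma> q x y) * ennreal (- ?\<phi> y) \<partial>F x)"
    unfolding elim(2) neg by (subst nn_integral_density) auto
  also have "\<dots> = (\<integral>\<^sup>+y. ennreal (- (ow \<sigma> q x y * ?\<phi> y)) \<partial>F x)"
    by (intro nn_integral_cong) (simp add: ennreal_mult'[symmetric] nn)
  also have "\<dots> = ennreal (- (\<integral>y. ow \<sigma> q x y * ?\<phi> y \<partial>F x))"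
    using i nn by (subst nn_integral_eq_integral) (auto intro!: AE_I2 mult_nonneg_nonpos)
  also have "\<dots> \<le> ennreal (- (\<integral>y. ?\<phi> y \<partial>J' (False, x)))"
    by (rule ennreal_leI, rule le_imp_neg_le)
      (rule opt_weight_optimal[OF o \<phi>(1) gt lt J'.real_distribution_axioms conjunct1[OF conjunct2[OF elim(3)]] bw(1)])
  also have "\<dots> = (\<integral>\<^sup>+y. ennreal (- ?\<phi> y) \<partial>J' (False, x))"
    using \<phi>(2) by (subst nn_integral_eq_integral) auto
  finally show ?case unfolding neg .
qed

lemma model_lawsD:
  assumes "Q \<in> \<Q>"
  obtains MU J where "model MU Q" "full_law MU Q" "observed_law Q = observed_law P"
    "cond_law Q treat_covar TX_space outcome1 borel J"
  using assms unfolding deMSM_laws_def deMSM_def omega_constraint_def by blast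

text \<open>One law serves both conclusions: its conditional mean is the bound for almost every x,
  and its \<open>Y\<^sup>1\<close> has a mean as soon as any law of the model has an integrable one.
  Since \<open>nu\<close> refers to \<sigma> times the outcome, a second factor \<sigma> returns to
  the outcome itself.\<close>

lemma attained:
  assumes \<sigma>: "\<sigma> = 1 \<or> \<sigma> = -1" and q: "q \<in> borel_measurable borel" and qa: "AE x in covar_law P. quantile_at \<sigma> q x"
  shows "\<exists>Q\<in>\<Q>. is_cond_mean_untreated Q (\<lambda>x. \<sigma> * nu \<sigma> q x) \<and>
    ((\<exists>Q\<in>\<Q>. integrable Q outcome1) \<longrightarrow> quasi_integrable Q outcome1)"
proof -
  have \<sigma>0: "\<sigma> \<noteq> 0" and \<sigma>2: "\<sigma> * \<sigma> = 1" using \<sigma> by auto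
  obtain Q J where Q: "model (borel :: real measure) Q" and J: "cond_law Q treat_covar TX_space outcome1 borel J"
    and JF: "AE x in covar_law P. J (False, x) = density (F x) (\<lambda>y. ennreal (ow \<sigma> q x y))"
    by (rule extremal_law[OF \<sigma>0 q qa])
  have fQ: "full_law borel Q" and oQ: "observed_law Q = observed_law P" using Q by (auto simp: deMSM_def)
  have QQ: "Q \<in> \<Q>" using Q by (auto simp: deMSM_laws_def)
  have "AE x in covar_law P. \<sigma> * nu \<sigma> q x = (\<integral>y. y \<partial>J (False, x))"
    using extremal_cond_mean[OF \<sigma>0 qa JF]
  proof eventually_elim
    case (elim x)
    show ?case unfolding elim[symmetric] mult.assoc[symmetric] \<sigma>2 by simp
  qed
  then have cm: "is_cond_mean_untreated Q (\<lambda>x. \<sigma> * nu \<sigma> q x)"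
    unfolding is_cond_mean_untreated_def observed_law_eqD(2)[OF P fQ oQ]
    using nu_measurable[OF q] J by (auto intro!: borel_measurable_times)
  have qi: "quasi_integrable Q outcome1" if ex: "\<exists>Q\<in>\<Q>. integrable Q outcome1"
  proof -
    obtain Q' where "Q' \<in> \<Q>" and i: "integrable Q' outcome1" using ex by blast
    then obtain MU J' where Q': "model MU Q'" and fQ': "full_law MU Q'" and oQ': "observed_law Q' = observed_law P"
      and J': "cond_law Q' treat_covar TX_space outcome1 borel J'"
      using model_lawsD by blast
    note [measurable] = full_measurable[OF P]
    have m: "(\<lambda>y. ennreal (- (\<sigma> * y))) \<in> borel_measurable borel" by measurable
    have le: "AE \<omega> in P. (\<integral>\<^sup>+y. ennreal (- (\<sigma> * y)) \<partial>J (False, covar \<omega>)) \<le> (\<integral>\<^sup>+y. ennreal (- (\<sigma> * y)) \<partial>J' (False, covar \<omega>))"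
      using extremal_negative_part[OF \<sigma>0 qa JF Q' J'] by (rule AE_distrD[rotated]) measurable
    \<comment> \<open>Under \<open>P\<close> the two integrands coincide on the treated, and on the
      untreated they are ordered by \<open>extremal_negative_part\<close>.\<close>
    have "(\<integral>\<^sup>+\<omega>. ennreal (- (\<sigma> * outcome1 \<omega>)) \<partial>Q) \<le> (\<integral>\<^sup>+\<omega>. ennreal (- (\<sigma> * outcome1 \<omega>)) \<partial>Q')"
      unfolding nn_integral_outcome1[OF P fQ oQ J m] nn_integral_outcome1[OF P fQ' oQ' J' m]
      by (rule nn_integral_mono_AE) (use le in eventually_elim, simp)
    also have "\<dots> < \<infinity>"
    proof -
      have "integrable Q' (\<lambda>\<omega>. \<sigma> * outcome1 \<omega>)" using i by simp
      then show ?thesis unfolding real_integrable_def less_top[symmetric] infinity_ennreal_def by blast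
    qed
    finally have "(\<integral>\<^sup>+\<omega>. ennreal (- (\<sigma> * outcome1 \<omega>)) \<partial>Q) < \<infinity>" .
    \<comment> \<open>For \<sigma> = 1 the negative part of \<open>Y\<^sup>1\<close> has a finite
      integral, for \<sigma> = -1 the positive part; either one suffices.\<close>
    then show ?thesis
      using \<sigma> full_measurable(2)[OF fQ] by (auto simp: quasi_integrable_def)
  qed
  show ?thesis
    by (rule bexI[OF _ QQ], rule conjI[OF cm], rule impI, rule qi)
qed

section \<open>Arbitrary versions of the conditional mean and overall means\<close>

lemma cond_mean_bound:
  assumes \<sigma>: "\<sigma> \<noteq> 0" and qa: "AE x in covar_law P. quantile_at \<sigma> q x"
    and Q: "Q \<in> \<Q>" and g: "is_cond_mean_untreated Q g"
  shows "AE x in covar_law P. \<sigma> * g x \<le> nu \<sigma> q x"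
proof -
  obtain MU where Q': "model MU Q" and fQ: "full_law MU Q" and oQ: "observed_law Q = observed_law P"
    using model_lawsD[OF Q] by metis
  obtain J where J: "cond_law Q treat_covar TX_space outcome1 borel J" and gJ: "AE x in covar_law P. g x = (\<integral>y. y \<partial>J (False, x))"
    using g unfolding is_cond_mean_untreated_def observed_law_eqD(2)[OF P fQ oQ] by blast
  show ?thesis using cond_mean_le_nu[OF \<sigma> qa Q' J] gJ by eventually_elim simp
qed

lemma model_mean:
  assumes Q: "Q \<in> \<Q>" and qi: "quasi_integrable Q outcome1" and g: "is_cond_mean_untreated Q g"
  shows "quasi_integrable P (impute g)" "ext_integral Q outcome1 = ext_integral P (impute g)"
proof -
  obtain MU where Q': "model MU Q" and fQ: "full_law MU Q" and oQ: "observed_law Q = observed_law P"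
    using model_lawsD[OF Q] by metis
  obtain J where J: "cond_law Q treat_covar TX_space outcome1 borel J" and gJ: "AE x in covar_law P. g x = (\<integral>y. y \<partial>J (False, x))"
    and gm: "g \<in> borel_measurable borel"
    using g unfolding is_cond_mean_untreated_def observed_law_eqD(2)[OF P fQ oQ] by blast
  have i: "AE x in covar_law P. integrable (J (False, x)) (\<lambda>y. y)"
    using model_ratio[OF Q' J] by eventually_elim simp
  show "quasi_integrable P (impute g)" "ext_integral Q outcome1 = ext_integral P (impute g)"
    by (rule ext_integral_outcome1[OF P fQ oQ J gm gJ i qi])+
qed

lemma cond_mean_exists:
  assumes Q: "Q \<in> \<Q>"
  obtains g where "is_cond_mean_untreated Q g"
proof -
  obtain MU J where Q': "model MU Q" and J: "cond_law Q treat_covar TX_space outcome1 borel J"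
    using model_lawsD[OF Q] by metis
  have "(\<lambda>x. \<integral>y. y \<partial>J (False, x)) \<in> borel_measurable borel"
  proof (rule measurable_compose[OF _ integral_measurable_subprob_algebra])
    show "(\<lambda>x. J (False, x)) \<in> borel \<rightarrow>\<^sub>M subprob_algebra borel"
      by (rule measurable_compose[of _ _ TX_space])
        (use J in \<open>simp_all add: cond_law_def measurable_prob_algebraD\<close>)
  qed simp
  then have "is_cond_mean_untreated Q (\<lambda>x. \<integral>y. y \<partial>J (False, x))"
    unfolding is_cond_mean_untreated_def using J by blast
  then show thesis by (rule that)
qed

lemma impute_mono_AE:
  assumes "AE x in covar_law P. g x \<le> h x"
  shows "AE \<omega> in P. impute g \<omega> \<le> impute h \<omega>"
proof -
  note [measurable] = full_measurable[OF P]
  have "AE \<omega> in P. g (covar \<omega>) \<le> h (covar \<omega>)"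
    using assms by (rule AE_distrD[rotated]) measurable
  then show ?thesis by eventually_elim (simp add: impute_def)
qed

lemma nu_upper_eq: "nu_upper \<Lambda>1 \<Lambda>2 \<Gamma>1 \<Gamma>2 K q = (\<lambda>x. 1 * nu 1 q x)"
  by (simp add: fun_eq_iff nu_upper_def nu_def)

lemma nu_lower_eq: "nu_lower \<Lambda>1 \<Lambda>2 \<Gamma>1 \<Gamma>2 K q = (\<lambda>x. -1 * nu (-1) q x)"
proof -
  \<comment> \<open>Reflecting the line exchanges excess and shortfall, hence the two weights of the
    check function.\<close>
  have "rho (1 - t) y r = rho t (-1 * y) (-1 * r)" for t y r by (simp add: rho_def)
  then show ?thesis by (simp add: fun_eq_iff nu_lower_def nu_def)
qed

lemma treated_quantile_quantile_at:
  assumes tq: "treated_quantile P K \<gamma> q" and \<gamma>: "\<And>x. 0 \<le> \<gamma> x" "\<And>x. \<gamma> x \<le> 1"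
  shows "AE x in covar_law P. measure (F x) {..<q x} \<le> \<gamma> x \<and> measure (F x) {q x<..} \<le> 1 - \<gamma> x"
  using integrable_F tq[unfolded treated_quantile_def, THEN conjunct2]
proof eventually_elim
  case (elim x)
  show ?case
    using rho_minimizer_quantile[OF F_distribution elim(1) \<gamma>, of x "q x"] elim(2) by simp
qed

end

theorem proposition1:
  fixes P :: "('x::polish_space, 'v) full measure"
    and MV :: "'v measure"
    and \<Lambda>1 \<Lambda>2 \<Gamma>1 \<Gamma>2 :: "'x \<Rightarrow> real"
    and K :: "bool \<times> 'x \<Rightarrow> real measure"
    and q_lower q_upper :: "'x \<Rightarrow> real"
  assumes "full_law MV P"
    and "overlap P"
    and "integrable P observed"
    and "\<Lambda>1 \<in> borel_measurable borel" and "\<Lambda>2 \<in> borel_measurable borel"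
    and "\<Gamma>1 \<in> borel_measurable borel" and "\<Gamma>2 \<in> borel_measurable borel"
    and "\<And>x. 0 \<le> \<Lambda>1 x" and "\<And>x. \<Lambda>1 x \<le> 1" and "\<And>x. 1 \<le> \<Lambda>2 x"
    and "\<And>x. 0 \<le> \<Gamma>1 x" and "\<And>x. \<Gamma>1 x \<le> 1" and "\<And>x. 1 \<le> \<Gamma>2 x"
    and "cond_law P treat_covar TX_space observed borel K"
    and "treated_quantile P K (\<lambda>x. 1 - tau_bar \<Lambda>1 \<Lambda>2 \<Gamma>1 \<Gamma>2 x) q_lower"
    and "treated_quantile P K (\<lambda>x. tau_bar \<Lambda>1 \<Lambda>2 \<Gamma>1 \<Gamma>2 x) q_upper"
  shows "is_essinf (covar_law P)
           {g. \<exists>Q \<in> deMSM_laws P \<Lambda>1 \<Lambda>2 \<Gamma>1 \<Gamma>2. is_cond_mean_untreated Q g}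
           (nu_lower \<Lambda>1 \<Lambda>2 \<Gamma>1 \<Gamma>2 K q_lower) \<and>
         is_esssup (covar_law P)
           {g. \<exists>Q \<in> deMSM_laws P \<Lambda>1 \<Lambda>2 \<Gamma>1 \<Gamma>2. is_cond_mean_untreated Q g}
           (nu_upper \<Lambda>1 \<Lambda>2 \<Gamma>1 \<Gamma>2 K q_upper) \<and>
         ((\<exists>Q \<in> deMSM_laws P \<Lambda>1 \<Lambda>2 \<Gamma>1 \<Gamma>2. integrable Q outcome1) \<longrightarrow>
           quasi_integrable P (impute (nu_lower \<Lambda>1 \<Lambda>2 \<Gamma>1 \<Gamma>2 K q_lower)) \<and>
           (INF Q \<in> {Q \<in> deMSM_laws P \<Lambda>1 \<Lambda>2 \<Gamma>1 \<Gamma>2. quasi_integrable Q outcome1}. ext_integral Q outcome1) =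
             ext_integral P (impute (nu_lower \<Lambda>1 \<Lambda>2 \<Gamma>1 \<Gamma>2 K q_lower)) \<and>
           quasi_integrable P (impute (nu_upper \<Lambda>1 \<Lambda>2 \<Gamma>1 \<Gamma>2 K q_upper)) \<and>
           (SUP Q \<in> {Q \<in> deMSM_laws P \<Lambda>1 \<Lambda>2 \<Gamma>1 \<Gamma>2. quasi_integrable Q outcome1}. ext_integral Q outcome1) =
             ext_integral P (impute (nu_upper \<Lambda>1 \<Lambda>2 \<Gamma>1 \<Gamma>2 K q_upper)))"
proof -
  interpret deMSM_setting P MV \<Lambda>1 \<Lambda>2 \<Gamma>1 \<Gamma>2 K
    by unfold_locales (rule assms)+
  let ?l = "nu_lower \<Lambda>1 \<Lambda>2 \<Gamma>1 \<Gamma>2 K q_lower" and ?u = "nu_upper \<Lambda>1 \<Lambda>2 \<Gamma>1 \<Gamma>2 K q_upper"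
  have qm: "q_lower \<in> borel_measurable borel" "q_upper \<in> borel_measurable borel"
    using assms(15,16) by (auto simp: treated_quantile_def)
  have qu: "AE x in covar_law P. quantile_at 1 q_upper x"
    using treated_quantile_quantile_at[OF assms(16) bw(5,6)]
    by eventually_elim (simp add: quantile_at_def lessThan_def greaterThan_def)
  have t1: "AE x in covar_law P. measure (F x) {..<q_lower x} \<le> 1 - \<tau> x \<and> measure (F x) {q_lower x<..} \<le> 1 - (1 - \<tau> x)"
    using bw(5,6) by (intro treated_quantile_quantile_at[OF assms(15)]) auto
  have ql: "AE x in covar_law P. quantile_at (-1) q_lower x"
    using t1
    by eventually_elim (simp add: quantile_at_def lessThan_def greaterThan_def)
  have m: "?l \<in> borel_measurable (covar_law P)" "?u \<in> borel_measurable (covar_law P)"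
    unfolding nu_lower_eq nu_upper_eq using nu_measurable[OF qm(1)] nu_measurable[OF qm(2)] by simp_all
  obtain Ql where Ql: "Ql \<in> \<Q>" "is_cond_mean_untreated Ql ?l"
    "(\<exists>Q\<in>\<Q>. integrable Q outcome1) \<Longrightarrow> quasi_integrable Ql outcome1"
    using attained[OF _ qm(1) ql] unfolding nu_lower_eq by auto
  obtain Qu where Qu: "Qu \<in> \<Q>" "is_cond_mean_untreated Qu ?u"
    "(\<exists>Q\<in>\<Q>. integrable Q outcome1) \<Longrightarrow> quasi_integrable Qu outcome1"
    using attained[OF _ qm(2) qu] unfolding nu_upper_eq by auto
  have bl: "AE x in covar_law P. ?l x \<le> g x" if "Q \<in> \<Q>" "is_cond_mean_untreated Q g" for Q g
    using cond_mean_bound[OF _ ql that] unfolding nu_lower_eq by (auto elim!: eventually_mono)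
  have bu: "AE x in covar_law P. g x \<le> ?u x" if "Q \<in> \<Q>" "is_cond_mean_untreated Q g" for Q g
    using cond_mean_bound[OF _ qu that] unfolding nu_upper_eq by (auto elim!: eventually_mono)
  \<comment> \<open>The bound is itself a member of the family, being attained by \<open>Ql\<close>,
    so every almost-sure lower bound of the family lies below it. The same holds for the supremum
    with \<open>Qu\<close>.\<close>
  have "is_essinf (covar_law P) {g. \<exists>Q \<in> \<Q>. is_cond_mean_untreated Q g} ?l"
    unfolding is_essinf_def using m(1) bl Ql(1,2) by blast
  moreover have "is_esssup (covar_law P) {g. \<exists>Q \<in> \<Q>. is_cond_mean_untreated Q g} ?u"
    unfolding is_esssup_def using m(2) bu Qu(1,2) by blast
  moreover {
    assume ex: "\<exists>Q\<in>\<Q>. integrable Q outcome1"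
    \<comment> \<open>A single integrable law makes both extremal laws admissible in the infimum and
      supremum over laws with an existing mean, so the bounds are attained there too.\<close>
    note ql' = Ql(3)[OF ex] and qu' = Qu(3)[OF ex]
    note el = model_mean[OF Ql(1) ql' Ql(2)] and eu = model_mean[OF Qu(1) qu' Qu(2)]
    have lower: "ext_integral P (impute ?l) \<le> ext_integral Q outcome1"
      and upper: "ext_integral Q outcome1 \<le> ext_integral P (impute ?u)"
      if Q: "Q \<in> \<Q>" "quasi_integrable Q outcome1" for Q
    proof -
      \<comment> \<open>Through a version g of its conditional mean, the mean under \<open>Q\<close>
        becomes the mean of \<open>impute g\<close> under \<open>P\<close>, and the almost-sure
        order between g and the two bounds carries over.\<close>
      obtain g where g: "is_cond_mean_untreated Q g" using cond_mean_exists[OF Q(1)] .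
      show "ext_integral P (impute ?l) \<le> ext_integral Q outcome1" "ext_integral Q outcome1 \<le> ext_integral P (impute ?u)"
        unfolding model_mean(2)[OF Q g]
        by (intro ext_integral_mono_AE impute_mono_AE bl[OF Q(1) g] bu[OF Q(1) g])+
    qed
    have "(INF Q \<in> {Q \<in> \<Q>. quasi_integrable Q outcome1}. ext_integral Q outcome1) = ext_integral P (impute ?l)"
    proof (rule antisym)
      show "(INF Q \<in> {Q \<in> \<Q>. quasi_integrable Q outcome1}. ext_integral Q outcome1) \<le> ext_integral P (impute ?l)"
        unfolding el(2)[symmetric] using Ql(1) ql' by (intro INF_lower) auto
    qed (auto intro!: INF_greatest lower)
    moreover have "(SUP Q \<in> {Q \<in> \<Q>. quasi_integrable Q outcome1}. ext_integral Q outcome1) = ext_integral P (impute ?u)"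
    proof (rule antisym)
      show "ext_integral P (impute ?u) \<le> (SUP Q \<in> {Q \<in> \<Q>. quasi_integrable Q outcome1}. ext_integral Q outcome1)"
        unfolding eu(2)[symmetric] using Qu(1) qu' by (intro SUP_upper) auto
    qed (auto intro!: SUP_least upper)
    ultimately have "quasi_integrable P (impute ?l) \<and>
      (INF Q \<in> {Q \<in> \<Q>. quasi_integrable Q outcome1}. ext_integral Q outcome1) = ext_integral P (impute ?l) \<and>
      quasi_integrable P (impute ?u) \<and>
      (SUP Q \<in> {Q \<in> \<Q>. quasi_integrable Q outcome1}. ext_integral Q outcome1) = ext_integral P (impute ?u)"
      using el(1) eu(1) by blast
  }
  ultimately show ?thesis by blast
qed

end
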